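(* Let $n\ge2$ and $1\le i\le n-1$. The pair $\mathcal X_i^{DD}=(M,\delta^1)$ constructed in the context, with $\delta^1=\delta^1_{\mathrm{local}}+\delta^1_{\mathrm{external}}$, is a valid $DD$ bimodule over $(\mathcal B(n),\mathcal B^!(n))$.
   Context: Let $\mathbb F=\mathbb F_2$; tensor products are over $\mathbb F$ unless indicated. **Algebras.** For $n\ge 0$, $\mathcal B(n)$ is the $\mathbb F$-path algebra of the following quiver modulo relations. Vertices: all subsets $\mathbf x\subset\{0,\dots,n\}$. For $1\le i\le n$: an arrow $R_i$ from $\mathbf x$ to $(\mathbf x\setminus\{i-1\})\cup\{i\}$ whenever $\mathbf x\cap\{i-1,i\}=\{i-1\}$; an arrow $L_i$ from $\mathbf x$ to $(\mathbf x\setminus\{i\})\cup\{i-1\}$ whenever $\mathbf x\cap\{i-1,i\}=\{i\}$; a loop $U_i$ at every $\mathbf x$. Paths are multiplied left to right: an arrow from $\mathbf x$ to $\mathbf y$ lies in $\mathbf I_{\mathbf x}\mathcal B(n)\mathbf I_{\mathbf y}$, where $\mathbf I_{\mathbf x}$ is the trivial path at $\mathbf x$. Relations, wherever composable: $[R_i,R_j]=[L_i,L_j]=[R_i,L_j]=0$ if $|i-j|>1$; $U_i$ commutes with all labels; $R_iL_i=U_i$, $L_iR_i=U_i$; $R_iR_{i+1}=0$, $L_iL_{i-1}=0$; $U_i=0$ at $\mathbf x$ if $\mathbf x\cap\{i-1,i\}=\varnothing$. The differential is zero. $\mathcal B^!(n)$ is defined in the same way with additional loops $C_i$ ($1\le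 i\le n$) at every vertex, with $C_i^2=0$, $C_i$ commuting with all labels, and differential $\partial(C_i)=U_i$ (zero on other generators, extended by the Leibniz rule). $\mathcal I(n)$ is the span of the $\mathbf I_{\mathbf x}$. A label without idempotents denotes the sum of all arrows with that label; in an expression such as $(a\otimes a')\otimes m$ only the parts compatible with idempotents are nonzero. Gradings (homological; Alexander in $\mathbb Z^{2n}=\mathbb Z\langle\tau_1,\beta_1,\dots,\tau_n,\beta_n\rangle$): in $\mathcal B(n)$, $R_i:(0;\tau_i)$, $L_i:(0;\beta_i)$, $U_i:(0;\tau_i+\beta_i)$; in $\mathcal B^!(n)$, $R_i:(1;-\beta_i)$, $L_i:(1;-\tau_i)$, $U_i:(2;-\tau_i-\beta_i)$, $C_i:(1;-\tau_i-\beta_i)$. **$DD$ bimodules.** Put $\mathcal B=\mathcal B(n)\otimes\mathcal B^!(n)$ and $\mathcal I=\mathcal I(n)\otimes\mathcal I(n)$. A $DD$ bimodule over $(\mathcal B(n),\mathcal B^!(n))$ is a $\mathbb Z\oplus\mathbb Z^{2n}$-graded left $\mathcal I$-module $M$ with an $\mathcal I$-linear map $\delta^1:M\to\mathcal B\otimes_{\mathcal I}M$ which preserves the Alexander degree and raises the homological degree by $1$, such that $(\partial\otimes\mathrm{id})\circ\delta^1+(\mu\otimes\mathrm{id})\circ(\mathrm{id}\otimes\delta^1)\circ\delta^1=0$, with $\partial,\mu$ the differential and multiplication of $\mathcal B$. **Local bimodule $\mathcal X^{DD}$ over $(\mathcal B(2),\mathcal B^!(2))$.** Write $A=\{0\},B=\{1\},C=\{2\},AB=\{0,1\}$,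 etc., for subsets of $\{0,1,2\}$; "$(\mathbf x|\mathbf y)$" means first idempotent $\mathbf I_{\mathbf x}$ and second idempotent $\mathbf I_{\mathbf y}$. Basis: * $z_1=S^-_t,\ z_2=S^-_b,\ z_3=S^+_b,\ z_4=S^+_t$, all $(\varnothing|ABC)$; * $x_1=S^-_t\,(A|BC)$, $x_2=S^-_t\,(C|AB)$, $x_3=W_t\,(B|BC)$, $x_4=S^-_b\,(A|BC)$, $x_5=S^-_b\,(C|AB)$, $x_6=E_b\,(B|AB)$, $x_7=W_b\,(B|BC)$, $x_8=S^+_b\,(A|BC)$, $x_9=S^+_b\,(C|AB)$, $x_{10}=E_t\,(B|AB)$, $x_{11}=S^+_t\,(A|BC)$, $x_{12}=S^+_t\,(C|AB)$; * $y_1=S^-_t\,(AC|B)$, $y_2=W_t\,(BC|B)$, $y_3=S^-_b\,(AC|B)$, $y_4=E_b\,(AB|B)$, $y_5=W_b\,(BC|B)$, $y_6=S^+_b\,(AC|B)$, $y_7=E_t\,(AB|B)$, $y_8=S^+_t\,(AC|B)$. Gradings by type (homological; Alexander in $\mathbb Z^4$): $S^-_t:(1;0)$, $W_t:(0;\beta_1)$, $S^-_b:(0;\tau_2+\beta_2)$, $E_b:(0;\tau_2)$, $W_b:(-1;\tau_2+\beta_1+\beta_2)$, $S^+_b:(-1;\tau_2+\beta_2)$, $E_t:(-1;\tau_1+\tau_2+\beta_1)$, $S^+_t:(-2;\tau_1+\tau_2+\beta_1+\beta_2)$. The operation $\delta^1_{\mathrm{loc}}$ (a tensor factor $1$ denotes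 the appropriate idempotent; $\delta^1_{\mathrm{loc}}$ is zero on basis elements not listed): $z_3\mapsto(1\otimes1)z_2$; $x_1\mapsto(R_1\otimes L_1L_2)x_6+(R_1\otimes U_1C_2)x_7+(U_1\otimes U_1C_2)x_8$; $x_2\mapsto(L_2\otimes R_2R_1)x_3+(L_2\otimes C_1U_2)x_{10}$; $x_3\mapsto(L_1\otimes1)x_1+(1\otimes L_1L_2)x_{10}+(L_1\otimes U_1C_2)x_{11}$; $x_5\mapsto(U_2\otimes1)x_2+(L_2\otimes R_2R_1)x_7+(U_2\otimes C_1U_2)x_{12}$; $x_6\mapsto(R_2\otimes1)x_2+(1\otimes R_2R_1)x_7+(L_1\otimes R_2R_1)x_8+(R_2\otimes C_1U_2)x_{12}$; $x_7\mapsto(U_2\otimes1)x_3+(L_1\otimes1)x_4+(R_2\otimes L_1L_2)x_{12}$; $x_8\mapsto(1\otimes1)x_4$; $x_9\mapsto(1\otimes1)x_5+(L_2\otimes1)x_6$; $x_{10}\mapsto(U_1\otimes1)x_6+(L_1\otimes R_2R_1)x_{11}$; $x_{11}\mapsto(R_1\otimes1)x_7+(U_1\otimes1)x_8$; $x_{12}\mapsto(L_2\otimes1)x_{10}$; $y_1\mapsto(R_1U_2\otimes C_1C_2)y_2+(L_2U_1\otimes C_1C_2)y_4+(R_1\otimes U_1C_2)y_5+(U_1\otimes U_1C_2)y_6+(L_2\otimes C_1U_2)y_7$; $y_2\mapsto(L_1\otimes1)y_1+(L_1L_2\otimes C_1C_2)y_7+(L_1\otimes U_1C_2)y_8$; $y_3\mapsto(U_2\otimes1)y_1+(R_1U_2\otimes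 C_1C_2)y_5+(U_1U_2\otimes C_1C_2)y_6+(U_2\otimes C_1U_2)y_8$; $y_4\mapsto(R_2\otimes1)y_1+(R_2R_1\otimes C_1C_2)y_5+(R_2U_1\otimes C_1C_2)y_6+(R_2\otimes C_1U_2)y_8$; $y_5\mapsto(U_2\otimes1)y_2+(L_1\otimes1)y_3+(L_1U_2\otimes C_1C_2)y_8$; $y_6\mapsto(1\otimes1)y_3+(L_2\otimes1)y_4$; $y_7\mapsto(R_2R_1\otimes1)y_2+(U_1\otimes1)y_4+(R_2U_1\otimes C_1C_2)y_8$; $y_8\mapsto(R_1\otimes1)y_5+(U_1\otimes1)y_6+(L_2\otimes1)y_7$. **Global module $M$.** Fix $n\ge2$, $1\le i\le n-1$. Let $S_{\mathrm{ext}}=\{0,\dots,i-2\}\cup\{i+2,\dots,n\}$; an external I-state is a subset $\mathbf x_{\mathrm{ext}}\subset S_{\mathrm{ext}}$. $M$ is the direct sum over all external I-states of copies of $\mathcal X^{DD}$, with basis the pairs $m=(\mathbf x_{\mathrm{ext}},m_{\mathrm{loc}})$, $m_{\mathrm{loc}}$ a basis element of $\mathcal X^{DD}$. If $m_{\mathrm{loc}}$ is $(\mathbf a|\mathbf b)$, then $m$ has first idempotent $\mathbf I_{\mathbf x_1}$ and second idempotent $\mathbf I_{\mathbf x_2}$ with $\mathbf x_1=\{j+i-1:j\in\mathbf a\}\cup\mathbf x_{\mathrm{ext}}$ and $\mathbf x_2=\{j+i-1:j\in\mathbf b\}\cup(S_{\mathrm{ext}}\setminus\mathbf x_{\mathrm{ext}})$.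 The degrees of $m$ are those of $m_{\mathrm{loc}}$, under $\mathbb Z^4\to\mathbb Z^{2n}$, $\tau_1,\beta_1,\tau_2,\beta_2\mapsto\tau_i,\beta_i,\tau_{i+1},\beta_{i+1}$. **Local differential.** For each $\mathbf x_{\mathrm{ext}}$ let $\iota_{\mathbf x_{\mathrm{ext}}}:\mathcal B(2)\otimes\mathcal B^!(2)\to\mathcal B$ be the (non-unital) dg algebra map that on the first (resp. second) factor sends a vertex $\mathbf x$ to $\{j+i-1:j\in\mathbf x\}\cup\mathbf x_{\mathrm{ext}}$ (resp. $\{j+i-1:j\in\mathbf x\}\cup(S_{\mathrm{ext}}\setminus\mathbf x_{\mathrm{ext}})$), and arrows $R_j,L_j,U_j,C_j$ to $R_{i+j-1},L_{i+j-1},U_{i+j-1},C_{i+j-1}$. Then $\delta^1_{\mathrm{local}}(\mathbf x_{\mathrm{ext}},m_{\mathrm{loc}})=\sum\iota_{\mathbf x_{\mathrm{ext}}}(a\otimes a')\otimes(\mathbf x_{\mathrm{ext}},m')$, where $\delta^1_{\mathrm{loc}}(m_{\mathrm{loc}})=\sum(a\otimes a')\otimes m'$. **External differential.** For $j\in\{1,\dots,n\}\setminus\{i,i+1\}$, $\delta^1_{\mathrm{ext},\mathrm{unmoving},j}(m)=(U_j\otimes C_j)\otimes m$. For a basis element $m$ with idempotents $\mathbf I_{\mathbf x_1},\mathbf I_{\mathbf x_2}$: $m\in A_j$ if $j-1\in\mathbf x_1$, $j-1\notin\mathbf x_2$, $j\notin\mathbf x_1$, $j\in\mathbf x_2$;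 $m\in B_j$ if $j\in\mathbf x_1$, $j\notin\mathbf x_2$, $j-1\notin\mathbf x_1$, $j-1\in\mathbf x_2$; otherwise $m\in C_j$. Let $\sigma_j:A_j\to B_j$ be the bijection sending $m$ to its counterpart, i.e. the basis element of the same type ($S^\pm_t,S^\pm_b,W_t,W_b,E_t,E_b$) whose first and second idempotents are obtained from those of $m$ by replacing $j-1$ by $j$ in $\mathbf x_1$ and $j$ by $j-1$ in $\mathbf x_2$; let $\tau_j=\sigma_j^{-1}$. Set $\delta^1_{\mathrm{ext},\mathrm{moving},j}(m)=(R_j\otimes L_j)\otimes\sigma_j(m)$ if $m\in A_j$, $(L_j\otimes R_j)\otimes\tau_j(m)$ if $m\in B_j$, and $0$ if $m\in C_j$. Finally $\delta^1_{\mathrm{external}}=\sum_{j\ne i,i+1}(\delta^1_{\mathrm{ext},\mathrm{unmoving},j}+\delta^1_{\mathrm{ext},\mathrm{moving},j})$. *)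

theory Defs
  imports
    "HOL-Algebra.QuotRing"
    "HOL-Algebra.Module"
    "HOL-Algebra.Generated_Groups"
    "HOL-Library.Poly_Mapping"
    "HOL-Library.Z2"
    "HOL-Library.Product_Plus"
begin

section \<open>Linear algebra over the field with two elements\<close>

text \<open>All vector spaces are over the field \<^typ>\<open>bit\<close>.  Hence spans are the same as generated
  additive subgroups, additive maps are linear, biadditive maps are bilinear, and there are
  no signs.\<close>

abbreviation bvec :: "'a \<Rightarrow> 'a \<Rightarrow>\<^sub>0 bit"
  where "bvec p \<equiv> Poly_Mapping.single p 1"

abbreviation gspan :: "('a, 'm) ring_scheme \<Rightarrow> 'a set \<Rightarrow> 'a set"
  where "gspan R S \<equiv> generate (add_monoid R) S"

text \<open>The vector space with basis \<open>S\<close>.  Only the additive part of the record is meaningful; the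
  multiplicative part is a dummy, replaced below whenever a product is wanted.\<close>

definition free_space :: "'a set \<Rightarrow> ('a \<Rightarrow>\<^sub>0 bit) ring"
  where "free_space S = \<lparr>carrier = {f. Poly_Mapping.keys f \<subseteq> S},
    mult = (\<lambda>_ _. 0), one = 0, zero = 0, add = (+)\<rparr>"

definition bilinear_ext :: "('a \<Rightarrow> 'b \<Rightarrow> 'c \<Rightarrow>\<^sub>0 bit) \<Rightarrow> ('a \<Rightarrow>\<^sub>0 bit) \<Rightarrow> ('b \<Rightarrow>\<^sub>0 bit) \<Rightarrow> 'c \<Rightarrow>\<^sub>0 bit"
  where "bilinear_ext \<mu> f g = (\<Sum>p\<in>Poly_Mapping.keys f. \<Sum>q\<in>Poly_Mapping.keys g. \<mu> p q)"

definition linear_ext :: "('b, 'm) ring_scheme \<Rightarrow> ('a \<Rightarrow> 'b) \<Rightarrow> ('a \<Rightarrow>\<^sub>0 bit) \<Rightarrow> 'b"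
  where "linear_ext N \<phi> f = (\<Oplus>\<^bsub>N\<^esub>p\<in>Poly_Mapping.keys f. \<phi> p)"

text \<open>The map induced on a quotient of a free space by the assignment \<open>\<phi>\<close> on basis vectors
  (meaningful when the linear extension of \<open>\<phi>\<close> is constant on cosets).\<close>

definition induced :: "('b, 'm) ring_scheme \<Rightarrow> ('a \<Rightarrow> 'b) \<Rightarrow> ('a \<Rightarrow>\<^sub>0 bit) set \<Rightarrow> 'b"
  where "induced N \<phi> X = the_elem (linear_ext N \<phi> ` X)"


section \<open>Gradings and dg algebras\<close>

datatype alex_gen = Tau nat | Beta nat

text \<open>Homological degree, then Alexander degree in the free abelian group on the
  \<open>\<tau>\<^sub>j\<close> and \<open>\<beta>\<^sub>j\<close>; \<open>degrees n\<close> only allows \<open>1 \<le> j \<le> n\<close>.\<close>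

type_synonym bidegree = "int \<times> (alex_gen \<Rightarrow>\<^sub>0 int)"

abbreviation tau :: "nat \<Rightarrow> alex_gen \<Rightarrow>\<^sub>0 int" where "tau j \<equiv> Poly_Mapping.single (Tau j) 1"
abbreviation beta :: "nat \<Rightarrow> alex_gen \<Rightarrow>\<^sub>0 int" where "beta j \<equiv> Poly_Mapping.single (Beta j) 1"

definition degrees :: "nat \<Rightarrow> bidegree set"
  where "degrees n = {(h, a). Poly_Mapping.keys a \<subseteq> Tau ` {1..n} \<union> Beta ` {1..n}}"

record 'a dga = "'a ring" +
  diff :: "'a \<Rightarrow> 'a"
  homog :: "bidegree \<Rightarrow> 'a set"


section \<open>Tensor products\<close>

definition biadditive_rels ::
  "('a, 'k) ring_scheme \<Rightarrow> ('b, 'l) ring_scheme \<Rightarrow> (('a \<times> 'b) \<Rightarrow>\<^sub>0 bit) set"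
  where "biadditive_rels A B =
    {bvec (a \<oplus>\<^bsub>A\<^esub> a', b) + bvec (a, b) + bvec (a', b) | a a' b.
       a \<in> carrier A \<and> a' \<in> carrier A \<and> b \<in> carrier B} \<union>
    {bvec (a, b \<oplus>\<^bsub>B\<^esub> b') + bvec (a, b) + bvec (a, b') | a b b'.
       a \<in> carrier A \<and> b \<in> carrier B \<and> b' \<in> carrier B}"

subsection \<open>Tensor product of dg algebras over the ground field\<close>

definition pair_algebra ::
  "('a, 'k) ring_scheme \<Rightarrow> ('b, 'l) ring_scheme \<Rightarrow> (('a \<times> 'b) \<Rightarrow>\<^sub>0 bit) ring"
  where "pair_algebra A B = (free_space (carrier A \<times> carrier B))
    \<lparr>mult := bilinear_ext (\<lambda>(a, b) (a', b'). bvec (a \<otimes>\<^bsub>A\<^esub> a', b \<otimes>\<^bsub>B\<^esub> b')),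
     one := bvec (\<one>\<^bsub>A\<^esub>, \<one>\<^bsub>B\<^esub>)\<rparr>"

definition tensor_ideal ::
  "('a, 'k) ring_scheme \<Rightarrow> ('b, 'l) ring_scheme \<Rightarrow> (('a \<times> 'b) \<Rightarrow>\<^sub>0 bit) set"
  where "tensor_ideal A B = gspan (pair_algebra A B) (biadditive_rels A B)"

definition tensor_ring ::
  "('a, 'k) ring_scheme \<Rightarrow> ('b, 'l) ring_scheme \<Rightarrow> (('a \<times> 'b) \<Rightarrow>\<^sub>0 bit) set ring"
  where "tensor_ring A B = pair_algebra A B Quot tensor_ideal A B"

definition alg_tensor ::
  "('a, 'k) ring_scheme \<Rightarrow> ('b, 'l) ring_scheme \<Rightarrow> 'a \<Rightarrow> 'b \<Rightarrow> (('a \<times> 'b) \<Rightarrow>\<^sub>0 bit) set"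
  where "alg_tensor A B a b = tensor_ideal A B +>\<^bsub>pair_algebra A B\<^esub> bvec (a, b)"

definition tensor_dga :: "'a dga \<Rightarrow> 'b dga \<Rightarrow> (('a \<times> 'b) \<Rightarrow>\<^sub>0 bit) set dga"
  where "tensor_dga A B = ring.extend (tensor_ring A B) (dga.fields
    (induced (tensor_ring A B)
      (\<lambda>(a, b). alg_tensor A B (diff A a) b \<oplus>\<^bsub>tensor_ring A B\<^esub> alg_tensor A B a (diff B b)))
    (\<lambda>d. gspan (tensor_ring A B)
      {alg_tensor A B a b | a b. \<exists>d\<^sub>1 d\<^sub>2. a \<in> homog A d\<^sub>1 \<and> b \<in> homog B d\<^sub>2 \<and> d\<^sub>1 + d\<^sub>2 = d}))"

subsection \<open>Tensor product of an algebra with a left module over a subring\<close>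

text \<open>Here \<open>K\<close> is a subring of the algebra \<open>A\<close>, which acts on \<open>A\<close> from the right by multiplication,
  and \<open>M\<close> is a left \<open>K\<close>-module.  The result is a left \<open>A\<close>-module, hence also a left \<open>K\<close>-module.\<close>

definition mod_tensor_kernel ::
  "('a, 'k) ring_scheme \<Rightarrow> ('a, 'l) ring_scheme \<Rightarrow> ('a, 'b, 'm) module_scheme \<Rightarrow>
   (('a \<times> 'b) \<Rightarrow>\<^sub>0 bit) set"
  where "mod_tensor_kernel K A M = gspan (free_space (carrier A \<times> carrier M))
    (biadditive_rels A M \<union>
     {bvec (a \<otimes>\<^bsub>A\<^esub> k, x) + bvec (a, k \<odot>\<^bsub>M\<^esub> x) | a k x.
        a \<in> carrier A \<and> k \<in> carrier K \<and> x \<in> carrier M})"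

definition mod_tensor ::
  "('a, 'k) ring_scheme \<Rightarrow> ('a, 'l) ring_scheme \<Rightarrow> ('a, 'b, 'm) module_scheme \<Rightarrow>
   'a \<Rightarrow> 'b \<Rightarrow> (('a \<times> 'b) \<Rightarrow>\<^sub>0 bit) set"
  where "mod_tensor K A M a x =
    mod_tensor_kernel K A M +>\<^bsub>free_space (carrier A \<times> carrier M)\<^esub> bvec (a, x)"

definition tensor_group ::
  "('a, 'k) ring_scheme \<Rightarrow> ('a, 'l) ring_scheme \<Rightarrow> ('a, 'b, 'm) module_scheme \<Rightarrow>
   (('a \<times> 'b) \<Rightarrow>\<^sub>0 bit) set ring"
  where "tensor_group K A M = free_space (carrier A \<times> carrier M) Quot mod_tensor_kernel K A M"

definition tensor_module ::
  "('a, 'k) ring_scheme \<Rightarrow> ('a, 'l) ring_scheme \<Rightarrow> ('a, 'b, 'm) module_scheme \<Rightarrow>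
   ('a, (('a \<times> 'b) \<Rightarrow>\<^sub>0 bit) set) module"
  where "tensor_module K A M = ring.extend (tensor_group K A M) (module.fields
    (\<lambda>a. induced (tensor_group K A M) (\<lambda>(b, x). mod_tensor K A M (a \<otimes>\<^bsub>A\<^esub> b) x)))"

definition tensor_homog ::
  "('a, 'k) ring_scheme \<Rightarrow> 'a dga \<Rightarrow> ('a, 'b) module \<Rightarrow> (bidegree \<Rightarrow> 'b set) \<Rightarrow>
   bidegree \<Rightarrow> (('a \<times> 'b) \<Rightarrow>\<^sub>0 bit) set set"
  where "tensor_homog K A M gr d = gspan (tensor_module K A M)
    {mod_tensor K A M a x | a x. \<exists>d\<^sub>1 d\<^sub>2. a \<in> homog A d\<^sub>1 \<and> x \<in> gr d\<^sub>2 \<and> d\<^sub>1 + d\<^sub>2 = d}"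


section \<open>Type D structures over a dg algebra\<close>

definition graded_module ::
  "bidegree set \<Rightarrow> ('a, 'k) ring_scheme \<Rightarrow> ('a, 'b) module \<Rightarrow> (bidegree \<Rightarrow> 'b set) \<Rightarrow> bool"
  where "graded_module D K M gr \<longleftrightarrow>
    module K M \<and>
    (\<forall>d\<in>D. subgroup (gr d) (add_monoid M)) \<and>
    (\<forall>d\<in>D. \<forall>k\<in>carrier K. \<forall>x\<in>gr d. k \<odot>\<^bsub>M\<^esub> x \<in> gr d) \<and>
    (\<forall>x\<in>carrier M. \<exists>!c. (\<forall>d\<in>D. c d \<in> gr d) \<and> (\<forall>d. d \<notin> D \<longrightarrow> c d = \<zero>\<^bsub>M\<^esub>) \<and>
       finite {d. c d \<noteq> \<zero>\<^bsub>M\<^esub>} \<and> x = (\<Oplus>\<^bsub>M\<^esub>d\<in>{d. c d \<noteq> \<zero>\<^bsub>M\<^esub>}. c d))"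

text \<open>The maps \<open>\<partial> \<otimes> id\<close>, \<open>id \<otimes> \<delta>\<close> and \<open>\<mu> \<otimes> id\<close>.  The last one is defined on
  \<open>A \<otimes> (A \<otimes> M)\<close> and sends \<open>a \<otimes> (b \<otimes> x)\<close> to \<open>ab \<otimes> x\<close>; the associativity isomorphism is
  left implicit.\<close>

definition diff_tensor_id ::
  "('a, 'k) ring_scheme \<Rightarrow> 'a dga \<Rightarrow> ('a, 'b) module \<Rightarrow>
   (('a \<times> 'b) \<Rightarrow>\<^sub>0 bit) set \<Rightarrow> (('a \<times> 'b) \<Rightarrow>\<^sub>0 bit) set"
  where "diff_tensor_id K A M =
    induced (tensor_module K A M) (\<lambda>(a, x). mod_tensor K A M (diff A a) x)"

definition id_tensor_delta ::
  "('a, 'k) ring_scheme \<Rightarrow> 'a dga \<Rightarrow> ('a, 'b) module \<Rightarrow> ('b \<Rightarrow> (('a \<times> 'b) \<Rightarrow>\<^sub>0 bit) set) \<Rightarrow>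
   (('a \<times> 'b) \<Rightarrow>\<^sub>0 bit) set \<Rightarrow> (('a \<times> (('a \<times> 'b) \<Rightarrow>\<^sub>0 bit) set) \<Rightarrow>\<^sub>0 bit) set"
  where "id_tensor_delta K A M \<delta> =
    induced (tensor_module K A (tensor_module K A M))
      (\<lambda>(a, x). mod_tensor K A (tensor_module K A M) a (\<delta> x))"

definition mult_tensor_id ::
  "('a, 'k) ring_scheme \<Rightarrow> 'a dga \<Rightarrow> ('a, 'b) module \<Rightarrow>
   (('a \<times> (('a \<times> 'b) \<Rightarrow>\<^sub>0 bit) set) \<Rightarrow>\<^sub>0 bit) set \<Rightarrow> (('a \<times> 'b) \<Rightarrow>\<^sub>0 bit) set"
  where "mult_tensor_id K A M =
    induced (tensor_module K A M) (\<lambda>(a, y). a \<odot>\<^bsub>tensor_module K A M\<^esub> y)"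

definition type_D_structure ::
  "bidegree set \<Rightarrow> ('a, 'k) ring_scheme \<Rightarrow> 'a dga \<Rightarrow> ('a, 'b) module \<Rightarrow> (bidegree \<Rightarrow> 'b set) \<Rightarrow>
   ('b \<Rightarrow> (('a \<times> 'b) \<Rightarrow>\<^sub>0 bit) set) \<Rightarrow> bool"
  where "type_D_structure D K A M gr \<delta> \<longleftrightarrow>
    (let T = tensor_module K A M in
      graded_module D K M gr \<and>
      \<delta> \<in> carrier M \<rightarrow> carrier T \<and>
      (\<forall>x\<in>carrier M. \<forall>y\<in>carrier M. \<delta> (x \<oplus>\<^bsub>M\<^esub> y) = \<delta> x \<oplus>\<^bsub>T\<^esub> \<delta> y) \<and>
      (\<forall>k\<in>carrier K. \<forall>x\<in>carrier M. \<delta> (k \<odot>\<^bsub>M\<^esub> x) = k \<odot>\<^bsub>T\<^esub> \<delta> x) \<and>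
      (\<forall>(h, a)\<in>D. \<forall>x\<in>gr (h, a). \<delta> x \<in> tensor_homog K A M gr (h + 1, a)) \<and>
      (\<forall>x\<in>carrier M.
         diff_tensor_id K A M (\<delta> x) \<oplus>\<^bsub>T\<^esub>
         mult_tensor_id K A M (id_tensor_delta K A M \<delta> (\<delta> x)) = \<zero>\<^bsub>T\<^esub>))"


section \<open>The algebras\<close>

datatype label = RR (idx: nat) | LL (idx: nat) | is_UU: UU (idx: nat) | is_CC: CC (idx: nat)

text \<open>Throughout, the flag \<open>s\<close> selects \<open>\<B>(n)\<close> (\<open>s = False\<close>) or \<open>\<B>\<^sup>!(n)\<close> (\<open>s = True\<close>).\<close>

definition labels :: "bool \<Rightarrow> nat \<Rightarrow> label set"
  where "labels s n = {l. 1 \<le> idx l \<and> idx l \<le> n \<and> (is_CC l \<longrightarrow> s)}"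

fun has_arrow :: "nat set \<Rightarrow> label \<Rightarrow> bool" where
  "has_arrow x (RR i) \<longleftrightarrow> x \<inter> {i - 1, i} = {i - 1}"
| "has_arrow x (LL i) \<longleftrightarrow> x \<inter> {i - 1, i} = {i}"
| "has_arrow x (UU i) \<longleftrightarrow> True"
| "has_arrow x (CC i) \<longleftrightarrow> True"

fun arrow_target :: "nat set \<Rightarrow> label \<Rightarrow> nat set" where
  "arrow_target x (RR i) = (x - {i - 1}) \<union> {i}"
| "arrow_target x (LL i) = (x - {i}) \<union> {i - 1}"
| "arrow_target x (UU i) = x"
| "arrow_target x (CC i) = x"

text \<open>An arrow is determined by its source and its label, so a path is represented by its source
  and its word of labels, read from left to right.\<close>

type_synonym path = "nat set \<times> label list"

fun composable :: "nat set \<Rightarrow> label list \<Rightarrow> bool" where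
  "composable x [] \<longleftrightarrow> True"
| "composable x (l # w) \<longleftrightarrow> has_arrow x l \<and> composable (arrow_target x l) w"

definition paths :: "bool \<Rightarrow> nat \<Rightarrow> path set"
  where "paths s n = {(x, w). x \<subseteq> {0..n} \<and> set w \<subseteq> labels s n \<and> composable x w}"

definition path_end :: "path \<Rightarrow> nat set"
  where "path_end p = foldl arrow_target (fst p) (snd p)"

definition path_mult :: "path \<Rightarrow> path \<Rightarrow> path \<Rightarrow>\<^sub>0 bit"
  where "path_mult p q = (if path_end p = fst q then bvec (fst p, snd p @ snd q) else 0)"

definition path_algebra :: "bool \<Rightarrow> nat \<Rightarrow> (path \<Rightarrow>\<^sub>0 bit) ring"
  where "path_algebra s n = (free_space (paths s n))
    \<lparr>mult := bilinear_ext path_mult, one := (\<Sum>x\<in>Pow {0..n}. bvec (x, []))\<rparr>"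

definition commuting :: "label \<Rightarrow> label \<Rightarrow> bool"
  where "commuting a b \<longleftrightarrow> is_UU a \<or> is_UU b \<or> is_CC a \<or> is_CC b \<or> \<bar>int (idx a) - int (idx b)\<bar> > 1"

definition relations :: "bool \<Rightarrow> nat \<Rightarrow> (path \<Rightarrow>\<^sub>0 bit) set"
  where "relations s n =
    {bvec (x, [a, b]) + bvec (x, [b, a]) | x a b.
       (x, [a, b]) \<in> paths s n \<and> (x, [b, a]) \<in> paths s n \<and> commuting a b} \<union>
    {bvec (x, [RR i, LL i]) + bvec (x, [UU i]) | x i. (x, [RR i, LL i]) \<in> paths s n} \<union>
    {bvec (x, [LL i, RR i]) + bvec (x, [UU i]) | x i. (x, [LL i, RR i]) \<in> paths s n} \<union>
    {bvec (x, [RR i, RR (i + 1)]) | x i. (x, [RR i, RR (i + 1)]) \<in> paths s n} \<union>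
    {bvec (x, [LL i, LL (i - 1)]) | x i. (x, [LL i, LL (i - 1)]) \<in> paths s n} \<union>
    {bvec (x, [UU i]) | x i. (x, [UU i]) \<in> paths s n \<and> x \<inter> {i - 1, i} = {}} \<union>
    {bvec (x, [CC i, CC i]) | x i. (x, [CC i, CC i]) \<in> paths s n}"

definition rel_ideal :: "bool \<Rightarrow> nat \<Rightarrow> (path \<Rightarrow>\<^sub>0 bit) set"
  where "rel_ideal s n = Idl\<^bsub>path_algebra s n\<^esub> (relations s n)"

text \<open>The derivation with \<open>\<partial>(C\<^sub>i) = U\<^sub>i\<close>; it vanishes on paths without letters \<open>C\<^sub>i\<close>, in
  particular on all paths for \<open>\<B>(n)\<close>.\<close>

definition path_diff :: "path \<Rightarrow> path \<Rightarrow>\<^sub>0 bit"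
  where "path_diff p = (\<Sum>k<length (snd p).
    case snd p ! k of CC i \<Rightarrow> bvec (fst p, (snd p)[k := UU i]) | _ \<Rightarrow> 0)"

fun label_degree :: "bool \<Rightarrow> label \<Rightarrow> bidegree" where
  "label_degree False (RR i) = (0, tau i)"
| "label_degree False (LL i) = (0, beta i)"
| "label_degree False (UU i) = (0, tau i + beta i)"
| "label_degree False (CC i) = 0"  \<comment> \<open>irrelevant: there is no \<open>C\<^sub>i\<close> in \<open>\<B>(n)\<close>\<close>
| "label_degree True (RR i) = (1, - beta i)"
| "label_degree True (LL i) = (1, - tau i)"
| "label_degree True (UU i) = (2, - tau i - beta i)"
| "label_degree True (CC i) = (1, - tau i - beta i)"

definition path_degree :: "bool \<Rightarrow> path \<Rightarrow> bidegree"
  where "path_degree s p = sum_list (map (label_degree s) (snd p))"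

definition quiver_class :: "bool \<Rightarrow> nat \<Rightarrow> (path \<Rightarrow>\<^sub>0 bit) \<Rightarrow> (path \<Rightarrow>\<^sub>0 bit) set"
  where "quiver_class s n f = rel_ideal s n +>\<^bsub>path_algebra s n\<^esub> f"

definition quiver_ring :: "bool \<Rightarrow> nat \<Rightarrow> (path \<Rightarrow>\<^sub>0 bit) set ring"
  where "quiver_ring s n = path_algebra s n Quot rel_ideal s n"

definition quiver_dga :: "bool \<Rightarrow> nat \<Rightarrow> (path \<Rightarrow>\<^sub>0 bit) set dga"
  where "quiver_dga s n = ring.extend (quiver_ring s n) (dga.fields
    (induced (quiver_ring s n) (\<lambda>p. quiver_class s n (path_diff p)))
    (\<lambda>d. gspan (quiver_ring s n)
       {quiver_class s n (bvec p) | p. p \<in> paths s n \<and> path_degree s p = d}))"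

abbreviation Balg :: "nat \<Rightarrow> (path \<Rightarrow>\<^sub>0 bit) set dga"
  where "Balg n \<equiv> quiver_dga False n"

abbreviation Bshriek :: "nat \<Rightarrow> (path \<Rightarrow>\<^sub>0 bit) set dga"
  where "Bshriek n \<equiv> quiver_dga True n"

type_synonym bb_elem = "(((path \<Rightarrow>\<^sub>0 bit) set \<times> (path \<Rightarrow>\<^sub>0 bit) set) \<Rightarrow>\<^sub>0 bit) set"

definition BB :: "nat \<Rightarrow> bb_elem dga"
  where "BB n = tensor_dga (Balg n) (Bshriek n)"

text \<open>\<open>bb_tensor n f g\<close> is \<open>[f] \<otimes> [g]\<close> for elements \<open>f\<close>, \<open>g\<close> of the two path algebras.\<close>

definition bb_tensor :: "nat \<Rightarrow> (path \<Rightarrow>\<^sub>0 bit) \<Rightarrow> (path \<Rightarrow>\<^sub>0 bit) \<Rightarrow> bb_elem"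
  where "bb_tensor n f g =
    alg_tensor (Balg n) (Bshriek n) (quiver_class False n f) (quiver_class True n g)"

definition bb_idem :: "nat \<Rightarrow> nat set \<Rightarrow> nat set \<Rightarrow> bb_elem"
  where "bb_idem n x y = bb_tensor n (bvec (x, [])) (bvec (y, []))"

definition idem_ring :: "nat \<Rightarrow> bb_elem dga"
  where "idem_ring n = (BB n)
    \<lparr>carrier := gspan (BB n) {bb_idem n x y | x y. x \<subseteq> {0..n} \<and> y \<subseteq> {0..n}}\<rparr>"

definition DD_bimodule ::
  "nat \<Rightarrow> (bb_elem, 'b) module \<Rightarrow> (bidegree \<Rightarrow> 'b set) \<Rightarrow>
   ('b \<Rightarrow> ((bb_elem \<times> 'b) \<Rightarrow>\<^sub>0 bit) set) \<Rightarrow> bool"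
  where "DD_bimodule n M gr \<delta> \<longleftrightarrow> type_D_structure (degrees n) (idem_ring n) (BB n) M gr \<delta>"


section \<open>The local bimodule\<close>

datatype kind = S_minus_t | S_minus_b | S_plus_b | S_plus_t | W_t | W_b | E_t | E_b

datatype xgen =
    Z1 | Z2 | Z3 | Z4
  | X1 | X2 | X3 | X4 | X5 | X6 | X7 | X8 | X9 | X10 | X11 | X12
  | Y1 | Y2 | Y3 | Y4 | Y5 | Y6 | Y7 | Y8

fun gen_data :: "xgen \<Rightarrow> kind \<times> nat set \<times> nat set" where
  "gen_data Z1  = (S_minus_t, {}, {0, 1, 2})"
| "gen_data Z2  = (S_minus_b, {}, {0, 1, 2})"
| "gen_data Z3  = (S_plus_b,  {}, {0, 1, 2})"
| "gen_data Z4  = (S_plus_t,  {}, {0, 1, 2})"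
| "gen_data X1  = (S_minus_t, {0}, {1, 2})"
| "gen_data X2  = (S_minus_t, {2}, {0, 1})"
| "gen_data X3  = (W_t,       {1}, {1, 2})"
| "gen_data X4  = (S_minus_b, {0}, {1, 2})"
| "gen_data X5  = (S_minus_b, {2}, {0, 1})"
| "gen_data X6  = (E_b,       {1}, {0, 1})"
| "gen_data X7  = (W_b,       {1}, {1, 2})"
| "gen_data X8  = (S_plus_b,  {0}, {1, 2})"
| "gen_data X9  = (S_plus_b,  {2}, {0, 1})"
| "gen_data X10 = (E_t,       {1}, {0, 1})"
| "gen_data X11 = (S_plus_t,  {0}, {1, 2})"
| "gen_data X12 = (S_plus_t,  {2}, {0, 1})"
| "gen_data Y1  = (S_minus_t, {0, 2}, {1})"
| "gen_data Y2  = (W_t,       {1, 2}, {1})"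
| "gen_data Y3  = (S_minus_b, {0, 2}, {1})"
| "gen_data Y4  = (E_b,       {0, 1}, {1})"
| "gen_data Y5  = (W_b,       {1, 2}, {1})"
| "gen_data Y6  = (S_plus_b,  {0, 2}, {1})"
| "gen_data Y7  = (E_t,       {0, 1}, {1})"
| "gen_data Y8  = (S_plus_t,  {0, 2}, {1})"

abbreviation gen_kind :: "xgen \<Rightarrow> kind" where "gen_kind g \<equiv> fst (gen_data g)"
abbreviation gen_idem1 :: "xgen \<Rightarrow> nat set" where "gen_idem1 g \<equiv> fst (snd (gen_data g))"
abbreviation gen_idem2 :: "xgen \<Rightarrow> nat set" where "gen_idem2 g \<equiv> snd (snd (gen_data g))"

text \<open>Degrees of the generators in the \<open>i\<close>-th global bimodule, i.e. with the indices 1, 2 of the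
  local Alexander degrees already replaced by \<open>i\<close>, \<open>i + 1\<close>.\<close>

fun kind_degree :: "nat \<Rightarrow> kind \<Rightarrow> bidegree" where
  "kind_degree i S_minus_t = (1, 0)"
| "kind_degree i W_t       = (0, beta i)"
| "kind_degree i S_minus_b = (0, tau (i + 1) + beta (i + 1))"
| "kind_degree i E_b       = (0, tau (i + 1))"
| "kind_degree i W_b       = (- 1, tau (i + 1) + beta i + beta (i + 1))"
| "kind_degree i S_plus_b  = (- 1, tau (i + 1) + beta (i + 1))"
| "kind_degree i E_t       = (- 1, tau i + tau (i + 1) + beta i)"
| "kind_degree i S_plus_t  = (- 2, tau i + tau (i + 1) + beta i + beta (i + 1))"

text \<open>\<open>(v, w, g') \<in> delta_loc g\<close> encodes the summand \<open>(v \<otimes> w) \<otimes> g'\<close>; the empty word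
  stands for the tensor factor 1.\<close>

fun delta_loc :: "xgen \<Rightarrow> (label list \<times> label list \<times> xgen) set" where
  "delta_loc Z1 = {}"
| "delta_loc Z2 = {}"
| "delta_loc Z3 = {([], [], Z2)}"
| "delta_loc Z4 = {}"
| "delta_loc X1 = {([RR 1], [LL 1, LL 2], X6), ([RR 1], [UU 1, CC 2], X7),
                   ([UU 1], [UU 1, CC 2], X8)}"
| "delta_loc X2 = {([LL 2], [RR 2, RR 1], X3), ([LL 2], [CC 1, UU 2], X10)}"
| "delta_loc X3 = {([LL 1], [], X1), ([], [LL 1, LL 2], X10), ([LL 1], [UU 1, CC 2], X11)}"
| "delta_loc X4 = {}"
| "delta_loc X5 = {([UU 2], [], X2), ([LL 2], [RR 2, RR 1], X7), ([UU 2], [CC 1, UU 2], X12)}"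
| "delta_loc X6 = {([RR 2], [], X2), ([], [RR 2, RR 1], X7), ([LL 1], [RR 2, RR 1], X8),
                   ([RR 2], [CC 1, UU 2], X12)}"
| "delta_loc X7 = {([UU 2], [], X3), ([LL 1], [], X4), ([RR 2], [LL 1, LL 2], X12)}"
| "delta_loc X8 = {([], [], X4)}"
| "delta_loc X9 = {([], [], X5), ([LL 2], [], X6)}"
| "delta_loc X10 = {([UU 1], [], X6), ([LL 1], [RR 2, RR 1], X11)}"
| "delta_loc X11 = {([RR 1], [], X7), ([UU 1], [], X8)}"
| "delta_loc X12 = {([LL 2], [], X10)}"
| "delta_loc Y1 = {([RR 1, UU 2], [CC 1, CC 2], Y2), ([LL 2, UU 1], [CC 1, CC 2], Y4),
                   ([RR 1], [UU 1, CC 2], Y5), ([UU 1], [UU 1, CC 2], Y6),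
                   ([LL 2], [CC 1, UU 2], Y7)}"
| "delta_loc Y2 = {([LL 1], [], Y1), ([LL 1, LL 2], [CC 1, CC 2], Y7),
                   ([LL 1], [UU 1, CC 2], Y8)}"
| "delta_loc Y3 = {([UU 2], [], Y1), ([RR 1, UU 2], [CC 1, CC 2], Y5),
                   ([UU 1, UU 2], [CC 1, CC 2], Y6), ([UU 2], [CC 1, UU 2], Y8)}"
| "delta_loc Y4 = {([RR 2], [], Y1), ([RR 2, RR 1], [CC 1, CC 2], Y5),
                   ([RR 2, UU 1], [CC 1, CC 2], Y6), ([RR 2], [CC 1, UU 2], Y8)}"
| "delta_loc Y5 = {([UU 2], [], Y2), ([LL 1], [], Y3), ([LL 1, UU 2], [CC 1, CC 2], Y8)}"
| "delta_loc Y6 = {([], [], Y3), ([LL 2], [], Y4)}"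
| "delta_loc Y7 = {([RR 2, RR 1], [], Y2), ([UU 1], [], Y4), ([RR 2, UU 1], [CC 1, CC 2], Y8)}"
| "delta_loc Y8 = {([RR 1], [], Y5), ([UU 1], [], Y6), ([LL 2], [], Y7)}"


section \<open>The global bimodule\<close>

definition S_ext :: "nat \<Rightarrow> nat \<Rightarrow> nat set"
  where "S_ext n i = {j. j \<le> n \<and> (j + 2 \<le> i \<or> i + 2 \<le> j)}"

type_synonym basis_elem = "nat set \<times> xgen"

definition X_basis :: "nat \<Rightarrow> nat \<Rightarrow> basis_elem set"
  where "X_basis n i = {(xe, g). xe \<subseteq> S_ext n i}"

definition shift_set :: "nat \<Rightarrow> nat set \<Rightarrow> nat set"
  where "shift_set i a = (\<lambda>j. j + i - 1) ` a"

definition idem1 :: "nat \<Rightarrow> basis_elem \<Rightarrow> nat set"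
  where "idem1 i m = shift_set i (gen_idem1 (snd m)) \<union> fst m"

definition idem2 :: "nat \<Rightarrow> nat \<Rightarrow> basis_elem \<Rightarrow> nat set"
  where "idem2 n i m = shift_set i (gen_idem2 (snd m)) \<union> (S_ext n i - fst m)"

text \<open>For \<open>e\<close> in the idempotent ring and \<open>\<iota> = I\<^sub>x \<otimes> I\<^sub>y\<close> the idempotent of a basis element \<open>m\<close>, the
  product \<open>e\<iota>\<close> is \<open>\<iota>\<close> or 0 according to whether \<open>I\<^sub>x \<otimes> I\<^sub>y\<close> occurs in \<open>e\<close>; correspondingly \<open>e\<close>
  acts on \<open>m\<close> by 1 or 0.\<close>

definition X_module :: "nat \<Rightarrow> nat \<Rightarrow> (bb_elem, basis_elem \<Rightarrow>\<^sub>0 bit) module"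
  where "X_module n i = ring.extend (free_space (X_basis n i)) (module.fields
    (\<lambda>e f. \<Sum>m\<in>Poly_Mapping.keys f.
       if e \<otimes>\<^bsub>BB n\<^esub> bb_idem n (idem1 i m) (idem2 n i m) = bb_idem n (idem1 i m) (idem2 n i m)
       then bvec m else 0))"

definition X_grading :: "nat \<Rightarrow> nat \<Rightarrow> bidegree \<Rightarrow> (basis_elem \<Rightarrow>\<^sub>0 bit) set"
  where "X_grading n i d =
    {f. Poly_Mapping.keys f \<subseteq> {m \<in> X_basis n i. kind_degree i (gen_kind (snd m)) = d}}"

type_synonym xt_elem = "((bb_elem \<times> (basis_elem \<Rightarrow>\<^sub>0 bit)) \<Rightarrow>\<^sub>0 bit) set"

definition XT :: "nat \<Rightarrow> nat \<Rightarrow> (bb_elem, xt_elem) module"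
  where "XT n i = tensor_module (idem_ring n) (BB n) (X_module n i)"

definition xt_tensor :: "nat \<Rightarrow> nat \<Rightarrow> bb_elem \<Rightarrow> basis_elem \<Rightarrow> xt_elem"
  where "xt_tensor n i b m = mod_tensor (idem_ring n) (BB n) (X_module n i) b (bvec m)"

text \<open>A word of labels without idempotents denotes the sum of all paths spelling that word.\<close>

definition word_paths :: "bool \<Rightarrow> nat \<Rightarrow> label list \<Rightarrow> path set"
  where "word_paths s n w = {p \<in> paths s n. snd p = w}"

subsection \<open>Local differential\<close>

fun shift_label :: "nat \<Rightarrow> label \<Rightarrow> label" where
  "shift_label i (RR j) = RR (i + j - 1)"
| "shift_label i (LL j) = LL (i + j - 1)"
| "shift_label i (UU j) = UU (i + j - 1)"
| "shift_label i (CC j) = CC (i + j - 1)"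

definition iota_path :: "nat \<Rightarrow> nat set \<Rightarrow> path \<Rightarrow> path"
  where "iota_path i xe p = (shift_set i (fst p) \<union> xe, map (shift_label i) (snd p))"

text \<open>The image of \<open>v \<otimes> w\<close> (words in the local algebras) under the embedding determined by the
  external state \<open>xe\<close>.\<close>

definition iota_words :: "nat \<Rightarrow> nat \<Rightarrow> nat set \<Rightarrow> label list \<Rightarrow> label list \<Rightarrow> bb_elem"
  where "iota_words n i xe v w = bb_tensor n
    (\<Sum>p\<in>word_paths False 2 v. bvec (iota_path i xe p))
    (\<Sum>q\<in>word_paths True 2 w. bvec (iota_path i (S_ext n i - xe) q))"

definition delta_local :: "nat \<Rightarrow> nat \<Rightarrow> basis_elem \<Rightarrow> xt_elem"
  where "delta_local n i m =
    (\<Oplus>\<^bsub>XT n i\<^esub>t\<in>delta_loc (snd m).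
      case t of (v, w, g) \<Rightarrow> xt_tensor n i (iota_words n i (fst m) v w) (fst m, g))"

subsection \<open>External differential\<close>

definition label_tensor :: "nat \<Rightarrow> label \<Rightarrow> label \<Rightarrow> bb_elem"
  where "label_tensor n a b =
    bb_tensor n (\<Sum>p\<in>word_paths False n [a]. bvec p) (\<Sum>q\<in>word_paths True n [b]. bvec q)"

definition delta_unmoving :: "nat \<Rightarrow> nat \<Rightarrow> nat \<Rightarrow> basis_elem \<Rightarrow> xt_elem"
  where "delta_unmoving n i j m = xt_tensor n i (label_tensor n (UU j) (CC j)) m"

definition A_set :: "nat \<Rightarrow> nat \<Rightarrow> nat \<Rightarrow> basis_elem set"
  where "A_set n i j = {m \<in> X_basis n i.
    j - 1 \<in> idem1 i m \<and> j - 1 \<notin> idem2 n i m \<and> j \<notin> idem1 i m \<and> j \<in> idem2 n i m}"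

definition B_set :: "nat \<Rightarrow> nat \<Rightarrow> nat \<Rightarrow> basis_elem set"
  where "B_set n i j = {m \<in> X_basis n i.
    j \<in> idem1 i m \<and> j \<notin> idem2 n i m \<and> j - 1 \<notin> idem1 i m \<and> j - 1 \<in> idem2 n i m}"

definition sigma :: "nat \<Rightarrow> nat \<Rightarrow> nat \<Rightarrow> basis_elem \<Rightarrow> basis_elem"
  where "sigma n i j m = (THE m'. m' \<in> X_basis n i \<and> gen_kind (snd m') = gen_kind (snd m) \<and>
    idem1 i m' = (idem1 i m - {j - 1}) \<union> {j} \<and>
    idem2 n i m' = (idem2 n i m - {j}) \<union> {j - 1})"

definition sigma_inv :: "nat \<Rightarrow> nat \<Rightarrow> nat \<Rightarrow> basis_elem \<Rightarrow> basis_elem"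
  where "sigma_inv n i j = inv_into (A_set n i j) (sigma n i j)"

definition delta_moving :: "nat \<Rightarrow> nat \<Rightarrow> nat \<Rightarrow> basis_elem \<Rightarrow> xt_elem"
  where "delta_moving n i j m =
    (if m \<in> A_set n i j then xt_tensor n i (label_tensor n (RR j) (LL j)) (sigma n i j m)
     else if m \<in> B_set n i j then xt_tensor n i (label_tensor n (LL j) (RR j)) (sigma_inv n i j m)
     else \<zero>\<^bsub>XT n i\<^esub>)"

definition delta_external :: "nat \<Rightarrow> nat \<Rightarrow> basis_elem \<Rightarrow> xt_elem"
  where "delta_external n i m =
    (\<Oplus>\<^bsub>XT n i\<^esub>j\<in>{1..n} - {i, i + 1}. delta_unmoving n i j m \<oplus>\<^bsub>XT n i\<^esub> delta_moving n i j m)"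

definition X_delta :: "nat \<Rightarrow> nat \<Rightarrow> (basis_elem \<Rightarrow>\<^sub>0 bit) \<Rightarrow> xt_elem"
  where "X_delta n i =
    linear_ext (XT n i) (\<lambda>m. delta_local n i m \<oplus>\<^bsub>XT n i\<^esub> delta_external n i m)"

end

theory Submission
  imports Defs
begin

text \<open>The value of \<open>\<delta>\<^sup>1\<close> at a basis element is recorded as a sum of triples \<open>(v, w, m')\<close>, where \<open>v\<close> and
  \<open>w\<close> are words in the labels that spell the two tensor factors. The structure equation then says
  that a certain sum of such triples evaluates to zero. It splits into four kinds of terms. The
  square of the local differential, and its commutators with the external moves at \<open>i - 1\<close> and
  \<open>i + 2\<close>, involve only boundedly many words; rewriting every word to a normal form by the relations
  of the quiver algebras, including \<open>U\<^sub>k = 0\<close> at vertices missing both \<open>k - 1\<close> and \<open>k\<close>, makes all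
  terms cancel in pairs. The elements \<open>U\<^sub>j \<otimes> C\<^sub>j\<close> are central, and \<open>\<partial>(U\<^sub>j \<otimes> C\<^sub>j) = U\<^sub>j \<otimes> U\<^sub>j\<close> cancels the
  square of the moving part at \<open>j\<close>, or vanishes where there is no move. Moves at distance greater
  than one commute, and composites of moves at adjacent indices vanish.\<close>

section \<open>Vector spaces over the field with two elements\<close>

text \<open>The coefficients live in quotients of free spaces on pairs of cosets, where nothing can
  be computed directly. But a coefficient leading from m to m' is a single path in each factor: an
  arrow is determined by its label and its end, so right multiplication by the idempotent of m'
  selects one summand of a label that denotes a sum of arrows. Sources and ends are then read off
  from m and m', and only two words remain. Indices are the other obstacle: n and i are arbitrary,
  while the check has to be finite. The tables use the labels 1 to 4, which k + i - 2 turns into i -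
  1 to i + 2, and the external state enters them only through the question whether i - 2, or i + 2,
  is occupied. Soundness of the rewriting is enough: equal normal forms are equal elements, and
  cancellation in pairs asks for nothing more. The one non-vanishing fact concerns the idempotents
  of basis elements; it is what makes the action of the idempotent ring on M, given by 0 or 1,
  additive.\<close>

lemma bit_poly_add_self [simp]: "f + f = (0 :: 'a \<Rightarrow>\<^sub>0 bit)"
  by (rule poly_mapping_eqI) (simp add: lookup_add)

lemma bit_poly_add_self_left [simp]: "f + (f + g) = (g :: 'a \<Rightarrow>\<^sub>0 bit)"
  by (simp flip: add.assoc)

lemma bit_poly_eq_sum: "(f :: 'a \<Rightarrow>\<^sub>0 bit) = (\<Sum>p\<in>Poly_Mapping.keys f. bvec p)"
proof (rule poly_mapping_eqI)
  fix k
  have "Poly_Mapping.lookup f k = of_bool (k \<in> Poly_Mapping.keys f)"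
    by (metis bit_not_zero_iff in_keys_iff of_bool_eq(1) of_bool_eq(2))
  then show "Poly_Mapping.lookup f k = Poly_Mapping.lookup (\<Sum>p\<in>Poly_Mapping.keys f. bvec p) k"
    by (simp add: lookup_sum lookup_single when_def)
qed

lemma bit_poly_induct [consumes 1, case_names zero bvec add]:
  fixes f :: "'a \<Rightarrow>\<^sub>0 bit"
  assumes "Poly_Mapping.keys f \<subseteq> S" and "P 0" and "\<And>p. p \<in> S \<Longrightarrow> P (bvec p)"
    and "\<And>f g. Poly_Mapping.keys f \<subseteq> S \<Longrightarrow> Poly_Mapping.keys g \<subseteq> S \<Longrightarrow> P f \<Longrightarrow> P g \<Longrightarrow> P (f + g)"
  shows "P f"
proof -
  have "Poly_Mapping.keys (\<Sum>p\<in>A. bvec p :: 'a \<Rightarrow>\<^sub>0 bit) \<subseteq> S \<and> P (\<Sum>p\<in>A. bvec p)"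
    if "finite A" "A \<subseteq> S" for A
    using that
  proof (induction A rule: finite_induct)
    case empty
    then show ?case by (simp add: assms(2))
  next
    case (insert p A)
    have "Poly_Mapping.keys (bvec p + (\<Sum>p\<in>A. bvec p) :: 'a \<Rightarrow>\<^sub>0 bit) \<subseteq> S"
      using insert by (intro order_trans[OF keys_add]) auto
    then show ?case
      using insert assms(3,4) by auto
  qed
  then show ?thesis
    using bit_poly_eq_sum[of f] assms(1) finite_keys by metis
qed

lemma keys_add_bit: "Poly_Mapping.keys (f + g :: 'a \<Rightarrow>\<^sub>0 bit) =
    (Poly_Mapping.keys f - Poly_Mapping.keys g) \<union> (Poly_Mapping.keys g - Poly_Mapping.keys f)"
proof -
  have "a + b \<noteq> 0 \<longleftrightarrow> (a \<noteq> 0) \<noteq> (b \<noteq> 0)" for a b :: bit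
    by (cases a; cases b; simp)
  then show ?thesis
    by (auto simp: in_keys_iff lookup_add)
qed

text \<open>An abelian group in which every element is its own negative is a vector space over the
  field with two elements, and its subgroups are its subspaces.\<close>

locale bit_space = abelian_group N for N (structure) +
  assumes add_self [simp]: "x \<in> carrier N \<Longrightarrow> x \<oplus> x = \<zero>"
begin

lemma a_inv_self [simp]: "x \<in> carrier N \<Longrightarrow> \<ominus> x = x"
  using minus_equality add_self by blast

lemma add_self_left [simp]: "x \<in> carrier N \<Longrightarrow> y \<in> carrier N \<Longrightarrow> x \<oplus> (x \<oplus> y) = y"
  by (metis a_assoc add_self l_zero)

lemma add_eq_zero_iff: "x \<in> carrier N \<Longrightarrow> y \<in> carrier N \<Longrightarrow> x \<oplus> y = \<zero> \<longleftrightarrow> x = y"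
  by (metis a_inv_self add_self minus_equality)

lemma linear_ext_closed [intro, simp]:
  assumes "\<phi> \<in> S \<rightarrow> carrier N" "Poly_Mapping.keys f \<subseteq> S"
  shows "linear_ext N \<phi> f \<in> carrier N"
  unfolding linear_ext_def using assms by (intro finsum_closed) auto

lemma linear_ext_zero [simp]: "linear_ext N \<phi> 0 = \<zero>"
  by (simp add: linear_ext_def)

lemma linear_ext_bvec [simp]: "\<phi> p \<in> carrier N \<Longrightarrow> linear_ext N \<phi> (bvec p) = \<phi> p"
  by (simp add: linear_ext_def)

text \<open>The keys of f + g form the symmetric difference; the common keys occur twice on the
  right-hand side and cancel.\<close>

lemma linear_ext_add:
  assumes \<phi>: "\<phi> \<in> S \<rightarrow> carrier N" and f: "Poly_Mapping.keys f \<subseteq> S" and g: "Poly_Mapping.keys g \<subseteq> S"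
  shows "linear_ext N \<phi> (f + g) = linear_ext N \<phi> f \<oplus> linear_ext N \<phi> g"
proof -
  let ?F = "Poly_Mapping.keys f" and ?G = "Poly_Mapping.keys g"
  let ?s = "finsum N \<phi>"
  have c: "\<phi> \<in> A \<rightarrow> carrier N" if "A \<subseteq> S" for A using \<phi> that by auto
  have F: "?s ?F = ?s (?F - ?G) \<oplus> ?s (?F \<inter> ?G)"
    using f by (subst finsum_Un_disjoint[symmetric]) (auto intro!: c arg_cong[where f = ?s])
  have G: "?s ?G = ?s (?F \<inter> ?G) \<oplus> ?s (?G - ?F)"
    using g by (subst finsum_Un_disjoint[symmetric]) (auto intro!: c arg_cong[where f = ?s])
  have FG: "?s (Poly_Mapping.keys (f + g)) = ?s (?F - ?G) \<oplus> ?s (?G - ?F)"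
    unfolding keys_add_bit using f g by (subst finsum_Un_disjoint) (auto intro!: c)
  have "?s (?F - ?G) \<in> carrier N" "?s (?F \<inter> ?G) \<in> carrier N" "?s (?G - ?F) \<in> carrier N"
    using f g by (auto intro!: finsum_closed c)
  then show ?thesis
    unfolding linear_ext_def F G FG by (simp add: a_ac)
qed

lemma linear_ext_unique:
  assumes "Poly_Mapping.keys f \<subseteq> S" and "F 0 = \<zero>" and "\<And>p. p \<in> S \<Longrightarrow> F (bvec p) = \<phi> p"
    and "\<phi> \<in> S \<rightarrow> carrier N"
    and "\<And>f g. Poly_Mapping.keys f \<subseteq> S \<Longrightarrow> Poly_Mapping.keys g \<subseteq> S \<Longrightarrow> F (f + g) = F f \<oplus> F g"
  shows "F f = linear_ext N \<phi> f"
  using assms(1)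
proof (induction rule: bit_poly_induct)
  case zero
  then show ?case by (simp add: assms(2))
next
  case (bvec p)
  then show ?case
    using assms(3,4) by (auto simp: Pi_iff)
next
  case (add f g)
  then show ?case
    using assms(4,5) by (simp add: linear_ext_add)
qed

lemma gspan_subgroup: "G \<subseteq> carrier N \<Longrightarrow> subgroup (gspan N G) (add_monoid N)"
  using add.generate_is_subgroup by auto

lemma gspan_zero [intro, simp]: "\<zero> \<in> gspan N G"
  using generate.one[of "add_monoid N" G] by simp

lemma gspan_incl: "x \<in> G \<Longrightarrow> x \<in> gspan N G"
  by (rule generate.incl)

lemma gspan_add: "x \<in> gspan N G \<Longrightarrow> y \<in> gspan N G \<Longrightarrow> x \<oplus> y \<in> gspan N G"
  using generate.eng[of x "add_monoid N" G y] by simp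

lemma gspan_induct [consumes 2, case_names zero incl add]:
  assumes "x \<in> gspan N G" "G \<subseteq> carrier N" "P \<zero>" "\<And>x. x \<in> G \<Longrightarrow> P x"
    and "\<And>x y. x \<in> gspan N G \<Longrightarrow> y \<in> gspan N G \<Longrightarrow> P x \<Longrightarrow> P y \<Longrightarrow> P (x \<oplus> y)"
  shows "P x"
  using assms(1)
proof (induction rule: generate.induct)
  case one
  then show ?case using assms(3) by simp
next
  case (incl h)
  then show ?case using assms(4) by simp
next
  case (inv h)
  then have "inv\<^bsub>add_monoid N\<^esub> h = h"
    using assms(2) a_inv_self by (metis a_inv_def subsetD)
  then show ?case using assms(4) inv by simp
next
  case (eng h1 h2)
  then show ?case using assms(5) by simp
qed

lemma gspan_closed: "x \<in> gspan N G \<Longrightarrow> G \<subseteq> carrier N \<Longrightarrow> x \<in> carrier N"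
  using add.generate_in_carrier by auto

end

lemma bit_spaceI:
  assumes "abelian_group N" "\<And>x. x \<in> carrier N \<Longrightarrow> x \<oplus>\<^bsub>N\<^esub> x = \<zero>\<^bsub>N\<^esub>"
  shows "bit_space N"
  using assms by (simp add: bit_space_def bit_space_axioms_def)

subsection \<open>Quotients\<close>

context bit_space
begin

context
  fixes H assumes H: "subgroup H (add_monoid N)"
begin

lemma quot_abelian_subgroup: "abelian_subgroup H N"
  using H by (simp add: abelian_subgroupI3 additive_subgroup_def abelian_group_axioms)

lemma quot_bit_space: "bit_space (N Quot H)"
proof (rule bit_spaceI)
  interpret abelian_subgroup H N by (rule quot_abelian_subgroup)
  show "abelian_group (N Quot H)"
    by (rule comm_group_abelian_groupI)
      (simp add: FactRing_def a_factorgroup_is_comm_group[unfolded A_FactGroup_def'])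
  show "x \<oplus>\<^bsub>N Quot H\<^esub> x = \<zero>\<^bsub>N Quot H\<^esub>" if x: "x \<in> carrier (N Quot H)" for x
  proof -
    obtain f where f: "f \<in> carrier N" "x = H +> f"
      using x by (auto simp: FactRing_simps)
    have "H +> \<zero> = H"
      using a_rcos_const zero_closed by simp
    then show ?thesis
      using f by (simp add: FactRing_def a_rcos_sum)
  qed
qed

lemma quot_carrier_iff: "X \<in> carrier (N Quot H) \<longleftrightarrow> (\<exists>f\<in>carrier N. X = H +> f)"
  by (auto simp: FactRing_simps)

lemma quot_closed [intro, simp]: "f \<in> carrier N \<Longrightarrow> H +> f \<in> carrier (N Quot H)"
  using quot_carrier_iff by blast

lemma quot_add: "f \<in> carrier N \<Longrightarrow> g \<in> carrier N \<Longrightarrow> (H +> f) \<oplus>\<^bsub>N Quot H\<^esub> (H +> g) = H +> (f \<oplus> g)"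
proof -
  interpret abelian_subgroup H N by (rule quot_abelian_subgroup)
  show "f \<in> carrier N \<Longrightarrow> g \<in> carrier N \<Longrightarrow> (H +> f) \<oplus>\<^bsub>N Quot H\<^esub> (H +> g) = H +> (f \<oplus> g)"
    by (simp add: FactRing_def a_rcos_sum)
qed

lemma quot_zero: "\<zero>\<^bsub>N Quot H\<^esub> = H"
  by (simp add: FactRing_def)

lemma quot_eq_zero_iff: "f \<in> carrier N \<Longrightarrow> H +> f = \<zero>\<^bsub>N Quot H\<^esub> \<longleftrightarrow> f \<in> H"
proof -
  interpret abelian_subgroup H N by (rule quot_abelian_subgroup)
  assume "f \<in> carrier N"
  then show ?thesis
    unfolding quot_zero
    by (metis a_coset_join2 a_rcos_self a_rcos_const is_additive_subgroup H)
qed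

lemma quot_eqI:
  assumes "f \<in> carrier N" "g \<in> carrier N" "f \<oplus> g \<in> H" shows "H +> f = H +> g"
proof -
  interpret Q: bit_space "N Quot H" by (rule quot_bit_space)
  show ?thesis
    using assms by (metis Q.add_eq_zero_iff a_closed quot_add quot_closed quot_eq_zero_iff)
qed

lemma quot_mem: "g \<in> H +> f \<Longrightarrow> \<exists>h\<in>H. g = h \<oplus> f"
  by (auto simp: a_r_coset_def r_coset_def)

lemma quot_self: "f \<in> carrier N \<Longrightarrow> f \<in> H +> f"
proof -
  interpret abelian_subgroup H N by (rule quot_abelian_subgroup)
  show "f \<in> carrier N \<Longrightarrow> f \<in> H +> f" by (rule a_rcos_self)
qed

end

end

section \<open>Free spaces and the maps induced on their quotients\<close>

lemma free_space_simps [simp]: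
  "carrier (free_space S) = {f. Poly_Mapping.keys f \<subseteq> S}"
  "add (free_space S) = (+)" "zero (free_space S) = 0"
  by (simp_all add: free_space_def)

text \<open>The path algebra, the pair algebra and the module M are records of different types over
  the same kind of additive group. A predicate on the additive part serves all of them, whatever the
  product and the further fields.\<close>

definition free_on :: "'a set \<Rightarrow> ('a \<Rightarrow>\<^sub>0 bit, 'm) ring_scheme \<Rightarrow> bool"
  where "free_on S R \<longleftrightarrow> carrier R = {f. Poly_Mapping.keys f \<subseteq> S} \<and> add R = (+) \<and> zero R = 0"

lemma free_onD:
  assumes "free_on S R"
  shows "carrier R = {f. Poly_Mapping.keys f \<subseteq> S}" "add R = (+)" "zero R = 0"
  using assms by (simp_all add: free_on_def)

lemma free_on_free_space: "free_on S (free_space S)"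
  by (simp add: free_on_def)

lemma keys_add_subset:
  "Poly_Mapping.keys f \<subseteq> S \<Longrightarrow> Poly_Mapping.keys g \<subseteq> S \<Longrightarrow> Poly_Mapping.keys (f + g) \<subseteq> S"
  using keys_add[of f g] by blast

lemma keys_sum_subset:
  "(\<And>x. x \<in> A \<Longrightarrow> Poly_Mapping.keys (f x) \<subseteq> S) \<Longrightarrow> Poly_Mapping.keys (\<Sum>x\<in>A. f x) \<subseteq> S"
  by (induction A rule: infinite_finite_induct) (simp_all add: keys_add_subset)

lemma free_on_bit_space:
  assumes "free_on S R"
  shows "bit_space R"
proof (rule bit_spaceI)
  show "abelian_group R"
  proof (rule abelian_groupI)
    fix x assume "x \<in> carrier R"
    then show "\<exists>y\<in>carrier R. y \<oplus>\<^bsub>R\<^esub> x = \<zero>\<^bsub>R\<^esub>"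
      by (intro bexI[of _ x]) (simp_all add: free_onD[OF assms])
  qed (simp_all add: free_onD[OF assms] add_ac keys_add_subset)
qed (simp add: free_onD[OF assms])

lemma finsum_free_on:
  assumes "free_on S R" "\<phi> \<in> A \<rightarrow> carrier R"
  shows "finsum R \<phi> A = sum \<phi> A"
proof -
  interpret bit_space R by (rule free_on_bit_space[OF assms(1)])
  show ?thesis using assms(2)
  proof (induction A rule: infinite_finite_induct)
    case (insert x A)
    then show ?case by (auto simp: free_onD[OF assms(1)] Pi_iff)
  qed (auto simp: free_onD[OF assms(1)] finsum_infinite)
qed

lemma linear_ext_free_on:
  assumes "free_on S R" "\<phi> \<in> Poly_Mapping.keys f \<rightarrow> carrier R"
  shows "linear_ext R \<phi> f = (\<Sum>p\<in>Poly_Mapping.keys f. \<phi> p)"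
  using finsum_free_on[OF assms] by (simp add: linear_ext_def)

text \<open>Elements of one coset differ by elements of H, on which the linear extension is zero. So
  the image of the coset is a singleton and \<open>the_elem\<close> is meaningful.\<close>

lemma induced_coset:
  assumes "free_on S R" "subgroup H (add_monoid R)" "bit_space N" "\<phi> \<in> S \<rightarrow> carrier N"
    and "\<And>h. h \<in> H \<Longrightarrow> linear_ext N \<phi> h = \<zero>\<^bsub>N\<^esub>" and f: "f \<in> carrier R"
  shows "induced N \<phi> (H +>\<^bsub>R\<^esub> f) = linear_ext N \<phi> f"
proof -
  interpret R: bit_space R by (rule free_on_bit_space[OF assms(1)])
  interpret N: bit_space N by (rule assms(3))
  have kf: "Poly_Mapping.keys f \<subseteq> S" using f by (simp add: free_onD[OF assms(1)])
  have kh: "Poly_Mapping.keys h \<subseteq> S" if "h \<in> H" for h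
    using subgroup.subset[OF assms(2)] that by (auto simp: free_onD[OF assms(1)])
  have "linear_ext N \<phi> g = linear_ext N \<phi> f" if g: "g \<in> H +>\<^bsub>R\<^esub> f" for g
  proof -
    obtain h where "h \<in> H" "g = h + f"
      using R.quot_mem[OF assms(2) g] by (auto simp: free_onD[OF assms(1)])
    then show ?thesis
      using N.linear_ext_add[OF assms(4) kh kf] assms(4,5) kf by simp
  qed
  then have "linear_ext N \<phi> ` (H +>\<^bsub>R\<^esub> f) = {linear_ext N \<phi> f}"
    using R.quot_self[OF assms(2) f] by blast
  then show ?thesis by (simp add: induced_def)
qed

lemma linear_ext_gspan:
  assumes "free_on S R" "bit_space N" "\<phi> \<in> S \<rightarrow> carrier N" "G \<subseteq> carrier R"
    and "\<And>g. g \<in> G \<Longrightarrow> linear_ext N \<phi> g \<in> K" "subgroup K (add_monoid N)"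
    and "h \<in> gspan R G"
  shows "linear_ext N \<phi> h \<in> K"
proof -
  interpret R: bit_space R by (rule free_on_bit_space[OF assms(1)])
  interpret N: bit_space N by (rule assms(2))
  interpret K: subgroup K "add_monoid N" by (rule assms(6))
  have k: "Poly_Mapping.keys x \<subseteq> S" if "x \<in> gspan R G" for x
    using R.gspan_closed[OF that assms(4)] by (simp add: free_onD[OF assms(1)])
  show ?thesis
    using assms(7,4)
  proof (induction rule: R.gspan_induct)
    case zero
    then show ?case using K.one_closed by (simp add: free_onD[OF assms(1)])
  next
    case (incl x)
    then show ?case by (rule assms(5))
  next
    case (add x y)
    then show ?case
      using K.m_closed N.linear_ext_add[OF assms(3)] k by (simp add: free_onD[OF assms(1)])
  qed
qed

declare [[simproc del: unit_eq]]

section \<open>Algebras given on a basis\<close>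

text \<open>An instance of \<open>linear_ext_add\<close> whose target is the full free space, so
  that no carrier conditions remain. It gives the additivity of \<open>bilinear_ext\<close> in
  either argument.\<close>

lemma sum_keys_add:
  "sum \<phi> (Poly_Mapping.keys (f + g)) = sum \<phi> (Poly_Mapping.keys f) + sum \<phi> (Poly_Mapping.keys g)"
  for \<phi> :: "'a \<Rightarrow> 'b \<Rightarrow>\<^sub>0 bit" and f :: "'a \<Rightarrow>\<^sub>0 bit"
proof -
  interpret bit_space "free_space UNIV :: ('b \<Rightarrow>\<^sub>0 bit) ring"
    by (rule free_on_bit_space[OF free_on_free_space])
  show ?thesis
    using linear_ext_add[of \<phi> UNIV f g]
    by (simp add: linear_ext_free_on[OF free_on_free_space])
qed

lemma bilinear_ext_bvec [simp]: "bilinear_ext \<mu> (bvec p) (bvec q) = \<mu> p q"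
  by (simp add: bilinear_ext_def)

lemma bilinear_ext_add_left: "bilinear_ext \<mu> (f + g) h = bilinear_ext \<mu> f h + bilinear_ext \<mu> g h"
  by (simp add: bilinear_ext_def sum_keys_add)

lemma bilinear_ext_add_right: "bilinear_ext \<mu> f (g + h) = bilinear_ext \<mu> f g + bilinear_ext \<mu> f h"
  by (simp add: bilinear_ext_def sum_keys_add sum.distrib)

lemma bilinear_ext_zero [simp]: "bilinear_ext \<mu> 0 h = 0" "bilinear_ext \<mu> f 0 = 0"
  by (simp_all add: bilinear_ext_def)

lemma bilinear_ext_sum_left: "bilinear_ext \<mu> (sum f A) h = (\<Sum>a\<in>A. bilinear_ext \<mu> (f a) h)"
  by (induction A rule: infinite_finite_induct) (simp_all add: bilinear_ext_add_left)

lemma bilinear_ext_sum_right: "bilinear_ext \<mu> h (sum f A) = (\<Sum>a\<in>A. bilinear_ext \<mu> h (f a))"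
  by (induction A rule: infinite_finite_induct) (simp_all add: bilinear_ext_add_right)

lemma keys_bilinear_ext:
  assumes "\<And>p q. p \<in> S \<Longrightarrow> q \<in> S \<Longrightarrow> Poly_Mapping.keys (\<mu> p q) \<subseteq> S"
    and "Poly_Mapping.keys f \<subseteq> S" "Poly_Mapping.keys g \<subseteq> S"
  shows "Poly_Mapping.keys (bilinear_ext \<mu> f g) \<subseteq> S"
  unfolding bilinear_ext_def using assms by (intro keys_sum_subset) blast

locale bit_ring = ring R + bit_space R for R (structure)

text \<open>Both sides of the associativity and unit laws are additive in each argument, so it
  suffices to compare them on basis vectors.\<close>

lemma bit_ring_of_bilinear_ext:
  fixes R :: "('a \<Rightarrow>\<^sub>0 bit, 'm) ring_scheme"
  assumes R: "free_on S R" and mult: "mult R = bilinear_ext \<mu>"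
    and closed: "\<And>p q. p \<in> S \<Longrightarrow> q \<in> S \<Longrightarrow> Poly_Mapping.keys (\<mu> p q) \<subseteq> S"
    and assoc: "\<And>p q r. p \<in> S \<Longrightarrow> q \<in> S \<Longrightarrow> r \<in> S \<Longrightarrow>
      bilinear_ext \<mu> (\<mu> p q) (bvec r) = bilinear_ext \<mu> (bvec p) (\<mu> q r)"
    and one: "Poly_Mapping.keys (one R) \<subseteq> S"
      "\<And>p. p \<in> S \<Longrightarrow> bilinear_ext \<mu> (one R) (bvec p) = bvec p"
      "\<And>p. p \<in> S \<Longrightarrow> bilinear_ext \<mu> (bvec p) (one R) = bvec p"
  shows "bit_ring R"
proof -
  interpret bit_space R by (rule free_on_bit_space[OF R])
  note [simp] = free_onD[OF R] mult
  have assoc': "bilinear_ext \<mu> (bilinear_ext \<mu> f g) h = bilinear_ext \<mu> f (bilinear_ext \<mu> g h)"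
    if f: "Poly_Mapping.keys f \<subseteq> S" and g: "Poly_Mapping.keys g \<subseteq> S" and h: "Poly_Mapping.keys h \<subseteq> S"
    for f g h
    using f
  proof (induction f rule: bit_poly_induct)
    case (bvec p)
    show ?case using g
    proof (induction g rule: bit_poly_induct)
      case (bvec q)
      show ?case using h
      proof (induction h rule: bit_poly_induct)
        case (bvec r)
        then show ?case using assoc \<open>p \<in> S\<close> \<open>q \<in> S\<close> by simp
      qed (simp_all add: bilinear_ext_add_right)
    qed (simp_all add: bilinear_ext_add_right bilinear_ext_add_left)
  qed (simp_all add: bilinear_ext_add_left)
  have left: "bilinear_ext \<mu> (one R) f = f" if "Poly_Mapping.keys f \<subseteq> S" for f
    using that by (induction f rule: bit_poly_induct) (simp_all add: bilinear_ext_add_right one)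
  have right: "bilinear_ext \<mu> f (one R) = f" if "Poly_Mapping.keys f \<subseteq> S" for f
    using that by (induction f rule: bit_poly_induct) (simp_all add: bilinear_ext_add_left one)
  have "ring R"
  proof (rule ringI)
    show "Group.monoid R"
      by (rule monoidI) (simp_all add: one assoc' left right keys_bilinear_ext[OF closed])
  qed (simp_all add: abelian_group_axioms bilinear_ext_add_left bilinear_ext_add_right)
  then show ?thesis
    by (simp add: bit_ring_def bit_space_axioms)
qed

context bit_ring
begin

lemma quot_bit_ring:
  assumes "ideal I R" shows "bit_ring (R Quot I)"
proof -
  interpret ideal I R by (rule assms)
  show ?thesis
    by (simp add: bit_ring_def quotient_is_ring quot_bit_space[OF a_subgroup])
qed

lemma quot_mult:
  assumes "ideal I R" "f \<in> carrier R" "g \<in> carrier R"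
  shows "(I +> f) \<otimes>\<^bsub>R Quot I\<^esub> (I +> g) = I +> (f \<otimes> g)"
proof -
  interpret ideal I R by (rule assms)
  show ?thesis
    using assms by (simp add: FactRing_def rcoset_mult_add)
qed

end

text \<open>The dg algebras extend a ring record by a differential and a grading. The ring laws see
  only the five common components and pass to the larger record.\<close>

lemma bit_ring_cong:
  assumes "bit_ring R" "carrier R' = carrier R" "mult R' = mult R" "one R' = one R"
    "zero R' = zero R" "add R' = add R"
  shows "bit_ring R'"
proof -
  interpret bit_ring R by (rule assms(1))
  have "abelian_group R'"
  proof (rule abelian_groupI)
    fix x assume "x \<in> carrier R'"
    then show "\<exists>y\<in>carrier R'. y \<oplus>\<^bsub>R'\<^esub> x = \<zero>\<^bsub>R'\<^esub>"
      using assms(2-) by (intro bexI[of _ x]) simp_all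
  qed (use assms(2-) in \<open>simp_all add: a_ac\<close>)
  moreover have "Group.monoid R'"
    by (rule monoidI) (simp_all add: assms(2-) m_assoc)
  ultimately show ?thesis
    using assms(2-) by (intro bit_ring.intro ring.intro bit_space.intro bit_space_axioms.intro ring_axioms.intro)
      (simp_all add: r_distr l_distr)
qed

section \<open>Tensor products of algebras\<close>

lemma subgroup_bit_spaceI:
  assumes "bit_space N" "H \<subseteq> carrier N" "\<zero>\<^bsub>N\<^esub> \<in> H" "\<And>x y. x \<in> H \<Longrightarrow> y \<in> H \<Longrightarrow> x \<oplus>\<^bsub>N\<^esub> y \<in> H"
  shows "subgroup H (add_monoid N)"
proof -
  interpret bit_space N by (rule assms(1))
  show ?thesis
    using assms(2-) a_inv_self
    by (intro add.subgroupI) (auto simp flip: a_inv_def)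
qed

text \<open>Both kinds of tensor product are free spaces modulo the span of explicit relations.
  Their universal properties are derived once, from this common form.\<close>

locale presented_space =
  fixes S :: "'a set" and R :: "('a \<Rightarrow>\<^sub>0 bit, 'm) ring_scheme" and G :: "('a \<Rightarrow>\<^sub>0 bit) set"
  assumes free: "free_on S R" and rels: "G \<subseteq> carrier R"
begin

sublocale R: bit_space R by (rule free_on_bit_space[OF free])

definition H where "H = gspan R G"

lemma H_subgroup: "subgroup H (add_monoid R)"
  unfolding H_def by (rule R.gspan_subgroup[OF rels])

lemma H_incl: "g \<in> G \<Longrightarrow> g \<in> H"
  unfolding H_def by (rule R.gspan_incl)

sublocale Q: bit_space "R Quot H"
  by (rule R.quot_bit_space[OF H_subgroup])

lemma bvec_closed: "p \<in> S \<Longrightarrow> bvec p \<in> carrier R"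
  by (simp add: free_onD[OF free])

lemma class_closed: "p \<in> S \<Longrightarrow> H +>\<^bsub>R\<^esub> bvec p \<in> carrier (R Quot H)"
  by (rule R.quot_closed[OF H_subgroup bvec_closed])

lemma class_zero: "H +>\<^bsub>R\<^esub> 0 = \<zero>\<^bsub>R Quot H\<^esub>"
proof -
  have "H +>\<^bsub>R\<^esub> \<zero>\<^bsub>R\<^esub> = \<zero>\<^bsub>R Quot H\<^esub>"
    using R.quot_eq_zero_iff[OF H_subgroup R.zero_closed] subgroup.one_closed[OF H_subgroup] by simp
  then show ?thesis by (simp add: free_onD[OF free])
qed

lemma class_add:
  "f \<in> carrier R \<Longrightarrow> g \<in> carrier R \<Longrightarrow> H +>\<^bsub>R\<^esub> (f + g) = (H +>\<^bsub>R\<^esub> f) \<oplus>\<^bsub>R Quot H\<^esub> (H +>\<^bsub>R\<^esub> g)"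
  using R.quot_add[OF H_subgroup, of f g] by (simp add: free_onD[OF free])

lemma class_rel: "bvec p + (bvec q + bvec r) \<in> G \<Longrightarrow> p \<in> S \<Longrightarrow> q \<in> S \<Longrightarrow> r \<in> S \<Longrightarrow>
    H +>\<^bsub>R\<^esub> bvec p = (H +>\<^bsub>R\<^esub> bvec q) \<oplus>\<^bsub>R Quot H\<^esub> (H +>\<^bsub>R\<^esub> bvec r)"
  using R.quot_eqI[OF H_subgroup bvec_closed, of p "bvec q + bvec r"]
    R.a_closed[OF bvec_closed bvec_closed, of q r] H_incl
  by (simp add: class_add[symmetric] bvec_closed) (simp add: free_onD[OF free] keys_add_subset)

lemma quotient_induct [consumes 1, case_names zero bvec add]:
  assumes "X \<in> carrier (R Quot H)" and "P \<zero>\<^bsub>R Quot H\<^esub>" and "\<And>p. p \<in> S \<Longrightarrow> P (H +>\<^bsub>R\<^esub> bvec p)"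
    and "\<And>X Y. X \<in> carrier (R Quot H) \<Longrightarrow> Y \<in> carrier (R Quot H) \<Longrightarrow> P X \<Longrightarrow> P Y \<Longrightarrow>
      P (X \<oplus>\<^bsub>R Quot H\<^esub> Y)"
  shows "P X"
proof -
  obtain f where f: "Poly_Mapping.keys f \<subseteq> S" and X: "X = H +>\<^bsub>R\<^esub> f"
    using assms(1) R.quot_carrier_iff[OF H_subgroup] by (auto simp: free_onD[OF free])
  have "P (H +>\<^bsub>R\<^esub> f)"
    using f
  proof (induction f rule: bit_poly_induct)
    case zero
    then show ?case using assms(2) class_zero by simp
  next
    case (bvec p)
    then show ?case by (rule assms(3))
  next
    case (add f g)
    then show ?case
      by (simp add: class_add assms(4) R.quot_closed[OF H_subgroup] free_onD[OF free])
  qed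
  then show ?thesis by (simp add: X)
qed

text \<open>The universal property of the presentation. Killing the relations in G is enough,
  because the elements with value zero form a subgroup.\<close>

lemma induced_map:
  assumes N: "bit_space N" and \<phi>: "\<phi> \<in> S \<rightarrow> carrier N"
    and rel: "\<And>g. g \<in> G \<Longrightarrow> linear_ext N \<phi> g = \<zero>\<^bsub>N\<^esub>"
  shows induced_class: "f \<in> carrier R \<Longrightarrow> induced N \<phi> (H +>\<^bsub>R\<^esub> f) = linear_ext N \<phi> f"
    and induced_bvec: "p \<in> S \<Longrightarrow> induced N \<phi> (H +>\<^bsub>R\<^esub> bvec p) = \<phi> p"
    and induced_closed: "X \<in> carrier (R Quot H) \<Longrightarrow> induced N \<phi> X \<in> carrier N"
    and induced_add: "X \<in> carrier (R Quot H) \<Longrightarrow> Y \<in> carrier (R Quot H) \<Longrightarrow>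
      induced N \<phi> (X \<oplus>\<^bsub>R Quot H\<^esub> Y) = induced N \<phi> X \<oplus>\<^bsub>N\<^esub> induced N \<phi> Y"
proof -
  interpret N: bit_space N by (rule N)
  have "linear_ext N \<phi> h \<in> {\<zero>\<^bsub>N\<^esub>}" if "h \<in> H" for h
  proof (rule linear_ext_gspan[OF free N \<phi> rels _ _ that[unfolded H_def]])
    show "subgroup {\<zero>\<^bsub>N\<^esub>} (add_monoid N)"
      by (rule subgroup_bit_spaceI[OF N]) auto
  qed (use rel in auto)
  then show ind: "induced N \<phi> (H +>\<^bsub>R\<^esub> f) = linear_ext N \<phi> f" if "f \<in> carrier R" for f
    using that by (intro induced_coset[OF free H_subgroup N \<phi>]) auto
  show "induced N \<phi> (H +>\<^bsub>R\<^esub> bvec p) = \<phi> p" if "p \<in> S"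
  proof -
    have "\<phi> p \<in> carrier N" using that \<phi> by auto
    then show ?thesis using that by (simp add: ind bvec_closed)
  qed
  have rep: "\<exists>f. Poly_Mapping.keys f \<subseteq> S \<and> X = H +>\<^bsub>R\<^esub> f" if "X \<in> carrier (R Quot H)" for X
    using that R.quot_carrier_iff[OF H_subgroup] by (auto simp: free_onD[OF free])
  show "induced N \<phi> X \<in> carrier N" if X: "X \<in> carrier (R Quot H)"
    using rep[OF X] ind N.linear_ext_closed[OF \<phi>] by (auto simp: free_onD[OF free])
  show "induced N \<phi> (X \<oplus>\<^bsub>R Quot H\<^esub> Y) = induced N \<phi> X \<oplus>\<^bsub>N\<^esub> induced N \<phi> Y"
    if XY: "X \<in> carrier (R Quot H)" "Y \<in> carrier (R Quot H)"
  proof -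
    obtain f g where "Poly_Mapping.keys f \<subseteq> S" "X = H +>\<^bsub>R\<^esub> f" "Poly_Mapping.keys g \<subseteq> S" "Y = H +>\<^bsub>R\<^esub> g"
      using rep XY by meson
    then show ?thesis
      using N.linear_ext_add[OF \<phi>, of f g]
      by (simp add: class_add[symmetric] ind free_onD[OF free] keys_add_subset)
  qed
qed

end

locale alg_pair = A: bit_ring A + B: bit_ring B
  for A :: "('a, 'k) ring_scheme" and B :: "('b, 'l) ring_scheme"
begin

abbreviation "P \<equiv> pair_algebra A B"
abbreviation "I \<equiv> tensor_ideal A B"
abbreviation "T \<equiv> tensor_ring A B"

lemma pair_free: "free_on (carrier A \<times> carrier B) P"
  by (simp add: free_on_def pair_algebra_def)

lemma pair_carrier: "carrier P = {f. Poly_Mapping.keys f \<subseteq> carrier A \<times> carrier B}"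
  and pair_add: "add P = (+)" and pair_zero: "zero P = 0"
  using free_onD[OF pair_free] by auto

lemma pair_bvec: "a \<in> carrier A \<Longrightarrow> b \<in> carrier B \<Longrightarrow> bvec (a, b) \<in> carrier P"
  by (simp add: pair_carrier)

lemma pair_mult: "mult P = bilinear_ext (\<lambda>(a, b) (a', b'). bvec (a \<otimes>\<^bsub>A\<^esub> a', b \<otimes>\<^bsub>B\<^esub> b'))"
  and pair_one: "one P = bvec (\<one>\<^bsub>A\<^esub>, \<one>\<^bsub>B\<^esub>)"
  by (simp_all add: pair_algebra_def)

sublocale P: bit_ring P
  by (rule bit_ring_of_bilinear_ext[OF pair_free pair_mult])
    (auto simp: pair_one A.m_assoc B.m_assoc)

lemma rels_subset: "biadditive_rels A B \<subseteq> carrier P"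
proof -
  have "bvec (a, b) + bvec (a', b') + bvec (a'', b'') \<in> carrier P"
    if "{a, a', a''} \<subseteq> carrier A" "{b, b', b''} \<subseteq> carrier B" for a b a' b' a'' b''
    unfolding pair_carrier mem_Collect_eq using that by (intro keys_add_subset) auto
  then show ?thesis
    unfolding biadditive_rels_def by (intro Un_least subsetI) (elim CollectE exE conjE; simp)+
qed

text \<open>The ideal is defined as an additive span. It absorbs products because a biadditivity
  relation multiplied by a basis vector on either side is again a biadditivity relation, by
  distributivity in the factors.\<close>

lemma tensor_ideal_ideal: "ideal I P"
proof -
  have sub: "subgroup I (add_monoid P)"
    unfolding tensor_ideal_def by (rule P.gspan_subgroup[OF rels_subset])
  have I_carr: "x \<in> carrier P" if "x \<in> I" for x
    using subgroup.subset[OF sub] that by auto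
  have rel: "bvec (c, d) \<otimes>\<^bsub>P\<^esub> x \<in> biadditive_rels A B \<and> x \<otimes>\<^bsub>P\<^esub> bvec (c, d) \<in> biadditive_rels A B"
    if x: "x \<in> biadditive_rels A B" and cd: "c \<in> carrier A" "d \<in> carrier B" for x c d
    using x unfolding biadditive_rels_def
  proof (elim UnE CollectE exE conjE)
    fix a a' b
    assume *: "x = bvec (a \<oplus>\<^bsub>A\<^esub> a', b) + bvec (a, b) + bvec (a', b)"
      "a \<in> carrier A" "a' \<in> carrier A" "b \<in> carrier B"
    have "bvec (c, d) \<otimes>\<^bsub>P\<^esub> x = bvec (c \<otimes>\<^bsub>A\<^esub> a \<oplus>\<^bsub>A\<^esub> c \<otimes>\<^bsub>A\<^esub> a', d \<otimes>\<^bsub>B\<^esub> b)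
        + bvec (c \<otimes>\<^bsub>A\<^esub> a, d \<otimes>\<^bsub>B\<^esub> b) + bvec (c \<otimes>\<^bsub>A\<^esub> a', d \<otimes>\<^bsub>B\<^esub> b)"
      "x \<otimes>\<^bsub>P\<^esub> bvec (c, d) = bvec (a \<otimes>\<^bsub>A\<^esub> c \<oplus>\<^bsub>A\<^esub> a' \<otimes>\<^bsub>A\<^esub> c, b \<otimes>\<^bsub>B\<^esub> d)
        + bvec (a \<otimes>\<^bsub>A\<^esub> c, b \<otimes>\<^bsub>B\<^esub> d) + bvec (a' \<otimes>\<^bsub>A\<^esub> c, b \<otimes>\<^bsub>B\<^esub> d)"
      using * cd by (simp_all add: pair_mult bilinear_ext_add_left bilinear_ext_add_right A.r_distr A.l_distr)
    then show "bvec (c, d) \<otimes>\<^bsub>P\<^esub> x \<in> {bvec (a \<oplus>\<^bsub>A\<^esub> a', b) + bvec (a, b) + bvec (a', b) | a a' b.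
       a \<in> carrier A \<and> a' \<in> carrier A \<and> b \<in> carrier B} \<union>
    {bvec (a, b \<oplus>\<^bsub>B\<^esub> b') + bvec (a, b) + bvec (a, b') | a b b'.
       a \<in> carrier A \<and> b \<in> carrier B \<and> b' \<in> carrier B} \<and>
     x \<otimes>\<^bsub>P\<^esub> bvec (c, d) \<in> {bvec (a \<oplus>\<^bsub>A\<^esub> a', b) + bvec (a, b) + bvec (a', b) | a a' b.
       a \<in> carrier A \<and> a' \<in> carrier A \<and> b \<in> carrier B} \<union>
    {bvec (a, b \<oplus>\<^bsub>B\<^esub> b') + bvec (a, b) + bvec (a, b') | a b b'.
       a \<in> carrier A \<and> b \<in> carrier B \<and> b' \<in> carrier B}"
      using * cd by (blast intro: A.m_closed B.m_closed)
  next
    fix a b b'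
    assume *: "x = bvec (a, b \<oplus>\<^bsub>B\<^esub> b') + bvec (a, b) + bvec (a, b')"
      "a \<in> carrier A" "b \<in> carrier B" "b' \<in> carrier B"
    have "bvec (c, d) \<otimes>\<^bsub>P\<^esub> x = bvec (c \<otimes>\<^bsub>A\<^esub> a, d \<otimes>\<^bsub>B\<^esub> b \<oplus>\<^bsub>B\<^esub> d \<otimes>\<^bsub>B\<^esub> b')
        + bvec (c \<otimes>\<^bsub>A\<^esub> a, d \<otimes>\<^bsub>B\<^esub> b) + bvec (c \<otimes>\<^bsub>A\<^esub> a, d \<otimes>\<^bsub>B\<^esub> b')"
      "x \<otimes>\<^bsub>P\<^esub> bvec (c, d) = bvec (a \<otimes>\<^bsub>A\<^esub> c, b \<otimes>\<^bsub>B\<^esub> d \<oplus>\<^bsub>B\<^esub> b' \<otimes>\<^bsub>B\<^esub> d)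
        + bvec (a \<otimes>\<^bsub>A\<^esub> c, b \<otimes>\<^bsub>B\<^esub> d) + bvec (a \<otimes>\<^bsub>A\<^esub> c, b' \<otimes>\<^bsub>B\<^esub> d)"
      using * cd by (simp_all add: pair_mult bilinear_ext_add_left bilinear_ext_add_right B.r_distr B.l_distr)
    then show "bvec (c, d) \<otimes>\<^bsub>P\<^esub> x \<in> {bvec (a \<oplus>\<^bsub>A\<^esub> a', b) + bvec (a, b) + bvec (a', b) | a a' b.
       a \<in> carrier A \<and> a' \<in> carrier A \<and> b \<in> carrier B} \<union>
    {bvec (a, b \<oplus>\<^bsub>B\<^esub> b') + bvec (a, b) + bvec (a, b') | a b b'.
       a \<in> carrier A \<and> b \<in> carrier B \<and> b' \<in> carrier B} \<and>
     x \<otimes>\<^bsub>P\<^esub> bvec (c, d) \<in> {bvec (a \<oplus>\<^bsub>A\<^esub> a', b) + bvec (a, b) + bvec (a', b) | a a' b.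
       a \<in> carrier A \<and> a' \<in> carrier A \<and> b \<in> carrier B} \<union>
    {bvec (a, b \<oplus>\<^bsub>B\<^esub> b') + bvec (a, b) + bvec (a, b') | a b b'.
       a \<in> carrier A \<and> b \<in> carrier B \<and> b' \<in> carrier B}"
      using * cd by (blast intro: A.m_closed B.m_closed)
  qed
  have basis: "bvec (c, d) \<otimes>\<^bsub>P\<^esub> x \<in> I \<and> x \<otimes>\<^bsub>P\<^esub> bvec (c, d) \<in> I"
    if "x \<in> I" and cd: "c \<in> carrier A" "d \<in> carrier B" for x c d
    using that(1) rels_subset unfolding tensor_ideal_def
  proof (induction rule: P.gspan_induct)
    case zero
    have "bvec (c, d) \<otimes>\<^bsub>P\<^esub> \<zero>\<^bsub>P\<^esub> = \<zero>\<^bsub>P\<^esub>" "\<zero>\<^bsub>P\<^esub> \<otimes>\<^bsub>P\<^esub> bvec (c, d) = \<zero>\<^bsub>P\<^esub>"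
      using cd by (auto intro!: P.r_null P.l_null pair_bvec)
    then show ?case by (metis P.gspan_zero)
  next
    case (incl x)
    then show ?case using rel cd by (blast intro: P.gspan_incl)
  next
    case (add x y)
    then show ?case
      using P.gspan_closed[OF _ rels_subset] cd
      by (simp add: pair_bvec P.r_distr P.l_distr P.gspan_add)
  qed
  have all: "y \<otimes>\<^bsub>P\<^esub> x \<in> I \<and> x \<otimes>\<^bsub>P\<^esub> y \<in> I" if "x \<in> I" "y \<in> carrier P" for x y
    using that(2) unfolding pair_carrier mem_Collect_eq
  proof (induction rule: bit_poly_induct)
    case zero
    then show ?case
      using I_carr[OF \<open>x \<in> I\<close>] subgroup.one_closed[OF sub] by (simp flip: pair_zero)
  next
    case (bvec p)
    then show ?case using basis[OF \<open>x \<in> I\<close>] by (cases p) auto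
  next
    case (add f g)
    then show ?case
      using I_carr[OF \<open>x \<in> I\<close>] subgroup.m_closed[OF sub]
      by (simp add: P.r_distr P.l_distr pair_carrier flip: pair_add)
  qed
  show ?thesis
    using all sub P.ring_axioms by (intro idealI) auto
qed

lemma tensor_ideal_subgroup: "subgroup I (add_monoid P)"
  by (rule additive_subgroup.a_subgroup[OF ideal.axioms(1)[OF tensor_ideal_ideal]])

sublocale T: bit_ring T
  unfolding tensor_ring_def by (rule P.quot_bit_ring[OF tensor_ideal_ideal])

abbreviation tens (infixl "\<odot>\<odot>" 75) where "a \<odot>\<odot> b \<equiv> alg_tensor A B a b"

lemma tens_closed [intro, simp]: "a \<in> carrier A \<Longrightarrow> b \<in> carrier B \<Longrightarrow> a \<odot>\<odot> b \<in> carrier T"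
  unfolding alg_tensor_def tensor_ring_def
  by (intro P.quot_closed tensor_ideal_subgroup pair_bvec)

lemma tens_mult:
  assumes "a \<in> carrier A" "b \<in> carrier B" "c \<in> carrier A" "d \<in> carrier B"
  shows "(a \<odot>\<odot> b) \<otimes>\<^bsub>T\<^esub> (c \<odot>\<odot> d) = (a \<otimes>\<^bsub>A\<^esub> c) \<odot>\<odot> (b \<otimes>\<^bsub>B\<^esub> d)"
  unfolding alg_tensor_def tensor_ring_def using assms
  by (simp add: P.quot_mult[OF tensor_ideal_ideal] pair_bvec) (simp add: pair_mult)

lemma tens_one: "\<one>\<^bsub>T\<^esub> = \<one>\<^bsub>A\<^esub> \<odot>\<odot> \<one>\<^bsub>B\<^esub>"
  by (simp add: tensor_ring_def FactRing_def alg_tensor_def pair_one)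

lemma presented: "presented_space (carrier A \<times> carrier B) P (biadditive_rels A B)"
  by (rule presented_space.intro[OF pair_free rels_subset])

abbreviation "J \<equiv> presented_space.H P (biadditive_rels A B)"

lemma T_def: "T = P Quot J"
  by (simp add: tensor_ring_def tensor_ideal_def presented_space.H_def[OF presented])

lemma tens_def: "a \<odot>\<odot> b = J +>\<^bsub>P\<^esub> bvec (a, b)"
  by (simp add: alg_tensor_def tensor_ideal_def presented_space.H_def[OF presented])

lemma tens_add_left:
  assumes "a \<in> carrier A" "a' \<in> carrier A" "b \<in> carrier B"
  shows "(a \<oplus>\<^bsub>A\<^esub> a') \<odot>\<odot> b = (a \<odot>\<odot> b) \<oplus>\<^bsub>T\<^esub> (a' \<odot>\<odot> b)"
  unfolding T_def tens_def using assms
  by (intro presented_space.class_rel[OF presented]) (auto simp: biadditive_rels_def add.assoc)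

lemma tens_add_right:
  assumes "a \<in> carrier A" "b \<in> carrier B" "b' \<in> carrier B"
  shows "a \<odot>\<odot> (b \<oplus>\<^bsub>B\<^esub> b') = (a \<odot>\<odot> b) \<oplus>\<^bsub>T\<^esub> (a \<odot>\<odot> b')"
  unfolding T_def tens_def using assms
  by (intro presented_space.class_rel[OF presented]) (auto simp: biadditive_rels_def add.assoc)

lemma tens_zero [simp]:
  "b \<in> carrier B \<Longrightarrow> \<zero>\<^bsub>A\<^esub> \<odot>\<odot> b = \<zero>\<^bsub>T\<^esub>" "a \<in> carrier A \<Longrightarrow> a \<odot>\<odot> \<zero>\<^bsub>B\<^esub> = \<zero>\<^bsub>T\<^esub>"
  using tens_add_left[of "\<zero>\<^bsub>A\<^esub>" "\<zero>\<^bsub>A\<^esub>" b] tens_add_right[of a "\<zero>\<^bsub>B\<^esub>" "\<zero>\<^bsub>B\<^esub>"] by auto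

lemma tensor_induct [consumes 1, case_names tens add]:
  assumes "X \<in> carrier T"
    and tens: "\<And>a b. a \<in> carrier A \<Longrightarrow> b \<in> carrier B \<Longrightarrow> Q (a \<odot>\<odot> b)"
    and add: "\<And>X Y. X \<in> carrier T \<Longrightarrow> Y \<in> carrier T \<Longrightarrow> Q X \<Longrightarrow> Q Y \<Longrightarrow> Q (X \<oplus>\<^bsub>T\<^esub> Y)"
  shows "Q X"
proof (rule presented_space.quotient_induct[OF presented assms(1)[unfolded T_def]], goal_cases)
  case 1
  \<comment> \<open>Zero is itself a pure tensor, so this case is an instance of
    \<open>tens\<close>.\<close>
  show ?case using tens[of "\<zero>\<^bsub>A\<^esub>" "\<zero>\<^bsub>B\<^esub>"] by (simp add: T_def)
next
  case (2 p)
  then show ?case using tens by (cases p) (auto simp: tens_def)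
next
  case (3 X Y)
  then show ?case using add by (simp add: T_def)
qed

lemma tensor_map:
  assumes N: "bit_space N" and \<phi>: "\<And>a b. a \<in> carrier A \<Longrightarrow> b \<in> carrier B \<Longrightarrow> \<phi> a b \<in> carrier N"
    and addl: "\<And>a a' b. a \<in> carrier A \<Longrightarrow> a' \<in> carrier A \<Longrightarrow> b \<in> carrier B \<Longrightarrow>
      \<phi> (a \<oplus>\<^bsub>A\<^esub> a') b = \<phi> a b \<oplus>\<^bsub>N\<^esub> \<phi> a' b"
    and addr: "\<And>a b b'. a \<in> carrier A \<Longrightarrow> b \<in> carrier B \<Longrightarrow> b' \<in> carrier B \<Longrightarrow>
      \<phi> a (b \<oplus>\<^bsub>B\<^esub> b') = \<phi> a b \<oplus>\<^bsub>N\<^esub> \<phi> a b'"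
  defines "F \<equiv> induced N (\<lambda>(a, b). \<phi> a b)"
  shows tensor_map_tens: "\<And>a b. a \<in> carrier A \<Longrightarrow> b \<in> carrier B \<Longrightarrow> F (a \<odot>\<odot> b) = \<phi> a b"
    and tensor_map_closed: "\<And>X. X \<in> carrier T \<Longrightarrow> F X \<in> carrier N"
    and tensor_map_add: "\<And>X Y. X \<in> carrier T \<Longrightarrow> Y \<in> carrier T \<Longrightarrow> F (X \<oplus>\<^bsub>T\<^esub> Y) = F X \<oplus>\<^bsub>N\<^esub> F Y"
proof -
  interpret N: bit_space N by (rule N)
  let ?S = "carrier A \<times> carrier B" and ?\<phi> = "\<lambda>(a, b). \<phi> a b"
  have pi: "?\<phi> \<in> ?S \<rightarrow> carrier N" using \<phi> by auto
  have rel: "linear_ext N ?\<phi> g = \<zero>\<^bsub>N\<^esub>" if "g \<in> biadditive_rels A B" for g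
    using that unfolding biadditive_rels_def
    by (auto simp: N.linear_ext_add[OF pi] keys_add_subset \<phi> addl addr N.a_ac)
  note ind = presented_space.induced_map[OF presented N pi rel, folded T_def]
  show "F (a \<odot>\<odot> b) = \<phi> a b" if "a \<in> carrier A" "b \<in> carrier B" for a b
    unfolding F_def tens_def using that ind(2)[of "(a, b)"] by simp
  show "F X \<in> carrier N" if "X \<in> carrier T" for X
    unfolding F_def using that ind(3) by simp
  show "F (X \<oplus>\<^bsub>T\<^esub> Y) = F X \<oplus>\<^bsub>N\<^esub> F Y" if "X \<in> carrier T" "Y \<in> carrier T" for X Y
    unfolding F_def using that ind(4) by simp
qed

end

lemma bit_space_cong:
  assumes "bit_space N" "carrier N' = carrier N" "zero N' = zero N" "add N' = add N"
  shows "bit_space N'"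
proof -
  interpret bit_space N by (rule assms(1))
  show ?thesis
  proof (intro bit_spaceI abelian_groupI)
    fix x assume "x \<in> carrier N'"
    then show "\<exists>y\<in>carrier N'. y \<oplus>\<^bsub>N'\<^esub> x = \<zero>\<^bsub>N'\<^esub>"
      using assms(2-) by (intro bexI[of _ x]) simp_all
  qed (use assms(2-) in \<open>simp_all add: a_ac\<close>)
qed

subsection \<open>The differential of a tensor product\<close>

lemma tensor_dga_simps [simp]:
  "carrier (tensor_dga A B) = carrier (tensor_ring A B)"
  "mult (tensor_dga A B) = mult (tensor_ring A B)"
  "one (tensor_dga A B) = one (tensor_ring A B)"
  "zero (tensor_dga A B) = zero (tensor_ring A B)"
  "add (tensor_dga A B) = add (tensor_ring A B)"
  by (simp_all add: tensor_dga_def ring.defs)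

lemma diff_tensor_dga: "diff (tensor_dga A B) = induced (tensor_ring A B)
    (\<lambda>(a, b). alg_tensor A B (diff A a) b \<oplus>\<^bsub>tensor_ring A B\<^esub> alg_tensor A B a (diff B b))"
  by (simp add: tensor_dga_def ring.defs dga.defs)

lemma homog_tensor_dga: "homog (tensor_dga A B) d = gspan (tensor_ring A B)
    {alg_tensor A B a b | a b. \<exists>d\<^sub>1 d\<^sub>2. a \<in> homog A d\<^sub>1 \<and> b \<in> homog B d\<^sub>2 \<and> d\<^sub>1 + d\<^sub>2 = d}"
  by (simp add: tensor_dga_def ring.defs dga.defs)

locale dg_space = bit_ring A for A :: "'a dga" (structure) +
  assumes diff_closed [intro, simp]: "a \<in> carrier A \<Longrightarrow> diff A a \<in> carrier A"
    and diff_add: "a \<in> carrier A \<Longrightarrow> b \<in> carrier A \<Longrightarrow> diff A (a \<oplus> b) = diff A a \<oplus> diff A b"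

locale dg_pair = A: dg_space A + B: dg_space B for A :: "'a dga" and B :: "'b dga"
begin

sublocale alg_pair A B by unfold_locales

text \<open>The Leibniz formula, without signs in characteristic two, is biadditive in the two
  factors and therefore descends to the tensor product.\<close>

lemma diff_rules:
  shows diff_tens: "a \<in> carrier A \<Longrightarrow> b \<in> carrier B \<Longrightarrow>
      diff (tensor_dga A B) (a \<odot>\<odot> b) = (diff A a \<odot>\<odot> b) \<oplus>\<^bsub>T\<^esub> (a \<odot>\<odot> diff B b)"
    and diff_tens_closed: "X \<in> carrier T \<Longrightarrow> diff (tensor_dga A B) X \<in> carrier T"
    and diff_tens_add: "X \<in> carrier T \<Longrightarrow> Y \<in> carrier T \<Longrightarrow>
      diff (tensor_dga A B) (X \<oplus>\<^bsub>T\<^esub> Y) = diff (tensor_dga A B) X \<oplus>\<^bsub>T\<^esub> diff (tensor_dga A B) Y"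
proof -
  let ?\<phi> = "\<lambda>a b. (diff A a \<odot>\<odot> b) \<oplus>\<^bsub>T\<^esub> (a \<odot>\<odot> diff B b)"
  have 1: "\<And>a b. a \<in> carrier A \<Longrightarrow> b \<in> carrier B \<Longrightarrow> ?\<phi> a b \<in> carrier T" by simp
  have 2: "\<And>a a' b. a \<in> carrier A \<Longrightarrow> a' \<in> carrier A \<Longrightarrow> b \<in> carrier B \<Longrightarrow>
      ?\<phi> (a \<oplus>\<^bsub>A\<^esub> a') b = ?\<phi> a b \<oplus>\<^bsub>T\<^esub> ?\<phi> a' b"
    by (simp add: A.diff_add tens_add_left T.a_ac)
  have 3: "\<And>a b b'. a \<in> carrier A \<Longrightarrow> b \<in> carrier B \<Longrightarrow> b' \<in> carrier B \<Longrightarrow>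
      ?\<phi> a (b \<oplus>\<^bsub>B\<^esub> b') = ?\<phi> a b \<oplus>\<^bsub>T\<^esub> ?\<phi> a b'"
    by (simp add: B.diff_add tens_add_right T.a_ac)
  note map = tensor_map[OF T.bit_space_axioms 1 2 3]
  show "a \<in> carrier A \<Longrightarrow> b \<in> carrier B \<Longrightarrow>
      diff (tensor_dga A B) (a \<odot>\<odot> b) = (diff A a \<odot>\<odot> b) \<oplus>\<^bsub>T\<^esub> (a \<odot>\<odot> diff B b)"
    unfolding diff_tensor_dga by (rule map(1))
  show "X \<in> carrier T \<Longrightarrow> diff (tensor_dga A B) X \<in> carrier T"
    unfolding diff_tensor_dga by (rule map(2))
  show "X \<in> carrier T \<Longrightarrow> Y \<in> carrier T \<Longrightarrow>
      diff (tensor_dga A B) (X \<oplus>\<^bsub>T\<^esub> Y) = diff (tensor_dga A B) X \<oplus>\<^bsub>T\<^esub> diff (tensor_dga A B) Y"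
    unfolding diff_tensor_dga by (rule map(3))
qed

lemma tensor_dga_dg_space: "dg_space (tensor_dga A B)"
proof -
  interpret D: bit_ring "tensor_dga A B"
    by (rule bit_ring_cong[OF T.bit_ring_axioms]) simp_all
  show ?thesis
    by unfold_locales (simp_all add: diff_tens_closed diff_tens_add)
qed

end

section \<open>Tensor products with modules\<close>

text \<open>The assumptions on K and M are so weak that the tensor module satisfies them in turn
  (\<open>mod_pair_T\<close>). This gives the iterated product A \<otimes> (A \<otimes> M), which
  occurs in the structure equation.\<close>

locale mod_pair = A: bit_ring A + M: bit_space M
  for K :: "('a, 'k) ring_scheme" and A :: "('a, 'l) ring_scheme" and M :: "('a, 'b, 'm) module_scheme" +
  assumes K_closed: "k \<in> carrier K \<Longrightarrow> k \<in> carrier A"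
    and smult_closed [simp]: "k \<in> carrier K \<Longrightarrow> x \<in> carrier M \<Longrightarrow> k \<odot>\<^bsub>M\<^esub> x \<in> carrier M"
begin

abbreviation "T \<equiv> tensor_module K A M"
abbreviation "F \<equiv> free_space (carrier A \<times> carrier M)"
abbreviation "balance \<equiv> {bvec (a \<otimes>\<^bsub>A\<^esub> k, x) + bvec (a, k \<odot>\<^bsub>M\<^esub> x) | a k x.
        a \<in> carrier A \<and> k \<in> carrier K \<and> x \<in> carrier M}"
abbreviation "G \<equiv> biadditive_rels A M \<union> balance"
abbreviation "H \<equiv> presented_space.H F G"
abbreviation tens (infixl "\<boxtimes>" 75) where "a \<boxtimes> x \<equiv> mod_tensor K A M a x"

lemma T_simps [simp]:
  "carrier T = carrier (tensor_group K A M)" "zero T = zero (tensor_group K A M)"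
  "add T = add (tensor_group K A M)"
  by (simp_all add: tensor_module_def ring.defs)

lemma smult_T: "a \<odot>\<^bsub>T\<^esub> X = induced (tensor_group K A M) (\<lambda>(b, x). (a \<otimes>\<^bsub>A\<^esub> b) \<boxtimes> x) X"
  by (simp add: tensor_module_def ring.defs module.defs)

lemma presented: "presented_space (carrier A \<times> carrier M) F G"
proof (rule presented_space.intro[OF free_on_free_space])
  have "bvec (a, b) + bvec (a', b') + bvec (a'', b'') \<in> carrier F"
    if "{a, a', a''} \<subseteq> carrier A" "{b, b', b''} \<subseteq> carrier M" for a b a' b' a'' b''
    unfolding free_space_simps mem_Collect_eq using that by (intro keys_add_subset) auto
  moreover have "bvec (a, b) + bvec (a', b') \<in> carrier F"
    if "{a, a'} \<subseteq> carrier A" "{b, b'} \<subseteq> carrier M" for a b a' b'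
    unfolding free_space_simps mem_Collect_eq using that by (intro keys_add_subset) auto
  ultimately show "G \<subseteq> carrier F"
    unfolding biadditive_rels_def
    by (intro Un_least subsetI) (elim CollectE exE conjE; simp add: K_closed del: free_space_simps)+
qed

lemma group_def: "tensor_group K A M = F Quot H"
  by (simp add: tensor_group_def mod_tensor_kernel_def presented_space.H_def[OF presented])

lemma tens_def: "a \<boxtimes> x = H +>\<^bsub>F\<^esub> bvec (a, x)"
  by (simp add: mod_tensor_def mod_tensor_kernel_def presented_space.H_def[OF presented])

sublocale TG: bit_space "tensor_group K A M"
  unfolding group_def
  by (rule bit_space.quot_bit_space[OF free_on_bit_space[OF free_on_free_space]
        presented_space.H_subgroup[OF presented]])

sublocale T: bit_space T
  by (rule bit_space_cong[OF TG.bit_space_axioms]) simp_all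

lemma tens_closed [intro, simp]: "a \<in> carrier A \<Longrightarrow> x \<in> carrier M \<Longrightarrow> a \<boxtimes> x \<in> carrier (tensor_group K A M)"
  unfolding group_def tens_def by (rule presented_space.class_closed[OF presented]) simp

lemma tens_add_left:
  assumes "a \<in> carrier A" "a' \<in> carrier A" "x \<in> carrier M"
  shows "(a \<oplus>\<^bsub>A\<^esub> a') \<boxtimes> x = (a \<boxtimes> x) \<oplus>\<^bsub>tensor_group K A M\<^esub> (a' \<boxtimes> x)"
  unfolding group_def tens_def using assms
  by (intro presented_space.class_rel[OF presented]) (auto simp: biadditive_rels_def add.assoc)

lemma tens_add_right:
  assumes "a \<in> carrier A" "x \<in> carrier M" "x' \<in> carrier M"
  shows "a \<boxtimes> (x \<oplus>\<^bsub>M\<^esub> x') = (a \<boxtimes> x) \<oplus>\<^bsub>tensor_group K A M\<^esub> (a \<boxtimes> x')"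
  unfolding group_def tens_def using assms
  by (intro presented_space.class_rel[OF presented]) (auto simp: biadditive_rels_def add.assoc)

lemma tens_zero [simp]:
  "x \<in> carrier M \<Longrightarrow> \<zero>\<^bsub>A\<^esub> \<boxtimes> x = \<zero>\<^bsub>tensor_group K A M\<^esub>"
  "a \<in> carrier A \<Longrightarrow> a \<boxtimes> \<zero>\<^bsub>M\<^esub> = \<zero>\<^bsub>tensor_group K A M\<^esub>"
  using tens_add_left[of "\<zero>\<^bsub>A\<^esub>" "\<zero>\<^bsub>A\<^esub>" x] tens_add_right[of a "\<zero>\<^bsub>M\<^esub>" "\<zero>\<^bsub>M\<^esub>"] by auto

lemma tens_balance:
  assumes "a \<in> carrier A" "k \<in> carrier K" "x \<in> carrier M"
  shows "(a \<otimes>\<^bsub>A\<^esub> k) \<boxtimes> x = a \<boxtimes> (k \<odot>\<^bsub>M\<^esub> x)"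
proof -
  interpret S: presented_space "carrier A \<times> carrier M" F G by (rule presented)
  have "bvec (a \<otimes>\<^bsub>A\<^esub> k, x) \<oplus>\<^bsub>F\<^esub> bvec (a, k \<odot>\<^bsub>M\<^esub> x) \<in> H"
    using assms by (intro S.H_incl) (auto)
  then show ?thesis
    unfolding tens_def using assms
    by (intro S.R.quot_eqI[OF S.H_subgroup]) (auto simp: K_closed)
qed

lemma tens_induct [consumes 1, case_names tens add]:
  assumes "X \<in> carrier (tensor_group K A M)"
    and tens: "\<And>a x. a \<in> carrier A \<Longrightarrow> x \<in> carrier M \<Longrightarrow> Q (a \<boxtimes> x)"
    and add: "\<And>X Y. X \<in> carrier (tensor_group K A M) \<Longrightarrow> Y \<in> carrier (tensor_group K A M) \<Longrightarrow>
      Q X \<Longrightarrow> Q Y \<Longrightarrow> Q (X \<oplus>\<^bsub>tensor_group K A M\<^esub> Y)"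
  shows "Q X"
proof (rule presented_space.quotient_induct[OF presented assms(1)[unfolded group_def]], goal_cases)
  case 1
  show ?case using tens[of "\<zero>\<^bsub>A\<^esub>" "\<zero>\<^bsub>M\<^esub>"] by (simp add: group_def)
next
  case (2 p)
  then show ?case using tens by (cases p) (auto simp: tens_def)
next
  case (3 X Y)
  then show ?case using add by (simp add: group_def)
qed

lemma tens_map:
  assumes N: "bit_space N" and \<phi>: "\<And>a x. a \<in> carrier A \<Longrightarrow> x \<in> carrier M \<Longrightarrow> \<phi> a x \<in> carrier N"
    and addl: "\<And>a a' x. a \<in> carrier A \<Longrightarrow> a' \<in> carrier A \<Longrightarrow> x \<in> carrier M \<Longrightarrow>
      \<phi> (a \<oplus>\<^bsub>A\<^esub> a') x = \<phi> a x \<oplus>\<^bsub>N\<^esub> \<phi> a' x"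
    and addr: "\<And>a x x'. a \<in> carrier A \<Longrightarrow> x \<in> carrier M \<Longrightarrow> x' \<in> carrier M \<Longrightarrow>
      \<phi> a (x \<oplus>\<^bsub>M\<^esub> x') = \<phi> a x \<oplus>\<^bsub>N\<^esub> \<phi> a x'"
    and bal: "\<And>a k x. a \<in> carrier A \<Longrightarrow> k \<in> carrier K \<Longrightarrow> x \<in> carrier M \<Longrightarrow>
      \<phi> (a \<otimes>\<^bsub>A\<^esub> k) x = \<phi> a (k \<odot>\<^bsub>M\<^esub> x)"
  shows tens_map_tens: "\<And>a x. a \<in> carrier A \<Longrightarrow> x \<in> carrier M \<Longrightarrow> induced N (\<lambda>(a, x). \<phi> a x) (a \<boxtimes> x) = \<phi> a x"
    and tens_map_closed: "\<And>X. X \<in> carrier (tensor_group K A M) \<Longrightarrow> induced N (\<lambda>(a, x). \<phi> a x) X \<in> carrier N"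
    and tens_map_add: "\<And>X Y. X \<in> carrier (tensor_group K A M) \<Longrightarrow> Y \<in> carrier (tensor_group K A M) \<Longrightarrow>
      induced N (\<lambda>(a, x). \<phi> a x) (X \<oplus>\<^bsub>tensor_group K A M\<^esub> Y) =
      induced N (\<lambda>(a, x). \<phi> a x) X \<oplus>\<^bsub>N\<^esub> induced N (\<lambda>(a, x). \<phi> a x) Y"
proof -
  interpret N: bit_space N by (rule N)
  let ?\<phi> = "\<lambda>(a, x). \<phi> a x"
  have pi: "?\<phi> \<in> carrier A \<times> carrier M \<rightarrow> carrier N" using \<phi> by auto
  have rel: "linear_ext N ?\<phi> g = \<zero>\<^bsub>N\<^esub>" if "g \<in> G" for g
    using that unfolding biadditive_rels_def
    by (auto simp: N.linear_ext_add[OF pi] keys_add_subset \<phi> addl addr N.a_ac K_closed bal)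
  note ind = presented_space.induced_map[OF presented N pi rel, folded group_def]
  show "induced N ?\<phi> (a \<boxtimes> x) = \<phi> a x" if "a \<in> carrier A" "x \<in> carrier M" for a x
    unfolding tens_def using that ind(2)[of "(a, x)"] by simp
  show "induced N ?\<phi> X \<in> carrier N" if "X \<in> carrier (tensor_group K A M)" for X
    using that ind(3) by simp
  show "induced N ?\<phi> (X \<oplus>\<^bsub>tensor_group K A M\<^esub> Y) = induced N ?\<phi> X \<oplus>\<^bsub>N\<^esub> induced N ?\<phi> Y"
    if "X \<in> carrier (tensor_group K A M)" "Y \<in> carrier (tensor_group K A M)" for X Y
    using that ind(4) by simp
qed

text \<open>Left multiplication by a commutes with the right action of K by associativity, so it
  respects the balancing relations.\<close>

lemma act_rules:
  assumes a: "a \<in> carrier A"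
  shows act_tens: "\<And>b x. b \<in> carrier A \<Longrightarrow> x \<in> carrier M \<Longrightarrow> a \<odot>\<^bsub>T\<^esub> (b \<boxtimes> x) = (a \<otimes>\<^bsub>A\<^esub> b) \<boxtimes> x"
    and act_closed [simp]: "\<And>X. X \<in> carrier (tensor_group K A M) \<Longrightarrow> a \<odot>\<^bsub>T\<^esub> X \<in> carrier (tensor_group K A M)"
    and act_add_right: "\<And>X Y. X \<in> carrier (tensor_group K A M) \<Longrightarrow> Y \<in> carrier (tensor_group K A M) \<Longrightarrow>
      a \<odot>\<^bsub>T\<^esub> (X \<oplus>\<^bsub>tensor_group K A M\<^esub> Y) = a \<odot>\<^bsub>T\<^esub> X \<oplus>\<^bsub>tensor_group K A M\<^esub> a \<odot>\<^bsub>T\<^esub> Y"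
proof -
  let ?\<phi> = "\<lambda>b x. (a \<otimes>\<^bsub>A\<^esub> b) \<boxtimes> x"
  have 1: "\<And>b x. b \<in> carrier A \<Longrightarrow> x \<in> carrier M \<Longrightarrow> ?\<phi> b x \<in> carrier (tensor_group K A M)"
    using a by simp
  have 2: "\<And>b b' x. b \<in> carrier A \<Longrightarrow> b' \<in> carrier A \<Longrightarrow> x \<in> carrier M \<Longrightarrow>
      ?\<phi> (b \<oplus>\<^bsub>A\<^esub> b') x = ?\<phi> b x \<oplus>\<^bsub>tensor_group K A M\<^esub> ?\<phi> b' x"
    using a by (simp add: A.r_distr tens_add_left)
  have 3: "\<And>b x x'. b \<in> carrier A \<Longrightarrow> x \<in> carrier M \<Longrightarrow> x' \<in> carrier M \<Longrightarrow>
      ?\<phi> b (x \<oplus>\<^bsub>M\<^esub> x') = ?\<phi> b x \<oplus>\<^bsub>tensor_group K A M\<^esub> ?\<phi> b x'"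
    using a by (simp add: tens_add_right)
  have 4: "\<And>b k x. b \<in> carrier A \<Longrightarrow> k \<in> carrier K \<Longrightarrow> x \<in> carrier M \<Longrightarrow>
      ?\<phi> (b \<otimes>\<^bsub>A\<^esub> k) x = ?\<phi> b (k \<odot>\<^bsub>M\<^esub> x)"
    using a by (simp add: K_closed tens_balance flip: A.m_assoc)
  note map = tens_map[OF TG.bit_space_axioms 1 2 3 4]
  show "\<And>b x. b \<in> carrier A \<Longrightarrow> x \<in> carrier M \<Longrightarrow> a \<odot>\<^bsub>T\<^esub> (b \<boxtimes> x) = (a \<otimes>\<^bsub>A\<^esub> b) \<boxtimes> x"
    unfolding smult_T by (rule map(1))
  show "\<And>X. X \<in> carrier (tensor_group K A M) \<Longrightarrow> a \<odot>\<^bsub>T\<^esub> X \<in> carrier (tensor_group K A M)"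
    unfolding smult_T by (rule map(2))
  show "\<And>X Y. X \<in> carrier (tensor_group K A M) \<Longrightarrow> Y \<in> carrier (tensor_group K A M) \<Longrightarrow>
      a \<odot>\<^bsub>T\<^esub> (X \<oplus>\<^bsub>tensor_group K A M\<^esub> Y) = a \<odot>\<^bsub>T\<^esub> X \<oplus>\<^bsub>tensor_group K A M\<^esub> a \<odot>\<^bsub>T\<^esub> Y"
    unfolding smult_T by (rule map(3))
qed

lemma act_zero: "a \<in> carrier A \<Longrightarrow> a \<odot>\<^bsub>T\<^esub> \<zero>\<^bsub>tensor_group K A M\<^esub> = \<zero>\<^bsub>tensor_group K A M\<^esub>"
  using act_add_right[of a "\<zero>\<^bsub>tensor_group K A M\<^esub>" "\<zero>\<^bsub>tensor_group K A M\<^esub>"] by simp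

lemma act_add_left:
  assumes "a \<in> carrier A" "b \<in> carrier A" "X \<in> carrier (tensor_group K A M)"
  shows "(a \<oplus>\<^bsub>A\<^esub> b) \<odot>\<^bsub>T\<^esub> X = a \<odot>\<^bsub>T\<^esub> X \<oplus>\<^bsub>tensor_group K A M\<^esub> b \<odot>\<^bsub>T\<^esub> X"
  using assms(3)
proof (induction rule: tens_induct)
  case (tens c x)
  then show ?case using assms by (simp add: act_tens A.l_distr tens_add_left)
next
  case (add X Y)
  then show ?case using assms by (simp add: act_add_right TG.a_ac)
qed

lemma act_assoc:
  assumes "a \<in> carrier A" "b \<in> carrier A" "X \<in> carrier (tensor_group K A M)"
  shows "(a \<otimes>\<^bsub>A\<^esub> b) \<odot>\<^bsub>T\<^esub> X = a \<odot>\<^bsub>T\<^esub> (b \<odot>\<^bsub>T\<^esub> X)"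
  using assms(3)
proof (induction rule: tens_induct)
  case (tens c x)
  then show ?case using assms by (simp add: act_tens A.m_assoc)
next
  case (add X Y)
  then show ?case using assms by (simp add: act_add_right)
qed

lemma mod_pair_T: "mod_pair K A T"
  by unfold_locales (simp_all add: K_closed)

end

section \<open>A criterion for type D structures\<close>

text \<open>The condition \<open>diff_K\<close> says that the elements of K behave as cycles; it is
  what makes \<partial> \<otimes> id compatible with the tensor product over K. Linearity of
  \<delta> over K does the same for id \<otimes> \<delta>.\<close>

locale type_D_data = A: dg_space A + mod_pair K A M
  for K :: "('a, 'k) ring_scheme" and A :: "'a dga" and M :: "('a, 'b) module" +
  fixes \<delta> :: "'b \<Rightarrow> (('a \<times> 'b) \<Rightarrow>\<^sub>0 bit) set"
  assumes diff_K: "a \<in> carrier A \<Longrightarrow> k \<in> carrier K \<Longrightarrow> diff A (a \<otimes>\<^bsub>A\<^esub> k) = diff A a \<otimes>\<^bsub>A\<^esub> k"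
    and \<delta>_closed: "x \<in> carrier M \<Longrightarrow> \<delta> x \<in> carrier (tensor_group K A M)"
    and \<delta>_add: "x \<in> carrier M \<Longrightarrow> y \<in> carrier M \<Longrightarrow> \<delta> (x \<oplus>\<^bsub>M\<^esub> y) = \<delta> x \<oplus>\<^bsub>tensor_group K A M\<^esub> \<delta> y"
    and \<delta>_smult: "k \<in> carrier K \<Longrightarrow> x \<in> carrier M \<Longrightarrow> \<delta> (k \<odot>\<^bsub>M\<^esub> x) = k \<odot>\<^bsub>T\<^esub> \<delta> x"
begin

interpretation TT: mod_pair K A T by (rule mod_pair_T)

text \<open>The structure equation measures the failure of this map to vanish.\<close>

definition curvature :: "(('a \<times> 'b) \<Rightarrow>\<^sub>0 bit) set \<Rightarrow> (('a \<times> 'b) \<Rightarrow>\<^sub>0 bit) set"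
  where "curvature X = diff_tensor_id K A M X \<oplus>\<^bsub>T\<^esub> mult_tensor_id K A M (id_tensor_delta K A M \<delta> X)"

lemma diff_tensor_id_rules:
  shows "\<And>a x. a \<in> carrier A \<Longrightarrow> x \<in> carrier M \<Longrightarrow> diff_tensor_id K A M (a \<boxtimes> x) = diff A a \<boxtimes> x"
    and "\<And>X. X \<in> carrier T \<Longrightarrow> diff_tensor_id K A M X \<in> carrier T"
    and "\<And>X Y. X \<in> carrier T \<Longrightarrow> Y \<in> carrier T \<Longrightarrow>
      diff_tensor_id K A M (X \<oplus>\<^bsub>T\<^esub> Y) = diff_tensor_id K A M X \<oplus>\<^bsub>T\<^esub> diff_tensor_id K A M Y"
  unfolding diff_tensor_id_def T_simps
  by (rule tens_map[OF T.bit_space_axioms, unfolded T_simps];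
      simp add: A.diff_add diff_K tens_add_left tens_add_right tens_balance)+

lemma mult_tensor_id_rules:
  shows "\<And>a X. a \<in> carrier A \<Longrightarrow> X \<in> carrier T \<Longrightarrow>
      mult_tensor_id K A M (mod_tensor K A T a X) = a \<odot>\<^bsub>T\<^esub> X"
    and "\<And>X. X \<in> carrier TT.T \<Longrightarrow> mult_tensor_id K A M X \<in> carrier T"
    and "\<And>X Y. X \<in> carrier TT.T \<Longrightarrow> Y \<in> carrier TT.T \<Longrightarrow>
      mult_tensor_id K A M (X \<oplus>\<^bsub>TT.T\<^esub> Y) = mult_tensor_id K A M X \<oplus>\<^bsub>T\<^esub> mult_tensor_id K A M Y"
  unfolding mult_tensor_id_def T_simps TT.T_simps
  by (rule TT.tens_map[OF T.bit_space_axioms, unfolded T_simps];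
      simp add: act_add_left act_add_right act_assoc K_closed)+

lemma id_tensor_delta_rules:
  shows "\<And>a x. a \<in> carrier A \<Longrightarrow> x \<in> carrier M \<Longrightarrow>
      id_tensor_delta K A M \<delta> (a \<boxtimes> x) = mod_tensor K A T a (\<delta> x)"
    and "\<And>X. X \<in> carrier T \<Longrightarrow> id_tensor_delta K A M \<delta> X \<in> carrier TT.T"
    and "\<And>X Y. X \<in> carrier T \<Longrightarrow> Y \<in> carrier T \<Longrightarrow>
      id_tensor_delta K A M \<delta> (X \<oplus>\<^bsub>T\<^esub> Y) = id_tensor_delta K A M \<delta> X \<oplus>\<^bsub>TT.T\<^esub> id_tensor_delta K A M \<delta> Y"
  unfolding id_tensor_delta_def T_simps TT.T_simps
  by (rule tens_map[OF TT.T.bit_space_axioms, unfolded T_simps TT.T_simps];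
      simp add: \<delta>_closed \<delta>_add \<delta>_smult TT.tens_add_left TT.tens_balance
        TT.tens_add_right[unfolded T_simps])+

text \<open>On pure tensors this is the differential of the left module that A and M generate, a
  \<otimes> x \<mapsto> \<partial>a \<otimes> x + a \<delta>(x). The triple tensor product has
  disappeared, and the structure equation says that this map kills the image of \<delta>.\<close>

lemma curvature_tens:
  "a \<in> carrier A \<Longrightarrow> x \<in> carrier M \<Longrightarrow> curvature (a \<boxtimes> x) = (diff A a \<boxtimes> x) \<oplus>\<^bsub>T\<^esub> (a \<odot>\<^bsub>T\<^esub> \<delta> x)"
  unfolding curvature_def
  by (simp add: diff_tensor_id_rules id_tensor_delta_rules mult_tensor_id_rules \<delta>_closed)

lemma curvature_closed: "X \<in> carrier T \<Longrightarrow> curvature X \<in> carrier T"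
  unfolding curvature_def
  using diff_tensor_id_rules(2) id_tensor_delta_rules(2) mult_tensor_id_rules(2) T.a_closed by metis

lemma curvature_add:
  assumes "X \<in> carrier T" "Y \<in> carrier T"
  shows "curvature (X \<oplus>\<^bsub>T\<^esub> Y) = curvature X \<oplus>\<^bsub>T\<^esub> curvature Y"
  unfolding curvature_def
    diff_tensor_id_rules(3)[OF assms] id_tensor_delta_rules(3)[OF assms]
    mult_tensor_id_rules(3)[OF id_tensor_delta_rules(2)[OF assms(1)] id_tensor_delta_rules(2)[OF assms(2)]]
  using assms[THEN diff_tensor_id_rules(2)]
    assms[THEN id_tensor_delta_rules(2), THEN mult_tensor_id_rules(2)]
  by (simp add: TG.a_ac)

lemma type_D_structureI:
  assumes "graded_module D K M gr"
    and "\<And>h a x. (h, a) \<in> D \<Longrightarrow> x \<in> gr (h, a) \<Longrightarrow> \<delta> x \<in> tensor_homog K A M gr (h + 1, a)"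
    and "\<And>x. x \<in> carrier M \<Longrightarrow> curvature (\<delta> x) = \<zero>\<^bsub>T\<^esub>"
  shows "type_D_structure D K A M gr \<delta>"
  using assms unfolding type_D_structure_def Let_def curvature_def
  by (auto simp: \<delta>_closed \<delta>_add \<delta>_smult)

end

section \<open>The quiver algebras\<close>

subsection \<open>Paths\<close>

abbreviation target :: "nat set \<Rightarrow> label list \<Rightarrow> nat set"
  where "target \<equiv> foldl arrow_target"

lemma path_end_simp [simp]: "path_end (x, w) = target x w"
  by (simp add: path_end_def)

lemma composable_append [simp]:
  "composable x (u @ v) \<longleftrightarrow> composable x u \<and> composable (target x u) v"
  by (induction u arbitrary: x) auto

lemma mem_paths: "(x, w) \<in> paths s n \<longleftrightarrow> x \<subseteq> {0..n} \<and> set w \<subseteq> labels s n \<and> composable x w"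
  by (simp add: paths_def)

lemma arrow_target_subset: "x \<subseteq> {0..n} \<Longrightarrow> l \<in> labels s n \<Longrightarrow> arrow_target x l \<subseteq> {0..n}"
  by (cases l) (auto simp: labels_def)

lemma target_subset: "x \<subseteq> {0..n} \<Longrightarrow> set w \<subseteq> labels s n \<Longrightarrow> target x w \<subseteq> {0..n}"
proof (induction w arbitrary: x)
  case (Cons l w)
  then show ?case using arrow_target_subset[of x n l s] by simp
qed simp

lemma paths_append: "(x, u @ v) \<in> paths s n \<longleftrightarrow> (x, u) \<in> paths s n \<and> (target x u, v) \<in> paths s n"
  using target_subset[of x n u s] by (auto simp: mem_paths)

lemma path_mult_simp: "path_mult (x, u) (y, v) = (if target x u = y then bvec (x, u @ v) else 0)"
  by (simp add: path_mult_def)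

subsection \<open>The path algebra\<close>

abbreviation pmul (infixl "\<star>" 70) where "f \<star> g \<equiv> bilinear_ext path_mult f g"

lemma path_algebra_free: "free_on (paths s n) (path_algebra s n)"
  by (simp add: free_on_def path_algebra_def)

lemma path_algebra_simps [simp]:
  "carrier (path_algebra s n) = {f. Poly_Mapping.keys f \<subseteq> paths s n}"
  "add (path_algebra s n) = (+)" "zero (path_algebra s n) = 0"
  "mult (path_algebra s n) = (\<star>)"
  "one (path_algebra s n) = (\<Sum>x\<in>Pow {0..n}. bvec (x, []))"
  by (simp_all add: path_algebra_def)

lemma keys_path_mult: "p \<in> paths s n \<Longrightarrow> q \<in> paths s n \<Longrightarrow> Poly_Mapping.keys (path_mult p q) \<subseteq> paths s n"
  by (cases p; cases q) (auto simp: path_mult_simp paths_append)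

lemma sum_idempotents_left:
  assumes "p \<in> paths s n" shows "(\<Sum>x\<in>Pow {0..n}. bvec (x, [])) \<star> bvec p = bvec p"
proof -
  obtain y w where p: "p = (y, w)" "y \<in> Pow {0..n}" using assms by (cases p) (auto simp: mem_paths)
  then show ?thesis
    by (simp add: bilinear_ext_sum_left path_mult_simp sum.delta)
qed

lemma sum_idempotents_right:
  assumes "p \<in> paths s n" shows "bvec p \<star> (\<Sum>x\<in>Pow {0..n}. bvec (x, [])) = bvec p"
proof -
  obtain y w where p: "p = (y, w)" "target y w \<in> Pow {0..n}"
    using assms target_subset by (cases p) (auto simp: mem_paths)
  then show ?thesis
    by (simp add: bilinear_ext_sum_right path_mult_simp sum.delta')
qed

lemma path_algebra_bit_ring: "bit_ring (path_algebra s n)"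
proof (rule bit_ring_of_bilinear_ext[OF path_algebra_free])
  show "bilinear_ext path_mult (path_mult p q) (bvec r) = bilinear_ext path_mult (bvec p) (path_mult q r)"
    for p q r by (cases p; cases q; cases r) (auto simp: path_mult_simp)
qed (auto simp: keys_path_mult sum_idempotents_left sum_idempotents_right mem_paths
    intro!: keys_sum_subset)

interpretation PA: bit_ring "path_algebra s n" for s n
  by (rule path_algebra_bit_ring)

lemma relations_subset: "relations s n \<subseteq> carrier (path_algebra s n)"
proof -
  have "bvec p + bvec q \<in> carrier (path_algebra s n)"
    if "p \<in> paths s n" "q \<in> paths s n" for p q
    using that by (simp add: keys_add_subset)
  moreover have "(x, [UU i]) \<in> paths s n"
    if "(x, [RR i, LL i]) \<in> paths s n \<or> (x, [LL i, RR i]) \<in> paths s n" for x i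
    using that by (auto simp: mem_paths labels_def)
  ultimately show ?thesis
    unfolding relations_def
    by (intro Un_least subsetI; elim CollectE exE conjE; simp del: path_algebra_simps)
      (simp_all)
qed

lemma rel_ideal_ideal: "ideal (rel_ideal s n) (path_algebra s n)"
  unfolding rel_ideal_def by (rule PA.genideal_ideal[OF relations_subset])

lemma relations_rel_ideal: "f \<in> relations s n \<Longrightarrow> f \<in> rel_ideal s n"
  unfolding rel_ideal_def using PA.genideal_self[OF relations_subset] by blast

lemma rel_ideal_subgroup: "subgroup (rel_ideal s n) (add_monoid (path_algebra s n))"
  by (rule additive_subgroup.a_subgroup[OF ideal.axioms(1)[OF rel_ideal_ideal]])

lemma rel_ideal_carrier: "f \<in> rel_ideal s n \<Longrightarrow> f \<in> carrier (path_algebra s n)"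
  using subgroup.subset[OF rel_ideal_subgroup] by auto

lemma rel_ideal_add: "f \<in> rel_ideal s n \<Longrightarrow> g \<in> rel_ideal s n \<Longrightarrow> f + g \<in> rel_ideal s n"
  using subgroup.m_closed[OF rel_ideal_subgroup, of f s n g] by simp

lemma rel_ideal_zero: "0 \<in> rel_ideal s n"
  using subgroup.one_closed[OF rel_ideal_subgroup, of s n] by simp

lemma rel_ideal_mult:
  assumes "f \<in> rel_ideal s n" "g \<in> carrier (path_algebra s n)"
  shows "f \<star> g \<in> rel_ideal s n" "g \<star> f \<in> rel_ideal s n"
  using ideal.I_r_closed[OF rel_ideal_ideal assms] ideal.I_l_closed[OF rel_ideal_ideal assms]
  by simp_all

lemma rel_ideal_least:
  assumes "ideal J (path_algebra s n)" "relations s n \<subseteq> J" shows "rel_ideal s n \<subseteq> J"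
  unfolding rel_ideal_def by (rule PA.genideal_minimal[OF assms])

subsection \<open>The derivation\<close>

definition pdiff :: "(path \<Rightarrow>\<^sub>0 bit) \<Rightarrow> path \<Rightarrow>\<^sub>0 bit"
  where "pdiff f = (\<Sum>p\<in>Poly_Mapping.keys f. path_diff p)"

lemma pdiff_add: "pdiff (f + g) = pdiff f + pdiff g"
  by (simp add: pdiff_def sum_keys_add)

lemma pdiff_zero [simp]: "pdiff 0 = 0" and pdiff_bvec [simp]: "pdiff (bvec p) = path_diff p"
  by (simp_all add: pdiff_def)

text \<open>The contribution of position k of w to the derivative of the path u w v. With the
  context u, v included, the Leibniz rule is a splitting of the range of positions.\<close>

abbreviation diff_at :: "nat set \<Rightarrow> label list \<Rightarrow> label list \<Rightarrow> label list \<Rightarrow> nat \<Rightarrow> path \<Rightarrow>\<^sub>0 bit"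
  where "diff_at x u w v k \<equiv> (case w ! k of CC i \<Rightarrow> bvec (x, u @ w[k := UU i] @ v) | _ \<Rightarrow> 0)"

lemma path_diff_simp: "path_diff (x, w) = (\<Sum>k<length w. diff_at x [] w [] k)"
  by (simp only: path_diff_def fst_conv snd_conv append_Nil append_Nil2)

lemma path_diff_append:
  "path_diff (x, u @ v) = (\<Sum>k<length u. diff_at x [] u v k) + (\<Sum>k<length v. diff_at x u v [] k)"
proof -
  let ?f = "\<lambda>k. case (u @ v) ! k of CC i \<Rightarrow> bvec (x, (u @ v)[k := UU i]) | _ \<Rightarrow> (0 :: path \<Rightarrow>\<^sub>0 bit)"
  have "path_diff (x, u @ v) = sum ?f {0..<length u + length v}"
    by (simp only: path_diff_simp lessThan_atLeast0 length_append append_Nil append_Nil2)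
  also have "\<dots> = sum ?f {0..<length u} + sum ?f {length u..<length u + length v}"
    by (simp add: sum.atLeastLessThan_concat)
  also have "sum ?f {length u..<length u + length v} = (\<Sum>k=0..<length v. ?f (k + length u))"
    using sum.shift_bounds_nat_ivl[of ?f 0 "length u" "length v"] by (simp add: add.commute)
  also have "\<dots> = (\<Sum>k<length v. diff_at x u v [] k)"
    by (intro sum.cong) (auto simp: nth_append list_update_append lessThan_atLeast0 split: label.split)
  also have "sum ?f {0..<length u} = (\<Sum>k<length u. diff_at x [] u v k)"
    by (intro sum.cong) (auto simp: nth_append list_update_append lessThan_atLeast0 split: label.split)
  finally show ?thesis .
qed

text \<open>Both letters label loops at every vertex, so the vertices along the path do not
  change.\<close>

lemma CC_replace:
  assumes "k < length w" "w ! k = CC i"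
  shows "target x (w[k := UU i]) = target x w"
    and "(x, w) \<in> paths s n \<Longrightarrow> (x, w[k := UU i]) \<in> paths s n"
proof -
  have w: "w = take k w @ CC i # drop (Suc k) w" and w': "w[k := UU i] = take k w @ UU i # drop (Suc k) w"
    using assms id_take_nth_drop[of k w] upd_conv_take_nth_drop[of k w] by simp_all
  show "target x (w[k := UU i]) = target x w"
    by (subst (2) w, subst w') simp
  show "(x, w) \<in> paths s n \<Longrightarrow> (x, w[k := UU i]) \<in> paths s n"
    unfolding w' by (subst (asm) w) (auto simp: mem_paths labels_def)
qed

lemma keys_path_diff: "p \<in> paths s n \<Longrightarrow> Poly_Mapping.keys (path_diff p) \<subseteq> paths s n"
  by (cases p; simp only: path_diff_simp; intro keys_sum_subset)
    (auto split: label.split simp: CC_replace)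

lemma pdiff_closed: "Poly_Mapping.keys f \<subseteq> paths s n \<Longrightarrow> Poly_Mapping.keys (pdiff f) \<subseteq> paths s n"
  unfolding pdiff_def using keys_path_diff by (intro keys_sum_subset) blast

lemma path_diff_mult:
  "pdiff (path_mult (x, u) (y, v)) = path_diff (x, u) \<star> bvec (y, v) + bvec (x, u) \<star> path_diff (y, v)"
proof -
  have "diff_at x [] u [] k \<star> bvec (y, v) = (if target x u = y then diff_at x [] u v k else 0)"
    if "k < length u" for k
    using that by (cases "u ! k") (simp_all add: path_mult_simp CC_replace)
  then have l: "path_diff (x, u) \<star> bvec (y, v) = (if target x u = y then \<Sum>k<length u. diff_at x [] u v k else 0)"
    unfolding path_diff_simp bilinear_ext_sum_left
    by (cases "target x u = y") (simp_all add: sum.neutral)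
  have "bvec (x, u) \<star> diff_at y [] v [] k = (if target x u = y then diff_at x u v [] k else 0)" for k
    by (cases "v ! k") (simp_all add: path_mult_simp)
  then have r: "bvec (x, u) \<star> path_diff (y, v) = (if target x u = y then \<Sum>k<length v. diff_at x u v [] k else 0)"
    unfolding path_diff_simp bilinear_ext_sum_right
    by (cases "target x u = y") (simp_all add: sum.neutral)
  show ?thesis
    unfolding l r by (simp add: path_mult_simp path_diff_append)
qed

lemma pdiff_mult:
  shows "pdiff (f \<star> g) = pdiff f \<star> g + f \<star> pdiff g"
  using subset_UNIV[of "Poly_Mapping.keys f"]
proof (induction f rule: bit_poly_induct)
  case (bvec p)
  show ?case using subset_UNIV[of "Poly_Mapping.keys g"]
  proof (induction g rule: bit_poly_induct)
    case (bvec q)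
    show ?case by (cases p; cases q) (simp add: path_diff_mult)
  qed (simp_all add: pdiff_add bilinear_ext_add_right add_ac)
qed (simp_all add: pdiff_add bilinear_ext_add_left add_ac)

text \<open>The derivative of the commutation of C_k with b is the commutation of U_k with b, again
  a relation, and C_k C_k has derivative U_k C_k + C_k U_k. In a commutation of C_k with C_l both
  letters contribute such a term.\<close>

lemma pdiff_relations:
  assumes "f \<in> relations s n" shows "pdiff f \<in> rel_ideal s n"
proof -
  have comm: "bvec (x, [a, b]) + bvec (x, [b, a]) \<in> rel_ideal s n"
    if "(x, [a, b]) \<in> paths s n" "is_UU a \<or> is_UU b" for x a b
  proof (rule relations_rel_ideal)
    have "(x, [b, a]) \<in> paths s n" "commuting a b"
      using that by (cases a; cases b; auto simp: mem_paths labels_def commuting_def)+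
    then show "bvec (x, [a, b]) + bvec (x, [b, a]) \<in> relations s n"
      using that unfolding relations_def by blast
  qed
  have two: "path_diff (x, [a, b]) = (case a of CC i \<Rightarrow> bvec (x, [UU i, b]) | _ \<Rightarrow> 0) +
      (case b of CC i \<Rightarrow> bvec (x, [a, UU i]) | _ \<Rightarrow> 0)" for x a b
    by (simp add: path_diff_simp add_ac lessThan_Suc split: label.split)
  have one: "path_diff (x, [UU i]) = 0" for x i
    by (simp add: path_diff_simp)
  have swap: "pdiff (bvec (x, [a, b]) + bvec (x, [b, a])) \<in> rel_ideal s n"
    if p: "(x, [a, b]) \<in> paths s n" "(x, [b, a]) \<in> paths s n" for x a b
  proof -
    have U: "bvec (x, [UU i, b]) + bvec (x, [b, UU i]) \<in> rel_ideal s n"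
      if "(x, [CC i, b]) \<in> paths s n" for i b
    proof (rule comm)
      show "(x, [UU i, b]) \<in> paths s n"
        using that by (simp add: mem_paths labels_def)
    qed simp
    have A: "(case a of CC i \<Rightarrow> bvec (x, [UU i, b]) + bvec (x, [b, UU i]) | _ \<Rightarrow> 0) \<in> rel_ideal s n"
      using p U by (cases a) (simp_all add: rel_ideal_zero)
    have B: "(case b of CC i \<Rightarrow> bvec (x, [UU i, a]) + bvec (x, [a, UU i]) | _ \<Rightarrow> 0) \<in> rel_ideal s n"
      using p U by (cases b) (simp_all add: rel_ideal_zero)
    have "pdiff (bvec (x, [a, b]) + bvec (x, [b, a])) =
        (case a of CC i \<Rightarrow> bvec (x, [UU i, b]) + bvec (x, [b, UU i]) | _ \<Rightarrow> 0) +
        (case b of CC i \<Rightarrow> bvec (x, [UU i, a]) + bvec (x, [a, UU i]) | _ \<Rightarrow> 0)"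
      by (simp add: pdiff_add two add_ac split: label.split)
    then show ?thesis using rel_ideal_add[OF A B] by simp
  qed
  have CC: "pdiff (bvec (x, [CC i, CC i])) \<in> rel_ideal s n" if "(x, [CC i, CC i]) \<in> paths s n" for x i
    using comm[of x "UU i" "CC i"] that by (auto simp: two mem_paths labels_def add_ac)
  show ?thesis
    using assms unfolding relations_def
  \<comment> \<open>Goals 1 and 7 are the commutations and the squares of C, the families in which a
    letter C may occur. The derivation is zero on every other family.\<close>
  proof (elim UnE CollectE exE conjE, goal_cases)
    case (1 x a b)
    then show ?case using swap by blast
  next
    case (7 x i)
    then show ?case using CC by blast
  qed (simp_all add: pdiff_add two one rel_ideal_zero)
qed

text \<open>By the Leibniz rule, the elements of the ideal whose derivative stays in it form an
  ideal; it contains the relations, hence everything.\<close>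

lemma pdiff_rel_ideal: "f \<in> rel_ideal s n \<Longrightarrow> pdiff f \<in> rel_ideal s n"
proof -
  let ?J = "{f \<in> rel_ideal s n. pdiff f \<in> rel_ideal s n}"
  have "ideal ?J (path_algebra s n)"
  proof (rule idealI)
    show "ring (path_algebra s n)" by (rule PA.ring_axioms)
    show "subgroup ?J (add_monoid (path_algebra s n))"
      using PA.bit_space_axioms rel_ideal_carrier
      by (intro subgroup_bit_spaceI subsetI) (simp_all add: rel_ideal_add rel_ideal_zero pdiff_add)
  qed (auto simp: pdiff_mult rel_ideal_mult rel_ideal_add pdiff_closed)
  from rel_ideal_least[OF this] show "f \<in> rel_ideal s n \<Longrightarrow> pdiff f \<in> rel_ideal s n"
    using pdiff_relations relations_rel_ideal by blast
qed

subsection \<open>The quotient\<close>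

lemma quiver_dga_simps [simp]:
  "carrier (quiver_dga s n) = carrier (quiver_ring s n)"
  "mult (quiver_dga s n) = mult (quiver_ring s n)"
  "one (quiver_dga s n) = one (quiver_ring s n)"
  "zero (quiver_dga s n) = zero (quiver_ring s n)"
  "add (quiver_dga s n) = add (quiver_ring s n)"
  by (simp_all add: quiver_dga_def ring.defs)

lemma diff_quiver_dga:
  "diff (quiver_dga s n) = induced (quiver_ring s n) (\<lambda>p. quiver_class s n (path_diff p))"
  by (simp add: quiver_dga_def ring.defs dga.defs)

lemma homog_quiver_dga: "homog (quiver_dga s n) d = gspan (quiver_ring s n)
    {quiver_class s n (bvec p) | p. p \<in> paths s n \<and> path_degree s p = d}"
  by (simp add: quiver_dga_def ring.defs dga.defs)

interpretation QR: bit_ring "quiver_ring s n" for s n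
  unfolding quiver_ring_def by (rule PA.quot_bit_ring[OF rel_ideal_ideal])

abbreviation "path_space s n \<equiv> {f. Poly_Mapping.keys f \<subseteq> paths s n}"

lemma class_closed [intro, simp]: "f \<in> path_space s n \<Longrightarrow> quiver_class s n f \<in> carrier (quiver_ring s n)"
  unfolding quiver_class_def quiver_ring_def by (rule PA.quot_closed[OF rel_ideal_subgroup]) simp

lemma class_add: "f \<in> path_space s n \<Longrightarrow> g \<in> path_space s n \<Longrightarrow>
    quiver_class s n (f + g) = quiver_class s n f \<oplus>\<^bsub>quiver_ring s n\<^esub> quiver_class s n g"
  using PA.quot_add[OF rel_ideal_subgroup, of f s n g] by (simp add: quiver_class_def quiver_ring_def)

lemma class_mult: "f \<in> path_space s n \<Longrightarrow> g \<in> path_space s n \<Longrightarrow>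
    quiver_class s n f \<otimes>\<^bsub>quiver_ring s n\<^esub> quiver_class s n g = quiver_class s n (f \<star> g)"
  using PA.quot_mult[OF rel_ideal_ideal, of f s n g] by (simp add: quiver_class_def quiver_ring_def)

lemma class_eq_zero_iff: "f \<in> path_space s n \<Longrightarrow>
    quiver_class s n f = \<zero>\<^bsub>quiver_ring s n\<^esub> \<longleftrightarrow> f \<in> rel_ideal s n"
  using PA.quot_eq_zero_iff[OF rel_ideal_subgroup, of f s n] by (simp add: quiver_class_def quiver_ring_def)

lemma class_zero [simp]: "quiver_class s n 0 = \<zero>\<^bsub>quiver_ring s n\<^esub>"
  by (simp add: class_eq_zero_iff rel_ideal_zero)

lemma class_eq_iff: "f \<in> path_space s n \<Longrightarrow> g \<in> path_space s n \<Longrightarrow>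
    quiver_class s n f = quiver_class s n g \<longleftrightarrow> f + g \<in> rel_ideal s n"
  using QR.add_eq_zero_iff[of "quiver_class s n f" s n "quiver_class s n g"]
  by (simp add: keys_add_subset flip: class_eq_zero_iff class_add)

lemma class_one: "\<one>\<^bsub>quiver_ring s n\<^esub> = quiver_class s n (\<Sum>x\<in>Pow {0..n}. bvec (x, []))"
  by (simp add: quiver_ring_def FactRing_def quiver_class_def)

lemma class_cases:
  assumes "X \<in> carrier (quiver_ring s n)"
  obtains f where "f \<in> path_space s n" "X = quiver_class s n f"
  using assms PA.quot_carrier_iff[OF rel_ideal_subgroup]
  by (auto simp: quiver_ring_def quiver_class_def)

lemma diff_class:
  assumes "f \<in> path_space s n"
  shows "diff (quiver_dga s n) (quiver_class s n f) = quiver_class s n (pdiff f)"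
proof -
  let ?\<phi> = "\<lambda>p. quiver_class s n (path_diff p)"
  have \<phi>: "?\<phi> \<in> paths s n \<rightarrow> carrier (quiver_ring s n)"
    using keys_path_diff by auto
  have lin: "linear_ext (quiver_ring s n) ?\<phi> f = quiver_class s n (pdiff f)"
    if "Poly_Mapping.keys f \<subseteq> paths s n" for f
    using that \<phi>
    by (intro QR.linear_ext_unique[symmetric]) (auto simp: pdiff_add class_add pdiff_closed)
  have "induced (quiver_ring s n) ?\<phi> (rel_ideal s n +>\<^bsub>path_algebra s n\<^esub> f) = linear_ext (quiver_ring s n) ?\<phi> f"
  proof (rule induced_coset[OF path_algebra_free rel_ideal_subgroup QR.bit_space_axioms \<phi>])
    show "linear_ext (quiver_ring s n) ?\<phi> h = \<zero>\<^bsub>quiver_ring s n\<^esub>" if "h \<in> rel_ideal s n" for h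
      using that rel_ideal_carrier[OF that] pdiff_rel_ideal[OF that]
      by (simp add: lin class_eq_zero_iff pdiff_closed)
  qed (use assms in simp)
  then show ?thesis
    using assms by (simp add: diff_quiver_dga lin) (simp add: quiver_class_def)
qed

lemma quiver_dg_space: "dg_space (quiver_dga s n)"
proof -
  interpret bit_ring "quiver_dga s n"
    by (rule bit_ring_cong[OF QR.bit_ring_axioms]) simp_all
  show ?thesis
  proof unfold_locales
    show "diff (quiver_dga s n) a \<in> carrier (quiver_dga s n)" if "a \<in> carrier (quiver_dga s n)" for a
      using that by (auto elim!: class_cases simp: diff_class pdiff_closed)
    show "diff (quiver_dga s n) (a \<oplus>\<^bsub>quiver_dga s n\<^esub> b) =
        diff (quiver_dga s n) a \<oplus>\<^bsub>quiver_dga s n\<^esub> diff (quiver_dga s n) b"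
      if "a \<in> carrier (quiver_dga s n)" "b \<in> carrier (quiver_dga s n)" for a b
      using that by (auto elim!: class_cases simp: diff_class pdiff_closed keys_add_subset pdiff_add simp flip: class_add)
  qed
qed

section \<open>The algebra \<open>\<B>(n) \<otimes> \<B>\<^sup>!(n)\<close>\<close>

interpretation DG: dg_pair "Balg n" "Bshriek n" for n
  by (intro dg_pair.intro quiver_dg_space)

interpretation BB: dg_space "BB n" for n
  unfolding BB_def by (rule DG.tensor_dga_dg_space)

lemma BB_simps:
  "carrier (BB n) = carrier (tensor_ring (Balg n) (Bshriek n))"
  "mult (BB n) = mult (tensor_ring (Balg n) (Bshriek n))"
  "one (BB n) = one (tensor_ring (Balg n) (Bshriek n))"
  "zero (BB n) = zero (tensor_ring (Balg n) (Bshriek n))"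
  "add (BB n) = add (tensor_ring (Balg n) (Bshriek n))"
  by (simp_all add: BB_def)

lemma bb_closed [intro, simp]:
  "f \<in> path_space False n \<Longrightarrow> g \<in> path_space True n \<Longrightarrow> bb_tensor n f g \<in> carrier (BB n)"
  unfolding bb_tensor_def BB_simps by (intro DG.tens_closed) simp_all

lemma bb_mult:
  assumes "f \<in> path_space False n" "g \<in> path_space True n" "f' \<in> path_space False n" "g' \<in> path_space True n"
  shows "bb_tensor n f g \<otimes>\<^bsub>BB n\<^esub> bb_tensor n f' g' = bb_tensor n (f \<star> f') (g \<star> g')"
  unfolding bb_tensor_def BB_simps using assms by (simp add: DG.tens_mult class_mult)

lemma bb_add_left:
  assumes "f \<in> path_space False n" "f' \<in> path_space False n" "g \<in> path_space True n"
  shows "bb_tensor n (f + f') g = bb_tensor n f g \<oplus>\<^bsub>BB n\<^esub> bb_tensor n f' g"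
  unfolding bb_tensor_def BB_simps using assms DG.tens_add_left[of "quiver_class False n f" n]
  by (simp add: class_add)

lemma bb_add_right:
  assumes "f \<in> path_space False n" "g \<in> path_space True n" "g' \<in> path_space True n"
  shows "bb_tensor n f (g + g') = bb_tensor n f g \<oplus>\<^bsub>BB n\<^esub> bb_tensor n f g'"
  unfolding bb_tensor_def BB_simps
  using assms DG.tens_add_right[of "quiver_class False n f" n "quiver_class True n g"]
  by (simp add: class_add)

lemma bb_zero [simp]:
  "g \<in> path_space True n \<Longrightarrow> bb_tensor n 0 g = \<zero>\<^bsub>BB n\<^esub>"
  "f \<in> path_space False n \<Longrightarrow> bb_tensor n f 0 = \<zero>\<^bsub>BB n\<^esub>"
  using bb_add_left[of 0 n 0 g] bb_add_right[of f n 0 0] by simp_all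

lemma BB_induct [consumes 1, case_names tensor add]:
  assumes "X \<in> carrier (BB n)"
    and "\<And>f g. f \<in> path_space False n \<Longrightarrow> g \<in> path_space True n \<Longrightarrow> Q (bb_tensor n f g)"
    and "\<And>X Y. X \<in> carrier (BB n) \<Longrightarrow> Y \<in> carrier (BB n) \<Longrightarrow> Q X \<Longrightarrow> Q Y \<Longrightarrow> Q (X \<oplus>\<^bsub>BB n\<^esub> Y)"
  shows "Q X"
  using assms(1) unfolding BB_simps
proof (induction rule: DG.tensor_induct)
  case (tens a b)
  then show ?case
    using assms(2) by (auto elim!: class_cases simp: bb_tensor_def)
next
  case (add X Y)
  then show ?case using assms(3) by (simp add: BB_simps)
qed

lemma pdiff_False:
  assumes "f \<in> path_space False n" shows "pdiff f = 0"
proof -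
  have "Poly_Mapping.keys f \<subseteq> paths False n" using assms by simp
  then show ?thesis
  proof (induction f rule: bit_poly_induct)
    case (bvec p)
    obtain x w where p: "p = (x, w)" by (cases p)
    have "diff_at x [] w [] k = 0" if "k < length w" for k
      using bvec nth_mem[OF that] by (cases "w ! k") (auto simp: p mem_paths labels_def)
    then show ?case by (simp add: p path_diff_simp sum.neutral)
  qed (simp_all add: pdiff_add)
qed

lemma bb_diff:
  assumes f: "f \<in> path_space False n" and g: "g \<in> path_space True n"
  shows "diff (BB n) (bb_tensor n f g) = bb_tensor n f (pdiff g)"
proof -
  have "diff (BB n) (bb_tensor n f g) = bb_tensor n (pdiff f) g \<oplus>\<^bsub>BB n\<^esub> bb_tensor n f (pdiff g)"
    unfolding bb_tensor_def BB_def using assms by (simp add: DG.diff_tens diff_class)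
  then show ?thesis
    using assms pdiff_closed[of g True n] by (simp add: pdiff_False[OF f])
qed

subsection \<open>Idempotents\<close>

lemma nil_path [simp]: "(x, []) \<in> paths s n \<longleftrightarrow> x \<subseteq> {0..n}"
  by (simp add: mem_paths)

lemma idem_closed [simp]: "x \<subseteq> {0..n} \<Longrightarrow> y \<subseteq> {0..n} \<Longrightarrow> bb_idem n x y \<in> carrier (BB n)"
  by (simp add: bb_idem_def)

lemma pmul_closed [simp]:
  "f \<in> path_space s n \<Longrightarrow> g \<in> path_space s n \<Longrightarrow> Poly_Mapping.keys (f \<star> g) \<subseteq> paths s n"
  by (rule keys_bilinear_ext[OF keys_path_mult]) auto

lemma idem_mult:
  assumes "x \<subseteq> {0..n}" "y \<subseteq> {0..n}" "x' \<subseteq> {0..n}" "y' \<subseteq> {0..n}"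
  shows "bb_idem n x y \<otimes>\<^bsub>BB n\<^esub> bb_idem n x' y' = (if x = x' \<and> y = y' then bb_idem n x y else \<zero>\<^bsub>BB n\<^esub>)"
  using assms by (auto simp: bb_idem_def bb_mult path_mult_simp)

abbreviation idems :: "nat \<Rightarrow> bb_elem set"
  where "idems n \<equiv> {bb_idem n x y | x y. x \<subseteq> {0..n} \<and> y \<subseteq> {0..n}}"

lemma idem_ring_simps [simp]:
  "carrier (idem_ring n) = gspan (BB n) (idems n)" "mult (idem_ring n) = mult (BB n)"
  "one (idem_ring n) = one (BB n)" "zero (idem_ring n) = zero (BB n)" "add (idem_ring n) = add (BB n)"
  by (simp_all add: idem_ring_def)

lemma idems_subset: "idems n \<subseteq> carrier (BB n)"
  by auto

lemma idem_in_span: "x \<subseteq> {0..n} \<Longrightarrow> y \<subseteq> {0..n} \<Longrightarrow> bb_idem n x y \<in> gspan (BB n) (idems n)"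
  by (rule BB.gspan_incl) blast

lemma idem_ring_closed: "k \<in> gspan (BB n) (idems n) \<Longrightarrow> k \<in> carrier (BB n)"
  by (rule BB.gspan_closed[OF _ idems_subset])

lemma idem_ring_mult_closed:
  assumes "k \<in> gspan (BB n) (idems n)" "l \<in> gspan (BB n) (idems n)"
  shows "k \<otimes>\<^bsub>BB n\<^esub> l \<in> gspan (BB n) (idems n)"
  using assms(1) idems_subset
proof (induction rule: BB.gspan_induct)
  case (incl e)
  show ?case using assms(2) idems_subset
  proof (induction rule: BB.gspan_induct)
    case (incl e')
    then show ?case
      using \<open>e \<in> idems n\<close> by (elim CollectE exE conjE) (simp add: idem_mult idem_in_span)
  next
    case (add x y)
    then show ?case
      using \<open>e \<in> idems n\<close> idems_subset idem_ring_closed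
      by (auto simp: BB.r_distr intro!: BB.gspan_add)
  qed (use incl in auto)
next
  case (add x y)
  then show ?case
    using assms(2) idem_ring_closed by (auto simp: BB.l_distr intro!: BB.gspan_add)
qed (use assms(2) idem_ring_closed in auto)

lemma idem_ring_comm:
  assumes "k \<in> gspan (BB n) (idems n)" "l \<in> gspan (BB n) (idems n)"
  shows "k \<otimes>\<^bsub>BB n\<^esub> l = l \<otimes>\<^bsub>BB n\<^esub> k"
  using assms(1) idems_subset
proof (induction rule: BB.gspan_induct)
  case (incl e)
  show ?case using assms(2) idems_subset
  proof (induction rule: BB.gspan_induct)
    case (incl e')
    then obtain x y x' y' where "e = bb_idem n x y" "e' = bb_idem n x' y'"
      "x \<subseteq> {0..n}" "y \<subseteq> {0..n}" "x' \<subseteq> {0..n}" "y' \<subseteq> {0..n}"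
      using \<open>e \<in> idems n\<close> by blast
    then show ?case
      by (cases "x = x' \<and> y = y'") (simp_all add: idem_mult)
  next
    case (add x y)
    then show ?case
      using \<open>e \<in> idems n\<close> idem_ring_closed by (auto simp: BB.r_distr BB.l_distr)
  qed (use incl in auto)
next
  case (add x y)
  then show ?case
    using assms(2) idem_ring_closed by (auto simp: BB.l_distr BB.r_distr)
qed (use assms(2) idem_ring_closed in auto)

lemma sum_nil_closed: "X \<subseteq> Pow {0..n} \<Longrightarrow> Poly_Mapping.keys (\<Sum>x\<in>X. bvec (x, [] :: label list) :: path \<Rightarrow>\<^sub>0 bit) \<subseteq> paths s n"
  by (rule keys_sum_subset) auto

text \<open>The unit is the tensor product of two sums of trivial paths. Expanding it takes one
  induction for each factor.\<close>

lemma idem_ring_one: "\<one>\<^bsub>BB n\<^esub> \<in> gspan (BB n) (idems n)"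
proof -
  have mem: "bb_tensor n (\<Sum>x\<in>X. bvec (x, [])) (\<Sum>y\<in>Y. bvec (y, [])) \<in> gspan (BB n) (idems n)"
    if X: "finite X" "X \<subseteq> Pow {0..n}" and Y: "finite Y" "Y \<subseteq> Pow {0..n}" for X Y
    using X
  proof (induction X rule: finite_induct)
    case empty
    show ?case using sum_nil_closed[OF Y(2)] by simp
  next
    case (insert x X)
    have sX: "(\<Sum>x\<in>X. bvec (x, [])) \<in> path_space False n"
      using insert(4) sum_nil_closed[of X n False] by simp
    have sY: "(\<Sum>y\<in>Z. bvec (y, [])) \<in> path_space True n" if "Z \<subseteq> Y" for Z
      using Y that sum_nil_closed[of Z n True] by simp
    have "bb_tensor n (bvec (x, [])) (\<Sum>y\<in>Z. bvec (y, [])) \<in> gspan (BB n) (idems n)"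
      if "finite Z" "Z \<subseteq> Y" for Z
      using that
    proof (induction Z rule: finite_induct)
      case empty
      show ?case using insert(4) by simp
    next
      case (insert y Z)
      have "bb_idem n x y \<in> gspan (BB n) (idems n)"
        using insert \<open>insert x X \<subseteq> Pow {0..n}\<close> Y by (intro idem_in_span) auto
      moreover have "bb_tensor n (bvec (x, [])) (\<Sum>y\<in>insert y Z. bvec (y, [])) =
          bb_idem n x y \<oplus>\<^bsub>BB n\<^esub> bb_tensor n (bvec (x, [])) (\<Sum>y\<in>Z. bvec (y, []))"
        using insert \<open>insert x X \<subseteq> Pow {0..n}\<close> subsetD[OF Y(2), of y] sY[of Z]
        by (simp add: bb_idem_def bb_add_right)
      ultimately show ?case
        using insert by (simp add: BB.gspan_add)
    qed
    moreover have "bb_tensor n (\<Sum>x\<in>insert x X. bvec (x, [])) (\<Sum>y\<in>Y. bvec (y, [])) =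
        bb_tensor n (bvec (x, [])) (\<Sum>y\<in>Y. bvec (y, [])) \<oplus>\<^bsub>BB n\<^esub>
        bb_tensor n (\<Sum>x\<in>X. bvec (x, [])) (\<Sum>y\<in>Y. bvec (y, []))"
      using insert sX sY[of Y] by (simp add: bb_add_left)
    ultimately show ?case
      using insert Y by (simp add: BB.gspan_add)
  qed
  have "\<one>\<^bsub>BB n\<^esub> = bb_tensor n (\<Sum>x\<in>Pow {0..n}. bvec (x, [])) (\<Sum>x\<in>Pow {0..n}. bvec (x, []))"
    unfolding BB_simps DG.tens_one by (simp add: class_one bb_tensor_def)
  then show ?thesis using mem by simp
qed

text \<open>The predicate \<open>module\<close> asks for a commutative base ring. Commutativity
  comes from the orthogonality of the spanning idempotents.\<close>

lemma idem_ring_cring: "cring (idem_ring n)"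
proof -
  have ab: "abelian_group (idem_ring n)"
  proof (rule abelian_groupI)
    fix x assume "x \<in> carrier (idem_ring n)"
    then show "\<exists>y\<in>carrier (idem_ring n). y \<oplus>\<^bsub>idem_ring n\<^esub> x = \<zero>\<^bsub>idem_ring n\<^esub>"
      using idem_ring_closed by (intro bexI[of _ x]) auto
  qed (use idem_ring_closed in \<open>auto simp: BB.gspan_add BB.a_ac\<close>)
  have "Group.monoid (idem_ring n)"
    by (rule monoidI) (use idem_ring_closed in \<open>auto simp: idem_ring_mult_closed idem_ring_one BB.m_assoc\<close>)
  then have "comm_monoid (idem_ring n)"
    by (rule Group.monoid.monoid_comm_monoidI) (simp add: idem_ring_comm)
  then show ?thesis
    using idem_ring_closed ab by (intro cringI) (auto simp: BB.l_distr)
qed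

text \<open>Non-vanishing of the idempotents is seen by the functionals that extract the coefficient of
  a trivial path; these vanish on the relations.\<close>

lemma rel_ideal_trivial_path:
  assumes "f \<in> rel_ideal s n" shows "Poly_Mapping.lookup f (x, []) = 0"
proof -
  \<comment> \<open>Combinations of nonempty paths form an ideal, and every relation is such a
    combination, so the ideal of relations lies inside it.\<close>
  let ?L = "{p \<in> paths s n. snd p \<noteq> []}"
  let ?J = "{f :: path \<Rightarrow>\<^sub>0 bit. Poly_Mapping.keys f \<subseteq> ?L}"
  have sub: "Poly_Mapping.keys (path_mult p q) \<subseteq> ?L"
    if "p \<in> paths s n" "q \<in> paths s n" "p \<in> ?L \<or> q \<in> ?L" for p q
    using that keys_path_mult[OF that(1,2)] by (auto simp: path_mult_def split: if_splits)
  have mult: "Poly_Mapping.keys (f \<star> g) \<subseteq> ?L"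
    if "Poly_Mapping.keys f \<subseteq> paths s n" "Poly_Mapping.keys g \<subseteq> paths s n"
      "Poly_Mapping.keys f \<subseteq> ?L \<or> Poly_Mapping.keys g \<subseteq> ?L" for f g
    unfolding bilinear_ext_def using that by (intro keys_sum_subset sub) blast+
  have "ideal ?J (path_algebra s n)"
  proof (rule idealI)
    show "ring (path_algebra s n)" by (rule PA.ring_axioms)
    show "subgroup ?J (add_monoid (path_algebra s n))"
      using PA.bit_space_axioms by (intro subgroup_bit_spaceI subsetI) (auto simp: keys_add_subset)
    fix f g assume fg: "f \<in> ?J" "g \<in> carrier (path_algebra s n)"
    then have f: "Poly_Mapping.keys f \<subseteq> paths s n" by blast
    show "g \<otimes>\<^bsub>path_algebra s n\<^esub> f \<in> ?J" "f \<otimes>\<^bsub>path_algebra s n\<^esub> g \<in> ?J"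
      using mult[of g f] mult[of f g] fg f by simp_all
  qed
  moreover have "relations s n \<subseteq> ?J"
  proof
    fix f assume f: "f \<in> relations s n"
    then have "Poly_Mapping.keys f \<subseteq> paths s n"
      using relations_subset by auto
    moreover have "snd p \<noteq> []" if "p \<in> Poly_Mapping.keys f" for p
      using f that unfolding relations_def
      by (auto dest!: keys_add[THEN subsetD])
    ultimately show "f \<in> ?J" by auto
  qed
  ultimately have "f \<in> ?J"
    using rel_ideal_least assms by blast
  then show ?thesis by (auto simp: in_keys_iff)
qed

text \<open>A representative of the coset may be chosen freely, since elements of the ideal have
  coefficient zero at every trivial path.\<close>

definition augmentation :: "nat set \<Rightarrow> (path \<Rightarrow>\<^sub>0 bit) set \<Rightarrow> bit"
  where "augmentation x X = Poly_Mapping.lookup (SOME f. f \<in> X) (x, [])"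

lemma augmentation_class:
  assumes "f \<in> path_space s n"
  shows "augmentation x (quiver_class s n f) = Poly_Mapping.lookup f (x, [])"
proof -
  have f: "f \<in> carrier (path_algebra s n)" using assms by simp
  define g where "g = (SOME g. g \<in> quiver_class s n f)"
  have "g \<in> quiver_class s n f"
    unfolding g_def quiver_class_def using PA.quot_self[OF rel_ideal_subgroup f] by (rule someI)
  then obtain h where "h \<in> rel_ideal s n" "g = h + f"
    using PA.quot_mem[OF rel_ideal_subgroup, of g s n f] by (auto simp: quiver_class_def)
  then show ?thesis
    unfolding augmentation_def by (simp add: lookup_add rel_ideal_trivial_path flip: g_def)
qed

lemma augmentation_add:
  assumes "X \<in> carrier (quiver_ring s n)" "Y \<in> carrier (quiver_ring s n)"
  shows "augmentation x (X \<oplus>\<^bsub>quiver_ring s n\<^esub> Y) = augmentation x X + augmentation x Y"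
  using assms
  by (auto elim!: class_cases simp: augmentation_class keys_add_subset lookup_add simp flip: class_add)

text \<open>The product of the two augmentations is biadditive, hence a functional on the tensor
  product, and it takes the value 1 on I_x \<otimes> I_y.\<close>

lemma idem_nonzero:
  assumes "x \<subseteq> {0..n}" "y \<subseteq> {0..n}" shows "bb_idem n x y \<noteq> \<zero>\<^bsub>BB n\<^esub>"
proof -
  \<comment> \<open>The ground field, written as the free space on one point so that
    \<open>tensor_map\<close> can have it as target.\<close>
  let ?N = "free_space UNIV :: (unit \<Rightarrow>\<^sub>0 bit) ring"
  let ?\<phi> = "\<lambda>a b. Poly_Mapping.single () (augmentation x a * augmentation y b)"
  have N: "bit_space ?N" by (rule free_on_bit_space[OF free_on_free_space])
  have 1: "?\<phi> a b \<in> carrier ?N" if "a \<in> carrier (Balg n)" "b \<in> carrier (Bshriek n)" for a b by simp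
  have 2: "?\<phi> (a \<oplus>\<^bsub>Balg n\<^esub> a') b = ?\<phi> a b \<oplus>\<^bsub>?N\<^esub> ?\<phi> a' b"
    if "a \<in> carrier (Balg n)" "a' \<in> carrier (Balg n)" "b \<in> carrier (Bshriek n)" for a a' b
    using that by (simp add: augmentation_add distrib_right single_add)
  have 3: "?\<phi> a (b \<oplus>\<^bsub>Bshriek n\<^esub> b') = ?\<phi> a b \<oplus>\<^bsub>?N\<^esub> ?\<phi> a b'"
    if "a \<in> carrier (Balg n)" "b \<in> carrier (Bshriek n)" "b' \<in> carrier (Bshriek n)" for a b b'
    using that by (simp add: augmentation_add distrib_left single_add)
  note map = DG.tensor_map[OF N 1 2 3]
  let ?F = "induced ?N (\<lambda>(a, b). ?\<phi> a b)"
  have "?F (bb_idem n x y) = bvec ()"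
    unfolding bb_idem_def bb_tensor_def
    by (subst map(1)) (use assms in \<open>simp_all add: augmentation_class\<close>)
  moreover have "?F (\<zero>\<^bsub>BB n\<^esub>) = 0"
    using map(3)[of "\<zero>\<^bsub>BB n\<^esub>" "\<zero>\<^bsub>BB n\<^esub>"] by (simp add: BB_simps)
  moreover have "bvec () \<noteq> (0 :: unit \<Rightarrow>\<^sub>0 bit)"
    by (metis lookup_single_eq lookup_zero zero_neq_one)
  ultimately show ?thesis by metis
qed

lemma idem_ring_cases:
  assumes "k \<in> gspan (BB n) (idems n)" "x \<subseteq> {0..n}" "y \<subseteq> {0..n}"
  shows "k \<otimes>\<^bsub>BB n\<^esub> bb_idem n x y = bb_idem n x y \<or> k \<otimes>\<^bsub>BB n\<^esub> bb_idem n x y = \<zero>\<^bsub>BB n\<^esub>"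
  using assms(1) idems_subset
proof (induction rule: BB.gspan_induct)
  case zero
  then show ?case using assms by simp
next
  case (incl k)
  then obtain x' y' where "k = bb_idem n x' y'" "x' \<subseteq> {0..n}" "y' \<subseteq> {0..n}" by blast
  then show ?case using assms by (cases "x' = x \<and> y' = y") (simp_all add: idem_mult)
next
  case (add k l)
  have "k \<in> carrier (BB n)" "l \<in> carrier (BB n)" using add idem_ring_closed by auto
  then show ?case using add(3,4) assms by (elim disjE) (simp_all add: BB.l_distr)
qed

text \<open>Trivial paths have derivative zero, so the Leibniz rule leaves one term. This supplies
  \<open>diff_K\<close> for the structure at hand.\<close>

lemma diff_idem_ring:
  assumes "X \<in> carrier (BB n)" "k \<in> gspan (BB n) (idems n)"
  shows "diff (BB n) (X \<otimes>\<^bsub>BB n\<^esub> k) = diff (BB n) X \<otimes>\<^bsub>BB n\<^esub> k"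
  using assms(2) idems_subset
proof (induction rule: BB.gspan_induct)
  case zero
  have "diff (BB n) \<zero>\<^bsub>BB n\<^esub> = \<zero>\<^bsub>BB n\<^esub>"
    using BB.diff_add[of "\<zero>\<^bsub>BB n\<^esub>" n "\<zero>\<^bsub>BB n\<^esub>"] by simp
  then show ?case using assms by simp
next
  case (incl k)
  then obtain x y where k: "k = bb_tensor n (bvec (x, [])) (bvec (y, []))" and xy: "x \<subseteq> {0..n}" "y \<subseteq> {0..n}"
    by (auto simp: bb_idem_def)
  show ?case using assms(1)
  proof (induction rule: BB_induct)
    case (tensor f g)
    have "path_diff (y, []) = 0" by (simp add: path_diff_simp)
    then show ?case
      using tensor xy by (simp add: k bb_mult bb_diff pdiff_mult pdiff_closed)
  next
    case (add X Y)
    then show ?case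
      using incl idems_subset by (auto simp: BB.l_distr BB.diff_add)
  qed
next
  case (add k l)
  then show ?case
    using assms(1) idem_ring_closed by (simp add: BB.r_distr BB.diff_add)
qed

section \<open>The global module\<close>

locale X_setting =
  fixes n i :: nat
  assumes n2: "2 \<le> n" and i1: "1 \<le> i" and i_le: "i \<le> n - 1"
begin

lemma gen_idem_subset: "gen_idem1 g \<subseteq> {0, 1, 2}" "gen_idem2 g \<subseteq> {0, 1, 2}"
  by (cases g; simp)+

lemma shift_subset: "a \<subseteq> {0, 1, 2} \<Longrightarrow> shift_set i a \<subseteq> {0..n}"
  using n2 i1 i_le by (auto simp: shift_set_def)

lemma S_ext_subset: "S_ext n i \<subseteq> {0..n}"
  by (auto simp: S_ext_def)

lemma idem1_subset: "m \<in> X_basis n i \<Longrightarrow> idem1 i m \<subseteq> {0..n}"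
  using S_ext_subset shift_subset[OF gen_idem_subset(1)] by (auto simp: X_basis_def idem1_def)

lemma idem2_subset: "m \<in> X_basis n i \<Longrightarrow> idem2 n i m \<subseteq> {0..n}"
  using S_ext_subset shift_subset[OF gen_idem_subset(2)] by (auto simp: X_basis_def idem2_def)

abbreviation idem :: "basis_elem \<Rightarrow> bb_elem"
  where "idem m \<equiv> bb_idem n (idem1 i m) (idem2 n i m)"

abbreviation "K \<equiv> idem_ring n"
abbreviation "M \<equiv> X_module n i"

lemma M_simps [simp]:
  "carrier M = {f. Poly_Mapping.keys f \<subseteq> X_basis n i}" "add M = (+)" "zero M = 0"
  by (simp_all add: X_module_def ring.defs)

lemma M_free: "free_on (X_basis n i) M"
  by (simp add: free_on_def)

lemma M_smult: "k \<odot>\<^bsub>M\<^esub> f = (\<Sum>m\<in>Poly_Mapping.keys f. if k \<otimes>\<^bsub>BB n\<^esub> idem m = idem m then bvec m else 0)"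
  by (simp add: X_module_def ring.defs module.defs)

lemma M_smult_bvec: "k \<odot>\<^bsub>M\<^esub> bvec m = (if k \<otimes>\<^bsub>BB n\<^esub> idem m = idem m then bvec m else 0)"
  by (simp add: M_smult)

lemma M_smult_add: "k \<odot>\<^bsub>M\<^esub> (f + g) = k \<odot>\<^bsub>M\<^esub> f + k \<odot>\<^bsub>M\<^esub> g"
  by (simp only: M_smult sum_keys_add)

lemma M_smult_zero [simp]: "k \<odot>\<^bsub>M\<^esub> 0 = 0"
  by (simp add: M_smult)

lemma M_smult_closed: "f \<in> carrier M \<Longrightarrow> k \<odot>\<^bsub>M\<^esub> f \<in> carrier M"
  unfolding M_smult M_simps mem_Collect_eq by (rule keys_sum_subset) auto

sublocale M: bit_space M by (rule free_on_bit_space[OF M_free])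

lemma idem_mem: "m \<in> X_basis n i \<Longrightarrow> idem m \<in> gspan (BB n) (idems n)"
  by (rule idem_in_span[OF idem1_subset idem2_subset])

lemma idem_carrier [simp]: "m \<in> X_basis n i \<Longrightarrow> idem m \<in> carrier (BB n)"
  by (rule idem_closed[OF idem1_subset idem2_subset])

lemma idem_ne: "m \<in> X_basis n i \<Longrightarrow> idem m \<noteq> \<zero>\<^bsub>BB n\<^esub>"
  by (rule idem_nonzero[OF idem1_subset idem2_subset])

lemma idem_action_cases:
  "k \<in> gspan (BB n) (idems n) \<Longrightarrow> m \<in> X_basis n i \<Longrightarrow>
    k \<otimes>\<^bsub>BB n\<^esub> idem m = idem m \<or> k \<otimes>\<^bsub>BB n\<^esub> idem m = \<zero>\<^bsub>BB n\<^esub>"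
  by (rule idem_ring_cases[OF _ idem1_subset idem2_subset])

lemma M_module: "module K M"
proof (rule moduleI)
  show "cring K" by (rule idem_ring_cring)
  show "abelian_group M" by (rule M.abelian_group_axioms)
  show "k \<odot>\<^bsub>M\<^esub> f \<in> carrier M" if "f \<in> carrier M" for k f
    using that by (rule M_smult_closed)
  show "k \<odot>\<^bsub>M\<^esub> (f \<oplus>\<^bsub>M\<^esub> g) = k \<odot>\<^bsub>M\<^esub> f \<oplus>\<^bsub>M\<^esub> k \<odot>\<^bsub>M\<^esub> g" for k f g
    by (simp add: M_smult_add)
  \<comment> \<open>Each of k and l sends \<open>idem m\<close> to itself or to 0. If both fix it,
    then k + l sends it to 0, and the two sides agree because 0 differs from
    \<open>idem m\<close>.\<close>
  have dist: "(k \<oplus>\<^bsub>K\<^esub> l) \<odot>\<^bsub>M\<^esub> bvec m = k \<odot>\<^bsub>M\<^esub> bvec m + l \<odot>\<^bsub>M\<^esub> bvec m"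
    if "k \<in> carrier K" "l \<in> carrier K" "m \<in> X_basis n i" for k l m
  proof -
    have "k \<in> carrier (BB n)" "l \<in> carrier (BB n)" using that idem_ring_closed by simp_all
    then show ?thesis
      using idem_action_cases[OF that(1)[unfolded idem_ring_simps] that(3)]
        idem_action_cases[OF that(2)[unfolded idem_ring_simps] that(3)]
        idem_ne[OF that(3)] idem_ne[OF that(3), symmetric] that(3)
      by (elim disjE) (simp_all add: M_smult_bvec BB.l_distr)
  qed
  show "(k \<oplus>\<^bsub>K\<^esub> l) \<odot>\<^bsub>M\<^esub> f = k \<odot>\<^bsub>M\<^esub> f \<oplus>\<^bsub>M\<^esub> l \<odot>\<^bsub>M\<^esub> f"
    if k: "k \<in> carrier K" "l \<in> carrier K" and f: "f \<in> carrier M" for k l f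
    using f unfolding M_simps mem_Collect_eq
    by (induction f rule: bit_poly_induct) (use dist[OF k] in \<open>simp_all add: M_smult_add add_ac\<close>)
  have assoc: "(k \<otimes>\<^bsub>K\<^esub> l) \<odot>\<^bsub>M\<^esub> bvec m = k \<odot>\<^bsub>M\<^esub> (l \<odot>\<^bsub>M\<^esub> bvec m)"
    if "k \<in> carrier K" "l \<in> carrier K" "m \<in> X_basis n i" for k l m
  proof -
    have "k \<in> carrier (BB n)" "l \<in> carrier (BB n)" using that idem_ring_closed by simp_all
    then show ?thesis
      using idem_action_cases[OF that(1)[unfolded idem_ring_simps] that(3)]
        idem_action_cases[OF that(2)[unfolded idem_ring_simps] that(3)]
        idem_ne[OF that(3)] idem_ne[OF that(3), symmetric] that(3)
      by (elim disjE) (simp_all add: M_smult_bvec BB.m_assoc)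
  qed
  show "(k \<otimes>\<^bsub>K\<^esub> l) \<odot>\<^bsub>M\<^esub> f = k \<odot>\<^bsub>M\<^esub> (l \<odot>\<^bsub>M\<^esub> f)"
    if k: "k \<in> carrier K" "l \<in> carrier K" and f: "f \<in> carrier M" for k l f
    using f unfolding M_simps mem_Collect_eq
    by (induction f rule: bit_poly_induct) (use assoc[OF k] in \<open>simp_all add: M_smult_add\<close>)
  show "\<one>\<^bsub>K\<^esub> \<odot>\<^bsub>M\<^esub> f = f" if f: "f \<in> carrier M" for f
    using f unfolding M_simps mem_Collect_eq
    by (induction f rule: bit_poly_induct) (simp_all add: M_smult_add M_smult_bvec)
qed

sublocale mod_pair K "BB n" M
  by unfold_locales (use idem_ring_closed M_smult_closed in auto)

subsection \<open>The grading\<close>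

abbreviation deg :: "basis_elem \<Rightarrow> bidegree"
  where "deg m \<equiv> kind_degree i (gen_kind (snd m))"

lemma deg_degrees: "deg m \<in> degrees n"
proof -
  have ks: "Poly_Mapping.keys (f + g) \<subseteq> Tau ` {1..n} \<union> Beta ` {1..n}"
    if "Poly_Mapping.keys f \<subseteq> Tau ` {1..n} \<union> Beta ` {1..n}"
      "Poly_Mapping.keys g \<subseteq> Tau ` {1..n} \<union> Beta ` {1..n}" for f g :: "alex_gen \<Rightarrow>\<^sub>0 int"
    using that by (rule keys_add_subset)
  show ?thesis
    using n2 i1 i_le
    by (cases "gen_kind (snd m)") (simp_all add: degrees_def ks[unfolded One_nat_def] image_iff)
qed

lemma M_graded: "graded_module (degrees n) K M (X_grading n i)"
  unfolding graded_module_def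
proof (intro conjI ballI)
  show "module K M" by (rule M_module)
  show "subgroup (X_grading n i d) (add_monoid M)" for d
    by (rule subgroup_bit_spaceI[OF M.bit_space_axioms]) (auto simp: X_grading_def keys_add_subset)
  show "k \<odot>\<^bsub>M\<^esub> f \<in> X_grading n i d" if "f \<in> X_grading n i d" for k f d
    using that unfolding M_smult X_grading_def mem_Collect_eq by (intro keys_sum_subset) auto
  fix f assume f: "f \<in> carrier M"
  define c where "c = (\<lambda>d. \<Sum>m\<in>{m \<in> Poly_Mapping.keys f. deg m = d}. bvec m :: basis_elem \<Rightarrow>\<^sub>0 bit)"
  have c_zero: "c d = 0" if "d \<notin> deg ` Poly_Mapping.keys f" for d
  proof -
    have "{m \<in> Poly_Mapping.keys f. deg m = d} = {}" using that by blast
    then show ?thesis by (simp only: c_def sum.empty)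
  qed
  have fin: "finite {d. c d \<noteq> 0}"
    by (rule finite_subset[of _ "deg ` Poly_Mapping.keys f"]) (use c_zero in blast, simp)
  have c_mem: "c d \<in> X_grading n i d" for d
    using f unfolding c_def X_grading_def mem_Collect_eq by (intro keys_sum_subset) auto
  have c_carr: "c d \<in> carrier M" for d
    using c_mem[of d] by (auto simp: X_grading_def)
  have f_sum: "f = (\<Oplus>\<^bsub>M\<^esub>d\<in>{d. c d \<noteq> \<zero>\<^bsub>M\<^esub>}. c d)"
  proof -
    have "f = (\<Sum>m\<in>Poly_Mapping.keys f. bvec m)" by (rule bit_poly_eq_sum)
    also have "\<dots> = (\<Sum>d\<in>deg ` Poly_Mapping.keys f. c d)"
      unfolding c_def by (rule sum.image_gen) simp
    also have "\<dots> = (\<Sum>d\<in>{d. c d \<noteq> 0}. c d)"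
      using c_zero by (intro sum.mono_neutral_right) (simp, blast, blast)
    finally show ?thesis
      using finsum_free_on[OF M_free, of c "{d. c d \<noteq> 0}"] c_carr by (simp add: Pi_iff)
  qed
  show "\<exists>!c. (\<forall>d\<in>degrees n. c d \<in> X_grading n i d) \<and> (\<forall>d. d \<notin> degrees n \<longrightarrow> c d = \<zero>\<^bsub>M\<^esub>) \<and>
       finite {d. c d \<noteq> \<zero>\<^bsub>M\<^esub>} \<and> f = (\<Oplus>\<^bsub>M\<^esub>d\<in>{d. c d \<noteq> \<zero>\<^bsub>M\<^esub>}. c d)"
  proof (rule ex1I[of _ c], intro conjI)
    show "\<forall>d. d \<notin> degrees n \<longrightarrow> c d = \<zero>\<^bsub>M\<^esub>"
    proof (intro allI impI)
      fix d assume "d \<notin> degrees n"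
      then have "d \<notin> deg ` Poly_Mapping.keys f" using deg_degrees by auto
      then show "c d = \<zero>\<^bsub>M\<^esub>" by (simp add: c_zero)
    qed
  next
    fix c' assume c': "(\<forall>d\<in>degrees n. c' d \<in> X_grading n i d) \<and> (\<forall>d. d \<notin> degrees n \<longrightarrow> c' d = \<zero>\<^bsub>M\<^esub>) \<and>
       finite {d. c' d \<noteq> \<zero>\<^bsub>M\<^esub>} \<and> f = (\<Oplus>\<^bsub>M\<^esub>d\<in>{d. c' d \<noteq> \<zero>\<^bsub>M\<^esub>}. c' d)"
    have mem: "c' d \<in> X_grading n i d" for d
    proof (cases "d \<in> degrees n")
      case False
      then have "c' d = \<zero>\<^bsub>M\<^esub>" using c' by blast
      then show ?thesis by (simp add: X_grading_def)
    qed (use c' in blast)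
    have "c' d \<in> carrier M" for d
      using mem[of d] unfolding X_grading_def M_simps by blast
    then have "finsum M c' {d. c' d \<noteq> 0} = (\<Sum>d\<in>{d. c' d \<noteq> 0}. c' d)"
      by (intro finsum_free_on[OF M_free]) blast
    then have f': "f = (\<Sum>d\<in>{d. c' d \<noteq> 0}. c' d)"
      using c' by simp
    have f'': "f = (\<Sum>d\<in>{d. c d \<noteq> 0}. c d)"
      using finsum_free_on[OF M_free, of c "{d. c d \<noteq> 0}"] c_carr f_sum
      unfolding M_simps(3) by (metis Pi_I)
    \<comment> \<open>Uniqueness of the decomposition: a homogeneous element involves only basis
      elements of its own degree, so the coefficient of m in f can come only from the component of
      degree \<open>deg m\<close>.\<close>
    have coeff: "Poly_Mapping.lookup (e d) m = (if deg m = d then Poly_Mapping.lookup f m else 0)"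
      if e: "\<And>d. e d \<in> X_grading n i d" "finite {d. e d \<noteq> 0}" "f = (\<Sum>d\<in>{d. e d \<noteq> 0}. e d)" for e d m
    proof -
      have z: "Poly_Mapping.lookup (e d) m = 0" if "deg m \<noteq> d" for d m
      proof -
        have "m \<notin> Poly_Mapping.keys (e d)"
          using e(1)[of d] that unfolding X_grading_def by blast
        then show ?thesis by (simp add: in_keys_iff)
      qed
      have "Poly_Mapping.lookup f m = (\<Sum>d\<in>{d. e d \<noteq> 0}. Poly_Mapping.lookup (e d) m)"
        by (subst e(3), rule lookup_sum)
      also have "\<dots> = (\<Sum>d\<in>{d. e d \<noteq> 0}. if d = deg m then Poly_Mapping.lookup (e (deg m)) m else 0)"
        by (intro sum.cong refl) (simp add: z)
      also have "\<dots> = Poly_Mapping.lookup (e (deg m)) m"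
      proof -
        have "deg m \<in> {d. e d \<noteq> 0}" if "Poly_Mapping.lookup (e (deg m)) m \<noteq> 0"
          using that by (metis lookup_zero mem_Collect_eq)
        then show ?thesis unfolding sum.delta[OF e(2)] by argo
      qed
      finally show ?thesis using z[of m d] by metis
    qed
    show "c' = c"
    proof
      have fin': "finite {d. c' d \<noteq> 0}" using c' unfolding M_simps by blast
      fix d show "c' d = c d"
        by (rule poly_mapping_eqI) (simp only: coeff[OF mem fin' f'] coeff[OF c_mem fin f''])
    qed
  next
    show "\<forall>d\<in>degrees n. c d \<in> X_grading n i d" using c_mem by blast
    show "finite {d. c d \<noteq> \<zero>\<^bsub>M\<^esub>}" unfolding M_simps by (rule fin)
    show "f = (\<Oplus>\<^bsub>M\<^esub>d\<in>{d. c d \<noteq> \<zero>\<^bsub>M\<^esub>}. c d)" by (rule f_sum)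
  qed
qed

end

section \<open>Words with coefficients in the module\<close>

lemma arrow_target_inj:
  "has_arrow x l \<Longrightarrow> has_arrow y l \<Longrightarrow> arrow_target x l = arrow_target y l \<Longrightarrow> x = y"
  by (cases l) (auto simp: set_eq_iff)

text \<open>Each label acts injectively on the vertices where its arrow starts, so a word and an end
  vertex determine the path. Hence at most one path of a given word survives multiplication by a
  trivial path on the right.\<close>

lemma target_inj:
  "composable x w \<Longrightarrow> composable y w \<Longrightarrow> target x w = target y w \<Longrightarrow> x = y"
proof (induction w arbitrary: x y)
  case (Cons l w)
  then have "arrow_target x l = arrow_target y l" by simp
  then show ?case using Cons.prems arrow_target_inj[of x l y] by simp
qed simp

lemma finite_word_paths [simp]: "finite (word_paths s n w)"
  by (rule finite_subset[of _ "Pow {0..n} \<times> {w}"]) (auto simp: word_paths_def paths_def)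

lemma word_paths_iff: "q \<in> word_paths s n w \<longleftrightarrow> q \<in> paths s n \<and> snd q = w"
  by (simp add: word_paths_def)

lemma finite_delta_loc [simp]: "finite (delta_loc g)"
  by (cases g) simp_all

type_synonym wterm = "label list \<times> label list \<times> basis_elem"

lemma pmul_sum_idem:
  assumes "finite A" "p \<in> A" "h p = (x, v)" "target x v = z"
    "\<And>q. q \<in> A \<Longrightarrow> path_end (h q) = z \<Longrightarrow> q = p"
  shows "(\<Sum>q\<in>A. bvec (h q)) \<star> bvec (z, []) = bvec (x, v)"
proof -
  have "bvec (h q) \<star> bvec (z, []) = (if p = q then bvec (x, v) else 0)" if "q \<in> A" for q
  proof (cases "path_end (h q) = z")
    case True
    then have "q = p" using assms(5) that by blast
    then show ?thesis using assms(3,4) by (simp add: path_mult_simp)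
  next
    case False
    then have "q \<noteq> p" using assms(3,4) by auto
    then show ?thesis using False by (cases "h q") (simp add: path_mult_simp)
  qed
  then have "(\<Sum>q\<in>A. bvec (h q)) \<star> bvec (z, []) = (\<Sum>q\<in>A. if p = q then bvec (x, v) else 0)"
    unfolding bilinear_ext_sum_left by (intro sum.cong refl) simp
  then show ?thesis
    using assms(1,2) by simp
qed

section \<open>Local paths inside the global quiver\<close>

lemma has_arrow_iff:
  assumes "1 \<le> j"
  shows "has_arrow x (RR j) \<longleftrightarrow> j - 1 \<in> x \<and> j \<notin> x" "has_arrow x (LL j) \<longleftrightarrow> j \<in> x \<and> j - 1 \<notin> x"
proof -
  have ne: "j - 1 \<noteq> j" using assms by simp
  have int: "x \<inter> {a, b} = {a} \<longleftrightarrow> a \<in> x \<and> b \<notin> x" "x \<inter> {a, b} = {b} \<longleftrightarrow> b \<in> x \<and> a \<notin> x"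
    if "a \<noteq> b" for a b :: nat
    using that by auto
  show "has_arrow x (RR j) \<longleftrightarrow> j - 1 \<in> x \<and> j \<notin> x" "has_arrow x (LL j) \<longleftrightarrow> j \<in> x \<and> j - 1 \<notin> x"
    using int[OF ne] by (simp_all only: has_arrow.simps)
qed

text \<open>The window from i - 1 to i + 1 carries the local vertices 0, 1, 2 and the external state
  lies outside it, so membership is decided separately inside and outside.\<close>

lemma mem_shift_union:
  assumes "1 \<le> i" "a \<subseteq> {0..2}" "xe \<inter> {i - 1..i + 1} = {}"
  shows "k \<in> shift_set i a \<union> xe \<longleftrightarrow> (if k \<in> {i - 1..i + 1} then k + 1 - i \<in> a else k \<in> xe)"
proof (cases "k \<in> {i - 1..i + 1}")
  case True
  have "k \<in> shift_set i a \<longleftrightarrow> k + 1 - i \<in> a"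
    unfolding shift_set_def image_iff using True assms(1)
    by (auto intro!: bexI[of _ "k + 1 - i"])
  then show ?thesis using True assms(3) by auto
next
  case False
  have "k \<notin> shift_set i a"
    unfolding shift_set_def using False assms(1,2) by force
  then show ?thesis using False by auto
qed

lemma shift_arrow:
  assumes "1 \<le> i" "z \<subseteq> {0..2}" "l \<in> labels s 2" "has_arrow z l" "xe \<inter> {i - 1..i + 1} = {}"
  shows "has_arrow (shift_set i z \<union> xe) (shift_label i l)"
    and "arrow_target (shift_set i z \<union> xe) (shift_label i l) = shift_set i (arrow_target z l) \<union> xe"
proof -
  note mem = mem_shift_union[OF assms(1) _ assms(5)]
  have l: "1 \<le> idx l" "idx l \<le> 2" using assms(3) by (auto simp: labels_def)
  then have idx: "idx l = 1 \<or> idx l = 2" by auto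
  have t: "arrow_target z l \<subseteq> {0..2}"
    by (rule arrow_target_subset[OF assms(2,3)])
  have at: "i - 1 \<in> shift_set i z \<union> xe \<longleftrightarrow> 0 \<in> z" "i \<in> shift_set i z \<union> xe \<longleftrightarrow> 1 \<in> z"
      "Suc i \<in> shift_set i z \<union> xe \<longleftrightarrow> 2 \<in> z"
    unfolding mem[OF assms(2)] using assms(1) by (auto simp: Suc_diff_Suc numeral_2_eq_2)
  show "has_arrow (shift_set i z \<union> xe) (shift_label i l)"
  proof -
    define S where "S = shift_set i z \<union> xe"
    note at = at[folded S_def]
    show ?thesis
      unfolding S_def[symmetric] using idx assms(1,4) at
      by (cases l) (auto simp: has_arrow_iff simp del: has_arrow.simps(1,2))
  qed
  show "arrow_target (shift_set i z \<union> xe) (shift_label i l) = shift_set i (arrow_target z l) \<union> xe"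
  proof (rule Set.set_eqI)
    fix k
    define S where "S = shift_set i z \<union> xe"
    note at = at[folded S_def]
    have i0: "i - 1 \<noteq> i" "Suc i - 1 = i" "i \<noteq> Suc i" "i - 1 \<noteq> Suc i" using assms(1) by simp_all
    have "k \<in> arrow_target S (shift_label i l) \<longleftrightarrow>
        (if k \<in> {i - 1..i + 1} then k + 1 - i \<in> arrow_target z l else k \<in> xe)"
    proof (cases "k \<in> {i - 1..i + 1}")
      case True
      then consider "k = i - 1" "k + 1 - i = 0" | "k = i" "k + 1 - i = 1" | "k = Suc i" "k + 1 - i = 2"
        using assms(1) by fastforce
      then have "k \<in> arrow_target S (shift_label i l) \<longleftrightarrow> k + 1 - i \<in> arrow_target z l"
      proof cases
        case 1
        show ?thesis
          unfolding 1(2) unfolding 1(1) using idx at i0 by (elim disjE; cases l) simp_all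
      next
        case 2
        show ?thesis
          unfolding 2(2) unfolding 2(1) using idx at i0 by (elim disjE; cases l) simp_all
      next
        case 3
        show ?thesis
          unfolding 3(2) unfolding 3(1) using idx at i0 by (elim disjE; cases l) simp_all
      qed
      then show ?thesis using True by simp
    next
      case False
      then have S: "k \<in> S \<longleftrightarrow> k \<in> xe" unfolding S_def mem[OF assms(2)] by argo
      have "k \<noteq> i - 1" "k \<noteq> i" "k \<noteq> Suc i" using False by auto
      then have "k \<in> arrow_target S (shift_label i l) \<longleftrightarrow> k \<in> xe"
        using idx S i0 by (elim disjE; cases l) simp_all
      then show ?thesis using False by argo
    qed
    then show "k \<in> arrow_target (shift_set i z \<union> xe) (shift_label i l) \<longleftrightarrow> k \<in> shift_set i (arrow_target z l) \<union> xe"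
      unfolding mem[OF t] S_def .
  qed
qed

lemma shift_labels: "l \<in> labels s 2 \<Longrightarrow> 1 \<le> i \<Longrightarrow> i + 1 \<le> n \<Longrightarrow> shift_label i l \<in> labels s n"
  by (cases l) (auto simp: labels_def)

lemma shift_word:
  assumes "1 \<le> i" "xe \<inter> {i - 1..i + 1} = {}"
  shows "z \<subseteq> {0..2} \<Longrightarrow> set w \<subseteq> labels s 2 \<Longrightarrow> composable z w \<Longrightarrow>
    composable (shift_set i z \<union> xe) (map (shift_label i) w) \<and>
    target (shift_set i z \<union> xe) (map (shift_label i) w) = shift_set i (target z w) \<union> xe"
proof (induction w arbitrary: z)
  case (Cons l w)
  have z: "arrow_target z l \<subseteq> {0..2}"
    using Cons.prems by (intro arrow_target_subset[of _ _ _ s]) auto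
  show ?case
    using Cons.IH[OF z] Cons.prems shift_arrow[OF assms(1) Cons.prems(1), of l s xe] assms(2) by simp
qed simp

text \<open>The table records only words and generators. Checking all 24 generators shows that every
  entry is spelled by a path between the idempotents of its generators, so no entry is lost to
  incompatible idempotents.\<close>

lemma delta_loc_valid:
  assumes "(v, w, g') \<in> delta_loc g"
  shows "(gen_idem1 g, v) \<in> paths False 2 \<and> target (gen_idem1 g) v = gen_idem1 g' \<and>
    (gen_idem2 g, w) \<in> paths True 2 \<and> target (gen_idem2 g) w = gen_idem2 g'"
  using assms by (cases g; simp; elim disjE conjE; simp add: mem_paths labels_def; auto)

context X_setting
begin

abbreviation xtens (infixl "\<boxtimes>" 75)
  where "a \<boxtimes> x \<equiv> mod_tensor (idem_ring n) (BB n) (X_module n i) a x"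

text \<open>Vertices are not stored in a triple: the two paths start at the idempotents of m and end
  at those of m'. This is why evaluation takes m as an additional argument.\<close>

definition valid :: "basis_elem \<Rightarrow> wterm set"
  where "valid m = {(v, w, m'). m' \<in> X_basis n i \<and>
    (idem1 i m, v) \<in> paths False n \<and> target (idem1 i m) v = idem1 i m' \<and>
    (idem2 n i m, w) \<in> paths True n \<and> target (idem2 n i m) w = idem2 n i m'}"

definition coeff :: "basis_elem \<Rightarrow> label list \<Rightarrow> label list \<Rightarrow> bb_elem"
  where "coeff m v w = bb_tensor n (bvec (idem1 i m, v)) (bvec (idem2 n i m, w))"

definition ev :: "basis_elem \<Rightarrow> wterm \<Rightarrow> xt_elem"
  where "ev m = (\<lambda>(v, w, m'). coeff m v w \<boxtimes> bvec m')"

lemma validI: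
  assumes "m' \<in> X_basis n i" "(idem1 i m, v) \<in> paths False n" "target (idem1 i m) v = idem1 i m'"
    "(idem2 n i m, w) \<in> paths True n" "target (idem2 n i m) w = idem2 n i m'"
  shows "(v, w, m') \<in> valid m"
  using assms by (simp add: valid_def)

lemma validD:
  assumes "(v, w, m') \<in> valid m"
  shows "m' \<in> X_basis n i" "(idem1 i m, v) \<in> paths False n" "target (idem1 i m) v = idem1 i m'"
    "(idem2 n i m, w) \<in> paths True n" "target (idem2 n i m) w = idem2 n i m'"
  using assms by (simp_all add: valid_def)

lemma coeff_closed: "(v, w, m') \<in> valid m \<Longrightarrow> coeff m v w \<in> carrier (BB n)"
  unfolding coeff_def using validD by (intro bb_closed) simp_all

lemma bvec_M [simp]: "m \<in> X_basis n i \<Longrightarrow> bvec m \<in> carrier M"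
  by simp

lemma ev_closed: "ev m \<in> valid m \<rightarrow> carrier T"
proof
  fix t assume t: "t \<in> valid m"
  obtain v w m' where "t = (v, w, m')" by (cases t) 
  then show "ev m t \<in> carrier T"
    using t coeff_closed[of v w m' m] validD(1)[of v w m' m] by (simp add: ev_def)
qed

lemma coeff_mult:
  assumes "(v, w, m') \<in> valid m" "(v', w', m'') \<in> valid m'"
  shows "coeff m v w \<otimes>\<^bsub>BB n\<^esub> coeff m' v' w' = coeff m (v @ v') (w @ w')"
  unfolding coeff_def using validD[OF assms(1)] validD[OF assms(2)]
  by (simp add: bb_mult path_mult_simp)

lemma valid_append:
  assumes "(v, w, m') \<in> valid m" "(v', w', m'') \<in> valid m'"
  shows "(v @ v', w @ w', m'') \<in> valid m"
  using validD[OF assms(1)] validD[OF assms(2)] by (intro validI) (simp_all add: paths_append)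

text \<open>Only the summands of the coefficient that end at the idempotents of \<open>m'\<close> survive in
  \<open>\<B> \<otimes> M\<close>.\<close>

lemma tens_sum_collapse:
  assumes v: "(v, w, m') \<in> valid m"
    and A: "finite A" "p \<in> A" "h p = (idem1 i m, v)"
      "\<And>q. q \<in> A \<Longrightarrow> path_end (h q) = idem1 i m' \<Longrightarrow> q = p" "\<And>q. q \<in> A \<Longrightarrow> h q \<in> paths False n"
    and A': "finite A'" "p' \<in> A'" "h' p' = (idem2 n i m, w)"
      "\<And>q. q \<in> A' \<Longrightarrow> path_end (h' q) = idem2 n i m' \<Longrightarrow> q = p'" "\<And>q. q \<in> A' \<Longrightarrow> h' q \<in> paths True n"
  shows "bb_tensor n (\<Sum>q\<in>A. bvec (h q)) (\<Sum>q\<in>A'. bvec (h' q)) \<boxtimes> bvec m' = ev m (v, w, m')"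
proof -
  note v = validD[OF v]
  let ?a = "bb_tensor n (\<Sum>q\<in>A. bvec (h q)) (\<Sum>q\<in>A'. bvec (h' q))"
  have c: "(\<Sum>q\<in>A. bvec (h q)) \<in> path_space False n" "(\<Sum>q\<in>A'. bvec (h' q)) \<in> path_space True n"
    using A(5) A'(5) unfolding mem_Collect_eq by (intro keys_sum_subset; simp)+
  have a: "?a \<in> carrier (BB n)" using c by (rule bb_closed)
  have "?a \<boxtimes> bvec m' = ?a \<boxtimes> (idem m' \<odot>\<^bsub>M\<^esub> bvec m')"
    using idem1_subset[OF v(1)] idem2_subset[OF v(1)] by (simp add: M_smult_bvec idem_mult)
  also have "\<dots> = (?a \<otimes>\<^bsub>BB n\<^esub> idem m') \<boxtimes> bvec m'"
    using a v(1) idem_mem by (intro tens_balance[symmetric]) simp_all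
  also have "?a \<otimes>\<^bsub>BB n\<^esub> idem m' = coeff m v w"
    unfolding bb_idem_def coeff_def using c idem1_subset[OF v(1)] idem2_subset[OF v(1)]
      pmul_sum_idem[of A p h, OF A(1-3) v(3) A(4)] pmul_sum_idem[of A' p' h', OF A'(1-3) v(5) A'(4)]
    by (simp add: bb_mult)
  finally show ?thesis by (simp add: ev_def)
qed

subsection \<open>The differential as a sum of words\<close>

lemma S_ext_disjoint: "xe \<subseteq> S_ext n i \<Longrightarrow> xe \<inter> {i - 1..i + 1} = {}"
  by (auto simp: S_ext_def)

lemma i1_le: "i + 1 \<le> n"
  using n2 i1 i_le by simp

lemma shift_inj:
  assumes "z \<subseteq> {0..2}" "z' \<subseteq> {0..2}" "xe \<inter> {i - 1..i + 1} = {}"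
    "shift_set i z \<union> xe = shift_set i z' \<union> xe"
  shows "z = z'"
proof -
  have "shift_set i a \<subseteq> {i - 1..i + 1}" if "a \<subseteq> {0..2}" for a
      using that i1 unfolding shift_set_def by force
  then have "shift_set i z = shift_set i z'"
    using assms by blast
  moreover have "inj (\<lambda>j. j + i - 1)"
    using i1 by (intro injI) simp
  ultimately show ?thesis
    unfolding shift_set_def by (simp add: inj_image_eq_iff)
qed

text \<open>The last claim is the uniqueness that \<open>tens_sum_collapse\<close> asks for:
  shifting is injective on local vertex sets, and a word with its end determines the path.\<close>

lemma iota_collapse:
  assumes "xe \<inter> {i - 1..i + 1} = {}" "xe \<subseteq> {0..n}" "(z, w) \<in> paths s 2"
  shows "(shift_set i z \<union> xe, map (shift_label i) w) \<in> paths s n"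
    and "target (shift_set i z \<union> xe) (map (shift_label i) w) = shift_set i (target z w) \<union> xe"
    and "q \<in> word_paths s 2 w \<Longrightarrow> iota_path i xe q \<in> paths s n"
    and "q \<in> word_paths s 2 w \<Longrightarrow> path_end (iota_path i xe q) = shift_set i (target z w) \<union> xe \<Longrightarrow> q = (z, w)"
proof -
  have *: "(shift_set i z \<union> xe, map (shift_label i) w) \<in> paths s n \<and>
      target (shift_set i z \<union> xe) (map (shift_label i) w) = shift_set i (target z w) \<union> xe"
    if "(z, w) \<in> paths s 2" for z
  proof -
    have "z \<subseteq> {0, 1, 2}" using that by (auto simp: mem_paths)
    then show ?thesis
      using that shift_word[OF i1 assms(1), of z w s] shift_subset[of z] assms(2) shift_labels[OF _ i1 i1_le]
      by (auto simp: mem_paths)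
  qed
  show "(shift_set i z \<union> xe, map (shift_label i) w) \<in> paths s n"
    and "target (shift_set i z \<union> xe) (map (shift_label i) w) = shift_set i (target z w) \<union> xe"
    using *[OF assms(3)] by simp_all
  assume "q \<in> word_paths s 2 w"
  then obtain y where q: "q = (y, w)" "(y, w) \<in> paths s 2"
    by (cases q) (auto simp: word_paths_def)
  show "iota_path i xe q \<in> paths s n"
    using *[OF q(2)] by (simp add: q iota_path_def)
  assume "path_end (iota_path i xe q) = shift_set i (target z w) \<union> xe"
  then have "shift_set i (target y w) \<union> xe = shift_set i (target z w) \<union> xe"
    using *[OF q(2)] by (simp add: q iota_path_def)
  moreover have "target x w \<subseteq> {0..2}" if "(x, w) \<in> paths s 2" for x
    using that target_subset[of x 2 w s] unfolding mem_paths by blast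
  ultimately have "target y w = target z w"
    using shift_inj[OF _ _ assms(1)] q(2) assms(3) by metis
  then show "q = (z, w)"
    using q assms(3) target_inj[of y w z] unfolding mem_paths by blast
qed

definition lift_term :: "basis_elem \<Rightarrow> label list \<times> label list \<times> xgen \<Rightarrow> wterm"
  where "lift_term m = (\<lambda>(v, w, g). (map (shift_label i) v, map (shift_label i) w, (fst m, g)))"

lemma local_term:
  assumes m: "m \<in> X_basis n i" and t: "(v, w, g') \<in> delta_loc (snd m)"
  shows "lift_term m (v, w, g') \<in> valid m"
    and "xt_tensor n i (iota_words n i (fst m) v w) (fst m, g') = ev m (lift_term m (v, w, g'))"
proof -
  obtain xe g where mg: "m = (xe, g)" by (cases m)
  have xe: "xe \<subseteq> S_ext n i" using m by (simp add: mg X_basis_def)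
  have xe': "xe \<inter> {i - 1..i + 1} = {}" "(S_ext n i - xe) \<inter> {i - 1..i + 1} = {}"
    "xe \<subseteq> {0..n}" "S_ext n i - xe \<subseteq> {0..n}"
    using S_ext_disjoint[of xe] S_ext_disjoint[of "S_ext n i - xe"] xe S_ext_subset by auto
  have tv: "(gen_idem1 g, v) \<in> paths False 2" "target (gen_idem1 g) v = gen_idem1 g'"
    "(gen_idem2 g, w) \<in> paths True 2" "target (gen_idem2 g) w = gen_idem2 g'"
    using delta_loc_valid t by (simp_all add: mg)
  note c1 = iota_collapse[OF xe'(1,3) tv(1)] and c2 = iota_collapse[OF xe'(2,4) tv(3)]
  show valid: "lift_term m (v, w, g') \<in> valid m"
    unfolding lift_term_def mg using c1(1,2) c2(1,2) tv xe
    by (auto simp: idem1_def idem2_def X_basis_def intro!: validI)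
  show "xt_tensor n i (iota_words n i (fst m) v w) (fst m, g') = ev m (lift_term m (v, w, g'))"
    unfolding xt_tensor_def iota_words_def lift_term_def prod.case mg fst_conv
    by (rule tens_sum_collapse[where p = "(gen_idem1 g, v)" and p' = "(gen_idem2 g, w)"])
      (use valid c1(3,4) c2(3,4) tv in \<open>simp_all add: mg lift_term_def idem1_def idem2_def iota_path_def word_paths_iff\<close>)
qed

lemma label_term:
  assumes m: "m \<in> X_basis n i" and v: "([a], [b], m') \<in> valid m"
  shows "xt_tensor n i (label_tensor n a b) m' = ev m ([a], [b], m')"
proof -
  note vd = validD[OF v]
  have uniq: "q = (x, [c])" if "q \<in> word_paths s n [c]" "(x, [c]) \<in> paths s n" "path_end q = target x [c]" for q x c s
  proof -
    have q: "q = (fst q, [c])" "composable (fst q) [c]"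
      using that(1) by (cases q; simp add: word_paths_iff mem_paths)+
    then have "target (fst q) [c] = target x [c]" using that(3) by (metis path_end_simp)
    then have "fst q = x"
      using q(2) that(2) target_inj[of "fst q" "[c]" x] unfolding mem_paths by blast
    then show ?thesis using q(1) by simp
  qed
  have u: "q = (idem1 i m, [a])" if "q \<in> word_paths False n [a]" "path_end q = idem1 i m'" for q
    by (rule uniq[OF that(1) vd(2)]) (simp only: that(2) vd(3))
  have u': "q = (idem2 n i m, [b])" if "q \<in> word_paths True n [b]" "path_end q = idem2 n i m'" for q
    by (rule uniq[OF that(1) vd(4)]) (simp only: that(2) vd(5))
  show ?thesis
    unfolding xt_tensor_def label_tensor_def
    by (rule tens_sum_collapse[where p = "(idem1 i m, [a])" and p' = "(idem2 n i m, [b])" and h = "\<lambda>p. p" and h' = "\<lambda>p. p"])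
      (use v vd u u' in \<open>simp_all add: word_paths_iff\<close>)
qed

end

section \<open>The external moves\<close>

text \<open>\<open>flip0\<close> pairs generators of the same type whose idempotents differ by
  moving the local vertex 0 between the two factors; \<open>flip2\<close> does this for the vertex
  2. The generators fixed by \<open>flip0\<close> are those of type W, which have 0 in neither
  factor, and those fixed by \<open>flip2\<close> are of type E, with 2 in neither factor.\<close>

fun flip0 :: "xgen \<Rightarrow> xgen" where
  "flip0 Z1 = X1" | "flip0 X1 = Z1" | "flip0 Z2 = X4" | "flip0 X4 = Z2"
| "flip0 Z3 = X8" | "flip0 X8 = Z3" | "flip0 Z4 = X11" | "flip0 X11 = Z4"
| "flip0 X2 = Y1" | "flip0 Y1 = X2" | "flip0 X5 = Y3" | "flip0 Y3 = X5"
| "flip0 X9 = Y6" | "flip0 Y6 = X9" | "flip0 X12 = Y8" | "flip0 Y8 = X12"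
| "flip0 X6 = Y4" | "flip0 Y4 = X6" | "flip0 X10 = Y7" | "flip0 Y7 = X10"
| "flip0 g = g"

fun flip2 :: "xgen \<Rightarrow> xgen" where
  "flip2 Z1 = X2" | "flip2 X2 = Z1" | "flip2 Z2 = X5" | "flip2 X5 = Z2"
| "flip2 Z3 = X9" | "flip2 X9 = Z3" | "flip2 Z4 = X12" | "flip2 X12 = Z4"
| "flip2 X1 = Y1" | "flip2 Y1 = X1" | "flip2 X4 = Y3" | "flip2 Y3 = X4"
| "flip2 X8 = Y6" | "flip2 Y6 = X8" | "flip2 X11 = Y8" | "flip2 Y8 = X11"
| "flip2 X3 = Y2" | "flip2 Y2 = X3" | "flip2 X7 = Y5" | "flip2 Y5 = X7"
| "flip2 g = g"

lemma flip_kind: "gen_kind (flip0 g) = gen_kind g" "gen_kind (flip2 g) = gen_kind g"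
  by (cases g; simp)+

lemma flip_flip: "flip0 (flip0 g) = g" "flip2 (flip2 g) = g"
  by (cases g; simp)+

lemma flip0_idem:
  "0 \<notin> gen_idem1 g \<and> 0 \<in> gen_idem2 g \<Longrightarrow>
    gen_idem1 (flip0 g) = insert 0 (gen_idem1 g) \<and> gen_idem2 (flip0 g) = gen_idem2 g - {0}"
  "0 \<in> gen_idem1 g \<and> 0 \<notin> gen_idem2 g \<Longrightarrow>
    gen_idem1 (flip0 g) = gen_idem1 g - {0} \<and> gen_idem2 (flip0 g) = insert 0 (gen_idem2 g)"
  by (cases g; auto)+

lemma flip2_idem:
  "2 \<notin> gen_idem1 g \<and> 2 \<in> gen_idem2 g \<Longrightarrow>
    gen_idem1 (flip2 g) = insert 2 (gen_idem1 g) \<and> gen_idem2 (flip2 g) = gen_idem2 g - {2}"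
  "2 \<in> gen_idem1 g \<and> 2 \<notin> gen_idem2 g \<Longrightarrow>
    gen_idem1 (flip2 g) = gen_idem1 g - {2} \<and> gen_idem2 (flip2 g) = insert 2 (gen_idem2 g)"
  by (cases g; auto)+

text \<open>Type and idempotents determine a generator, which makes the counterpart described in
  \<open>sigma\<close> unique.\<close>

lemma gen_data_inj: "gen_data g = gen_data h \<Longrightarrow> g = h"
  by (cases g; cases h; simp)

text \<open>Both \<open>\<sigma>\<^sub>j\<close> and \<open>\<tau>\<^sub>j\<close> are restrictions of this involution.\<close>

definition flip :: "nat \<Rightarrow> nat \<Rightarrow> basis_elem \<Rightarrow> basis_elem"
  where "flip i j = (\<lambda>(xe, g).
    if j + 1 = i then (if j - 1 \<in> xe then xe - {j - 1} else insert (j - 1) xe, flip0 g)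
    else if j = i + 2 then (if j \<in> xe then xe - {j} else insert j xe, flip2 g)
    else (if j \<in> xe then insert (j - 1) (xe - {j}) else insert j (xe - {j - 1}), g))"

context X_setting
begin

abbreviation "J \<equiv> {1..n} - {i, i + 1}"

text \<open>A move at j touches the vertices j - 1 and j. It shares i - 1 with the local window, or
  i + 1, or no vertex at all.\<close>

lemma J_cases:
  assumes "j \<in> J"
  obtains (left) "j + 1 = i" "1 \<le> j" | (right) "j = i + 2" "j \<le> n"
    | (far) "j - 1 \<notin> {i - 1..i + 1}" "j \<notin> {i - 1..i + 1}" "j + 1 \<noteq> i" "j \<noteq> i + 2" "1 \<le> j" "j \<le> n"
proof -
  have "1 \<le> j" "j \<le> n" "j \<noteq> i" "j \<noteq> i + 1" using assms by auto
  then consider "j + 1 = i" | "j = i + 2" | "j + 2 \<le> i" | "i + 3 \<le> j" by linarith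
  then show ?thesis
  proof cases
    case 3
    then show ?thesis using far \<open>1 \<le> j\<close> \<open>j \<le> n\<close> by simp
  next
    case 4
    then have "\<not> j - 1 \<le> i + 1" by arith
    then show ?thesis using 4 far \<open>1 \<le> j\<close> \<open>j \<le> n\<close> by simp
  qed (use left right \<open>1 \<le> j\<close> \<open>j \<le> n\<close> in auto)
qed

lemma mem_S_ext: "k \<in> S_ext n i \<longleftrightarrow> k \<le> n \<and> k \<notin> {i - 1..i + 1}"
  using i1 by (auto simp: S_ext_def)

lemma mem_idem1:
  assumes "(xe, g) \<in> X_basis n i"
  shows "k \<in> idem1 i (xe, g) \<longleftrightarrow> (if k \<in> {i - 1..i + 1} then k + 1 - i \<in> gen_idem1 g else k \<in> xe)"
proof -
  have "gen_idem1 g \<subseteq> {0..2}" using gen_idem_subset(1)[of g] by auto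
  then show ?thesis
    unfolding idem1_def fst_conv snd_conv
    using assms S_ext_disjoint by (intro mem_shift_union i1) (auto simp: X_basis_def)
qed

lemma mem_idem2:
  assumes "(xe, g) \<in> X_basis n i"
  shows "k \<in> idem2 n i (xe, g) \<longleftrightarrow>
    (if k \<in> {i - 1..i + 1} then k + 1 - i \<in> gen_idem2 g else k \<le> n \<and> k \<notin> xe)"
proof -
  have "gen_idem2 g \<subseteq> {0..2}" using gen_idem_subset(2)[of g] by auto
  then have "k \<in> idem2 n i (xe, g) \<longleftrightarrow>
      (if k \<in> {i - 1..i + 1} then k + 1 - i \<in> gen_idem2 g else k \<in> S_ext n i - xe)"
    unfolding idem2_def fst_conv snd_conv
    using S_ext_disjoint[of "S_ext n i - xe"] by (intro mem_shift_union i1) auto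
  then show ?thesis by (simp add: mem_S_ext)
qed

lemma basis_key_inj:
  assumes "m \<in> X_basis n i" "m' \<in> X_basis n i" "gen_kind (snd m) = gen_kind (snd m')"
    "idem1 i m = idem1 i m'" "idem2 n i m = idem2 n i m'"
  shows "m = m'"
proof -
  obtain xe g xe' g' where m: "m = (xe, g)" "m' = (xe', g')" by (cases m; cases m')
  have xe: "xe \<inter> {i - 1..i + 1} = {}" "xe' \<inter> {i - 1..i + 1} = {}"
    using assms(1,2) S_ext_disjoint unfolding m X_basis_def by blast+
  have "k \<in> xe \<longleftrightarrow> k \<in> xe'" for k
    using mem_idem1[OF assms(1)[unfolded m], of k] mem_idem1[OF assms(2)[unfolded m], of k]
      assms(4)[unfolded m] xe by (cases "k \<in> {i - 1..i + 1}") auto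
  then have "xe = xe'" by blast
  moreover have "gen_idem1 g = gen_idem1 g'"
  proof (rule shift_inj)
    show "shift_set i (gen_idem1 g) \<union> xe = shift_set i (gen_idem1 g') \<union> xe"
      using assms(4) \<open>xe = xe'\<close> by (simp add: m idem1_def)
  qed (use xe gen_idem_subset(1)[of g] gen_idem_subset(1)[of g'] in auto)
  moreover have "gen_idem2 g = gen_idem2 g'"
  proof (rule shift_inj)
    show "shift_set i (gen_idem2 g) \<union> (S_ext n i - xe) = shift_set i (gen_idem2 g') \<union> (S_ext n i - xe)"
      using assms(5) \<open>xe = xe'\<close> by (simp add: m idem2_def)
  qed (use S_ext_disjoint[of "S_ext n i - xe"] gen_idem_subset(2)[of g] gen_idem_subset(2)[of g'] in auto)
  ultimately show ?thesis
    using assms(3) gen_data_inj[of g g'] by (simp add: m prod_eq_iff)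
qed

lemma A_set_iff: "m \<in> A_set n i j \<longleftrightarrow> m \<in> X_basis n i \<and>
    j - 1 \<in> idem1 i m \<and> j - 1 \<notin> idem2 n i m \<and> j \<notin> idem1 i m \<and> j \<in> idem2 n i m"
  by (simp add: A_set_def)

lemma B_set_iff: "m \<in> B_set n i j \<longleftrightarrow> m \<in> X_basis n i \<and>
    j \<in> idem1 i m \<and> j \<notin> idem2 n i m \<and> j - 1 \<notin> idem1 i m \<and> j - 1 \<in> idem2 n i m"
  by (simp add: B_set_def)

text \<open>Both directions are treated at once: a is the vertex that leaves the first idempotent
  and enters the second, and b does the opposite.\<close>

lemma flip_swap:
  assumes j: "j \<in> J" and m: "m \<in> X_basis n i" and ab: "a = j - 1 \<and> b = j \<or> a = j \<and> b = j - 1"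
    and A: "a \<in> idem1 i m" "a \<notin> idem2 n i m" "b \<notin> idem1 i m" "b \<in> idem2 n i m"
  shows "flip i j m \<in> X_basis n i" and "idem1 i (flip i j m) = (idem1 i m - {a}) \<union> {b}"
    and "idem2 n i (flip i j m) = (idem2 n i m - {b}) \<union> {a}" and "flip i j (flip i j m) = m"
proof -
  obtain xe g where mg: "m = (xe, g)" by (cases m)
  have b: "(xe, g) \<in> X_basis n i" using m by (simp add: mg)
  then have xe: "xe \<subseteq> S_ext n i" by (simp add: X_basis_def)
  note A = A[unfolded mg mem_idem1[OF b] mem_idem2[OF b]]
  \<comment> \<open>Membership in the two new idempotents is spelled out pointwise, a common form
    that the three positions of j can all deliver.\<close>
  have "\<exists>xe' g'. flip i j m = (xe', g') \<and> xe' \<subseteq> S_ext n i \<and> flip i j (flip i j m) = m \<and>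
    (\<forall>k. (if k \<in> {i - 1..i + 1} then k + 1 - i \<in> gen_idem1 g' else k \<in> xe') \<longleftrightarrow>
      k \<noteq> a \<and> (if k \<in> {i - 1..i + 1} then k + 1 - i \<in> gen_idem1 g else k \<in> xe) \<or> k = b) \<and>
    (\<forall>k. (if k \<in> {i - 1..i + 1} then k + 1 - i \<in> gen_idem2 g' else k \<le> n \<and> k \<notin> xe') \<longleftrightarrow>
      k \<noteq> b \<and> (if k \<in> {i - 1..i + 1} then k + 1 - i \<in> gen_idem2 g else k \<le> n \<and> k \<notin> xe) \<or> k = a)"
    using j
  proof (cases rule: J_cases)
    case left
    then have out: "j - 1 \<notin> {i - 1..i + 1}" "j \<in> {i - 1..i + 1}" "j + 1 - i = 0" "j - 1 \<noteq> j" "j = i - 1"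
      by auto
    have S: "j - 1 \<in> S_ext n i" using left i1_le by (auto simp: S_ext_def)
    \<comment> \<open>As j = i - 1 is the image of the local vertex 0, removing one is removing the
      other.\<close>
    have k0: "k + 1 - i \<noteq> 0 \<longleftrightarrow> k \<noteq> j" if "k \<in> {i - 1..i + 1}" for k
      using that left by auto
    from ab show ?thesis
    proof (elim disjE conjE)
      assume e: "a = j - 1" "b = j"
      have g: "0 \<notin> gen_idem1 g \<and> 0 \<in> gen_idem2 g" "j - 1 \<in> xe"
        using A unfolding e using out by simp_all
      have f: "flip i j m = (xe - {j - 1}, flip0 g)" using left g by (simp add: flip_def mg)
      have "flip i j (flip i j m) = m"
        unfolding f using left g by (auto simp: flip_def flip_flip mg)
      then show ?thesis
        unfolding f e using xe out(1,2,4) k0 flip0_idem(1)[OF g(1)] left(2) i1_le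
        by (intro exI[of _ "xe - {j - 1}"] exI[of _ "flip0 g"]) auto
    next
      assume e: "a = j" "b = j - 1"
      have g: "0 \<in> gen_idem1 g \<and> 0 \<notin> gen_idem2 g" "j - 1 \<notin> xe"
        using A unfolding e using out by simp_all
      have f: "flip i j m = (insert (j - 1) xe, flip0 g)" using left g by (simp add: flip_def mg)
      have "flip i j (flip i j m) = m"
        unfolding f using left g by (auto simp: flip_def flip_flip mg)
      then show ?thesis
        unfolding f e using xe S out(1,2,4) k0 flip0_idem(2)[OF g(1)] left(2) i1_le
        by (intro exI[of _ "insert (j - 1) xe"] exI[of _ "flip0 g"]) auto
    qed
  next
    case right
    then have out: "j \<notin> {i - 1..i + 1}" "j - 1 \<in> {i - 1..i + 1}" "j - 1 + 1 - i = 2" "j - 1 \<noteq> j"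
      by auto
    have S: "j \<in> S_ext n i" using right by (auto simp: S_ext_def)
    have k0: "k + 1 - i \<noteq> 2 \<longleftrightarrow> k \<noteq> j - 1" if "k \<in> {i - 1..i + 1}" for k
      using that right i1 by auto
    from ab show ?thesis
    proof (elim disjE conjE)
      assume e: "a = j - 1" "b = j"
      have g: "2 \<notin> gen_idem1 g \<and> 2 \<in> gen_idem2 g \<Longrightarrow> True" "2 \<in> gen_idem1 g \<and> 2 \<notin> gen_idem2 g" "j \<notin> xe"
        using A unfolding e using out by simp_all
      have f: "flip i j m = (insert j xe, flip2 g)" using right g by (simp add: flip_def mg)
      have "flip i j (flip i j m) = m"
        unfolding f using right g by (auto simp: flip_def flip_flip mg)
      then show ?thesis
        unfolding f e using xe S out(1,2,4) k0 flip2_idem(2)[OF g(2)] right(2)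
        by (intro exI[of _ "insert j xe"] exI[of _ "flip2 g"]) auto
    next
      assume e: "a = j" "b = j - 1"
      have g: "2 \<notin> gen_idem1 g \<and> 2 \<in> gen_idem2 g" "j \<in> xe"
        using A unfolding e using out by simp_all
      have f: "flip i j m = (xe - {j}, flip2 g)" using right g by (simp add: flip_def mg)
      have "flip i j (flip i j m) = m"
        unfolding f using right g by (auto simp: flip_def flip_flip mg)
      then show ?thesis
        unfolding f e using xe out(1,2,4) k0 flip2_idem(1)[OF g(1)] right(2)
        by (intro exI[of _ "xe - {j}"] exI[of _ "flip2 g"]) auto
    qed
  next
    case far
    then have ne: "j - 1 \<noteq> j" by simp
    have S: "j \<in> S_ext n i" "j - 1 \<in> S_ext n i" using far by (auto simp: mem_S_ext)
    from ab show ?thesis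
    proof (elim disjE conjE)
      assume e: "a = j - 1" "b = j"
      have g: "j - 1 \<in> xe" "j \<notin> xe"
        using A far(1,2) unfolding e by (simp_all only: if_False simp_thms)
      have f: "flip i j m = (insert j (xe - {j - 1}), g)" using far g by (simp add: flip_def mg)
      have "flip i j (flip i j m) = m"
        unfolding f using far g by (auto simp: flip_def mg)
      then show ?thesis
        unfolding f e using xe S far g ne
        by (intro exI[of _ "insert j (xe - {j - 1})"] exI[of _ g]) auto
    next
      assume e: "a = j" "b = j - 1"
      have g: "j \<in> xe" "j - 1 \<notin> xe"
        using A far(1,2) unfolding e by (simp_all only: if_False simp_thms)
      have f: "flip i j m = (insert (j - 1) (xe - {j}), g)" using far g by (simp add: flip_def mg)
      have "flip i j (flip i j m) = m"
        unfolding f using far g by (auto simp: flip_def mg)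
      then show ?thesis
        unfolding f e using xe S far g ne
        by (intro exI[of _ "insert (j - 1) (xe - {j})"] exI[of _ g]) auto
    qed
  qed
  then obtain xe' g' where f: "flip i j m = (xe', g')" "xe' \<subseteq> S_ext n i" and ff: "flip i j (flip i j m) = m"
    and 1: "\<And>k. (if k \<in> {i - 1..i + 1} then k + 1 - i \<in> gen_idem1 g' else k \<in> xe') \<longleftrightarrow>
      k \<noteq> a \<and> (if k \<in> {i - 1..i + 1} then k + 1 - i \<in> gen_idem1 g else k \<in> xe) \<or> k = b"
    and 2: "\<And>k. (if k \<in> {i - 1..i + 1} then k + 1 - i \<in> gen_idem2 g' else k \<le> n \<and> k \<notin> xe') \<longleftrightarrow>
      k \<noteq> b \<and> (if k \<in> {i - 1..i + 1} then k + 1 - i \<in> gen_idem2 g else k \<le> n \<and> k \<notin> xe) \<or> k = a"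
    by blast
  have b': "(xe', g') \<in> X_basis n i" using f by (simp add: X_basis_def)
  show "flip i j m \<in> X_basis n i" unfolding f(1) by (rule b')
  show "flip i j (flip i j m) = m" by (rule ff)
  show "idem1 i (flip i j m) = (idem1 i m - {a}) \<union> {b}"
    unfolding f(1) unfolding mg
    by (rule Set.set_eqI) (simp only: mem_idem1[OF b'] mem_idem1[OF b] 1 Un_iff Diff_iff singleton_iff; blast)
  show "idem2 n i (flip i j m) = (idem2 n i m - {b}) \<union> {a}"
    unfolding f(1) unfolding mg
    by (rule Set.set_eqI) (simp only: mem_idem2[OF b'] mem_idem2[OF b] 2 Un_iff Diff_iff singleton_iff; blast)
qed

end

section \<open>Formal sums of triples and their composition\<close>

definition lin :: "('a \<Rightarrow> 'b \<Rightarrow>\<^sub>0 bit) \<Rightarrow> ('a \<Rightarrow>\<^sub>0 bit) \<Rightarrow> 'b \<Rightarrow>\<^sub>0 bit"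
  where "lin \<phi> f = (\<Sum>p\<in>Poly_Mapping.keys f. \<phi> p)"

lemma lin_add: "lin \<phi> (f + g) = lin \<phi> f + lin \<phi> g"
  by (simp add: lin_def sum_keys_add)

lemma lin_zero [simp]: "lin \<phi> 0 = 0" and lin_bvec [simp]: "lin \<phi> (bvec p) = \<phi> p"
  by (simp_all add: lin_def)

lemma lin_sum: "lin \<phi> (sum f A) = (\<Sum>a\<in>A. lin \<phi> (f a))"
  by (induction A rule: infinite_finite_induct) (simp_all add: lin_add)

lemma lin_fun_add: "lin (\<lambda>p. \<phi> p + \<psi> p) f = lin \<phi> f + lin \<psi> f"
  by (simp add: lin_def sum.distrib)

lemma lin_fun_sum: "lin (\<lambda>p. \<Sum>a\<in>A. \<phi> a p) f = (\<Sum>a\<in>A. lin (\<phi> a) f)"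
  unfolding lin_def by (rule sum.swap)

text \<open>The counterpart of \<partial> \<otimes> id on triples. Only the second word is
  differentiated, since the first factor has zero differential.\<close>

definition term_diff :: "wterm \<Rightarrow> wterm \<Rightarrow>\<^sub>0 bit"
  where "term_diff = (\<lambda>(v, w, m). \<Sum>k<length w. case w ! k of CC i \<Rightarrow> bvec (v, w[k := UU i], m) | _ \<Rightarrow> 0)"

definition prefix :: "label list \<Rightarrow> label list \<Rightarrow> (wterm \<Rightarrow>\<^sub>0 bit) \<Rightarrow> wterm \<Rightarrow>\<^sub>0 bit"
  where "prefix v w = lin (\<lambda>(v', w', m). bvec (v @ v', w @ w', m))"

text \<open>The counterpart of applying id \<otimes> \<delta> and then \<mu> \<otimes> id, for a map
  \<delta> whose value at the basis element m is encoded by G m.\<close>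

definition compose :: "(wterm \<Rightarrow>\<^sub>0 bit) \<Rightarrow> (basis_elem \<Rightarrow> wterm \<Rightarrow>\<^sub>0 bit) \<Rightarrow> wterm \<Rightarrow>\<^sub>0 bit"
  where "compose f G = lin (\<lambda>(v, w, m). prefix v w (G m)) f"

lemma compose_bvec [simp]: "compose (bvec (v, w, m)) G = prefix v w (G m)"
  by (simp add: compose_def)

lemma prefix_bvec [simp]: "prefix v w (bvec (v', w', m)) = bvec (v @ v', w @ w', m)"
  by (simp add: prefix_def)

lemma prefix_zero [simp]: "prefix v w 0 = 0"
  by (simp add: prefix_def)

lemma prefix_add: "prefix v w (f + g) = prefix v w f + prefix v w g"
  by (simp add: prefix_def lin_add)

lemma prefix_sum: "prefix v w (sum f A) = (\<Sum>a\<in>A. prefix v w (f a))"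
  by (simp add: prefix_def lin_sum)

lemma compose_zero [simp]: "compose 0 G = 0"
  by (simp add: compose_def)

lemma compose_add_left: "compose (f + g) H = compose f H + compose g H"
  by (simp add: compose_def lin_add)

lemma compose_sum_left: "compose (sum f A) H = (\<Sum>a\<in>A. compose (f a) H)"
  by (simp add: compose_def lin_sum)

lemma compose_add_right: "compose f (\<lambda>m. G m + H m) = compose f G + compose f H"
  by (simp add: compose_def prefix_add case_prod_unfold lin_fun_add)

lemma compose_sum_right: "compose f (\<lambda>m. \<Sum>a\<in>A. G a m) = (\<Sum>a\<in>A. compose f (G a))"
  by (simp add: compose_def prefix_sum case_prod_unfold lin_fun_sum)

section \<open>The structure equation in terms of words\<close>

context X_setting
begin

lemma sigma_eq:
  assumes j: "j \<in> J" and m: "m \<in> A_set n i j"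
  shows "sigma n i j m = flip i j m"
  unfolding sigma_def
proof (rule the_equality)
  have "m \<in> X_basis n i" "j - 1 \<in> idem1 i m" "j - 1 \<notin> idem2 n i m" "j \<notin> idem1 i m" "j \<in> idem2 n i m"
    using m unfolding A_set_iff by blast+
  note f = flip_swap[OF j this(1) disjI1[OF conjI[OF refl refl]] this(2-)]
  have k: "gen_kind (snd (flip i j m)) = gen_kind (snd m)"
    by (simp add: flip_def flip_kind split: prod.split)
  show *: "flip i j m \<in> X_basis n i \<and> gen_kind (snd (flip i j m)) = gen_kind (snd m) \<and>
    idem1 i (flip i j m) = (idem1 i m - {j - 1}) \<union> {j} \<and>
    idem2 n i (flip i j m) = (idem2 n i m - {j}) \<union> {j - 1}"
    using f k by simp
  fix m' assume "m' \<in> X_basis n i \<and> gen_kind (snd m') = gen_kind (snd m) \<and>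
    idem1 i m' = (idem1 i m - {j - 1}) \<union> {j} \<and>
    idem2 n i m' = (idem2 n i m - {j}) \<union> {j - 1}"
  then show "m' = flip i j m" using * by (intro basis_key_inj) simp_all
qed

lemma A_flip:
  assumes j: "j \<in> J" and m: "m \<in> A_set n i j"
  shows "flip i j m \<in> B_set n i j" and "idem1 i (flip i j m) = arrow_target (idem1 i m) (RR j)"
    and "idem2 n i (flip i j m) = arrow_target (idem2 n i m) (LL j)" and "flip i j (flip i j m) = m"
proof -
  have mm: "m \<in> X_basis n i" "j - 1 \<in> idem1 i m" "j - 1 \<notin> idem2 n i m" "j \<notin> idem1 i m" "j \<in> idem2 n i m"
    using m unfolding A_set_iff by blast+
  have j1: "j - 1 \<noteq> j" using j by auto
  note f = flip_swap[OF j mm(1) disjI1[OF conjI[OF refl refl]] mm(2-)]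
  show "flip i j m \<in> B_set n i j" unfolding B_set_iff f(2,3) using f(1) mm j1 j1[symmetric] by simp
  show "idem1 i (flip i j m) = arrow_target (idem1 i m) (RR j)" "idem2 n i (flip i j m) = arrow_target (idem2 n i m) (LL j)"
    unfolding arrow_target.simps by (rule f(2), rule f(3))
  show "flip i j (flip i j m) = m" by (rule f(4))
qed

lemma B_flip:
  assumes j: "j \<in> J" and m: "m \<in> B_set n i j"
  shows "flip i j m \<in> A_set n i j" and "idem1 i (flip i j m) = arrow_target (idem1 i m) (LL j)"
    and "idem2 n i (flip i j m) = arrow_target (idem2 n i m) (RR j)" and "flip i j (flip i j m) = m"
proof -
  have mm: "m \<in> X_basis n i" "j \<in> idem1 i m" "j \<notin> idem2 n i m" "j - 1 \<notin> idem1 i m" "j - 1 \<in> idem2 n i m"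
    using m unfolding B_set_iff by blast+
  have j1: "j - 1 \<noteq> j" using j by auto
  note f = flip_swap[OF j mm(1) disjI2[OF conjI[OF refl refl]] mm(2-)]
  show "flip i j m \<in> A_set n i j" unfolding A_set_iff f(2,3) using f(1) mm j1 j1[symmetric] by simp
  show "idem1 i (flip i j m) = arrow_target (idem1 i m) (LL j)" "idem2 n i (flip i j m) = arrow_target (idem2 n i m) (RR j)"
    unfolding arrow_target.simps by (rule f(2), rule f(3))
  show "flip i j (flip i j m) = m" by (rule f(4))
qed

lemma sigma_inv_eq:
  assumes j: "j \<in> J" and m: "m \<in> B_set n i j"
  shows "sigma_inv n i j m = flip i j m"
proof -
  have "inj_on (sigma n i j) (A_set n i j)"
    using sigma_eq[OF j] A_flip(4)[OF j] by (metis inj_onI)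
  then have "inv_into (A_set n i j) (sigma n i j) (sigma n i j (flip i j m)) = flip i j m"
    using B_flip(1)[OF j m] by (rule inv_into_f_f)
  then show ?thesis
    using sigma_eq[OF j B_flip(1)[OF j m]] B_flip(4)[OF j m] by (simp add: sigma_inv_def)
qed

lemma A_B_disjoint: "m \<in> A_set n i j \<Longrightarrow> m \<notin> B_set n i j"
  unfolding A_set_iff B_set_iff by blast

text \<open>\<open>Lw\<close>, \<open>Uw\<close>, \<open>Vw\<close> and \<open>Dw\<close> encode the
  local, unmoving, moving and total differential of a basis element; \<open>delta_basis\<close> is
  the comparison with the given definitions.\<close>

definition Lw :: "basis_elem \<Rightarrow> wterm \<Rightarrow>\<^sub>0 bit"
  where "Lw m = (\<Sum>t\<in>delta_loc (snd m). bvec (lift_term m t))"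

definition Uw :: "nat \<Rightarrow> basis_elem \<Rightarrow> wterm \<Rightarrow>\<^sub>0 bit"
  where "Uw j m = bvec ([UU j], [CC j], m)"

definition Vw :: "nat \<Rightarrow> basis_elem \<Rightarrow> wterm \<Rightarrow>\<^sub>0 bit"
  where "Vw j m = (if m \<in> A_set n i j then bvec ([RR j], [LL j], flip i j m)
    else if m \<in> B_set n i j then bvec ([LL j], [RR j], flip i j m) else 0)"

definition Dw :: "basis_elem \<Rightarrow> wterm \<Rightarrow>\<^sub>0 bit"
  where "Dw m = Lw m + (\<Sum>j\<in>J. Uw j m + Vw j m)"

abbreviation "WS m \<equiv> {f :: wterm \<Rightarrow>\<^sub>0 bit. Poly_Mapping.keys f \<subseteq> valid m}"

definition evm :: "basis_elem \<Rightarrow> (wterm \<Rightarrow>\<^sub>0 bit) \<Rightarrow> xt_elem"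
  where "evm m = linear_ext T (ev m)"

lemma evm_closed: "f \<in> WS m \<Longrightarrow> evm m f \<in> carrier (tensor_group K (BB n) M)"
  unfolding evm_def using T.linear_ext_closed[OF ev_closed] by simp

lemma evm_add: "f \<in> WS m \<Longrightarrow> g \<in> WS m \<Longrightarrow> evm m (f + g) = evm m f \<oplus>\<^bsub>tensor_group K (BB n) M\<^esub> evm m g"
  unfolding evm_def using T.linear_ext_add[OF ev_closed] by simp

lemma evm_zero [simp]: "evm m 0 = \<zero>\<^bsub>tensor_group K (BB n) M\<^esub>"
  by (simp add: evm_def)

lemma evm_bvec: "t \<in> valid m \<Longrightarrow> evm m (bvec t) = ev m t"
  unfolding evm_def by (rule T.linear_ext_bvec) (use ev_closed in blast)

lemma WS_sum: "(\<And>a. a \<in> A \<Longrightarrow> f a \<in> WS m) \<Longrightarrow> sum f A \<in> WS m"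
  unfolding mem_Collect_eq by (rule keys_sum_subset)

lemma evm_sum:
  assumes "finite A" "\<And>a. a \<in> A \<Longrightarrow> f a \<in> WS m"
  shows "evm m (sum f A) = (\<Oplus>\<^bsub>T\<^esub>a\<in>A. evm m (f a))"
  using assms
proof (induction A rule: finite_induct)
  case (insert a A)
  have "evm m (f a + sum f A) = evm m (f a) \<oplus>\<^bsub>tensor_group K (BB n) M\<^esub> evm m (sum f A)"
    using insert.prems by (intro evm_add WS_sum) auto
  moreover have "(\<lambda>a. evm m (f a)) \<in> A \<rightarrow> carrier (tensor_group K (BB n) M)"
    using insert.prems evm_closed by auto
  moreover have "evm m (f a) \<in> carrier (tensor_group K (BB n) M)"
    using insert.prems by (intro evm_closed) simp
  ultimately show ?case
    using insert by (simp add: T.finsum_insert)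
qed simp

lemma J_labels: "j \<in> J \<Longrightarrow> idx l = j \<Longrightarrow> (is_CC l \<longrightarrow> s) \<Longrightarrow> l \<in> labels s n"
  by (auto simp: labels_def)

lemma U_valid: "j \<in> J \<Longrightarrow> m \<in> X_basis n i \<Longrightarrow> ([UU j], [CC j], m) \<in> valid m"
  by (rule validI) (simp_all add: mem_paths J_labels idem1_subset idem2_subset)

lemma V_valid:
  assumes j: "j \<in> J"
  shows "m \<in> A_set n i j \<Longrightarrow> ([RR j], [LL j], flip i j m) \<in> valid m"
    and "m \<in> B_set n i j \<Longrightarrow> ([LL j], [RR j], flip i j m) \<in> valid m"
proof -
  have j1: "1 \<le> j" using j by auto
  note l = J_labels[OF j, of "RR j"] J_labels[OF j, of "LL j"]
  show "([RR j], [LL j], flip i j m) \<in> valid m" if m: "m \<in> A_set n i j"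
  proof -
    have b: "m \<in> X_basis n i" using m by (simp add: A_set_iff)
    have "flip i j m \<in> X_basis n i" using A_flip(1)[OF j m] by (simp add: B_set_iff)
    moreover have "has_arrow (idem1 i m) (RR j)" "has_arrow (idem2 n i m) (LL j)"
      unfolding has_arrow_iff[OF j1] using m by (simp_all add: A_set_iff)
    ultimately show ?thesis
      using A_flip(2,3)[OF j m] idem1_subset[OF b] idem2_subset[OF b] l
      by (intro validI) (simp_all add: mem_paths del: has_arrow.simps arrow_target.simps)
  qed
  show "([LL j], [RR j], flip i j m) \<in> valid m" if m: "m \<in> B_set n i j"
  proof -
    have b: "m \<in> X_basis n i" using m by (simp add: B_set_iff)
    have "flip i j m \<in> X_basis n i" using B_flip(1)[OF j m] by (simp add: A_set_iff)
    moreover have "has_arrow (idem1 i m) (LL j)" "has_arrow (idem2 n i m) (RR j)"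
      unfolding has_arrow_iff[OF j1] using m by (simp_all add: B_set_iff)
    ultimately show ?thesis
      using B_flip(2,3)[OF j m] idem1_subset[OF b] idem2_subset[OF b] l
      by (intro validI) (simp_all add: mem_paths del: has_arrow.simps arrow_target.simps)
  qed
qed

lemma L_valid: "m \<in> X_basis n i \<Longrightarrow> t \<in> delta_loc (snd m) \<Longrightarrow> lift_term m t \<in> valid m"
  by (cases t) (simp add: local_term(1))

lemma Lw_WS: "m \<in> X_basis n i \<Longrightarrow> Lw m \<in> WS m"
  unfolding Lw_def by (rule WS_sum) (simp add: L_valid)

lemma Uw_WS: "j \<in> J \<Longrightarrow> m \<in> X_basis n i \<Longrightarrow> Uw j m \<in> WS m"
  unfolding Uw_def using U_valid by simp

lemma Vw_WS: "j \<in> J \<Longrightarrow> Vw j m \<in> WS m"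
  unfolding Vw_def using V_valid by simp

lemma WS_add: "f \<in> WS m \<Longrightarrow> g \<in> WS m \<Longrightarrow> f + g \<in> WS m"
  by (simp add: keys_add_subset)

lemma Dw_WS: "m \<in> X_basis n i \<Longrightarrow> Dw m \<in> WS m"
  unfolding Dw_def by (intro WS_add WS_sum Lw_WS Uw_WS Vw_WS)

lemma XT_eq: "XT n i = T"
  by (simp add: XT_def)

lemma delta_basis:
  assumes m: "m \<in> X_basis n i"
  shows "delta_local n i m \<oplus>\<^bsub>XT n i\<^esub> delta_external n i m = evm m (Dw m)"
proof -
  have "delta_local n i m = (\<Oplus>\<^bsub>T\<^esub>t\<in>delta_loc (snd m). evm m (bvec (lift_term m t)))"
    unfolding delta_local_def XT_eq
  proof (rule T.finsum_cong')
    show "(\<lambda>t. evm m (bvec (lift_term m t))) \<in> delta_loc (snd m) \<rightarrow> carrier T"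
      unfolding T_simps using L_valid[OF m] by (intro Pi_I evm_closed) simp
    fix t assume t: "t \<in> delta_loc (snd m)"
    obtain v w g where "t = (v, w, g)" by (cases t)
    then show "(case t of (v, w, g) \<Rightarrow> xt_tensor n i (iota_words n i (fst m) v w) (fst m, g)) =
        evm m (bvec (lift_term m t))"
      using local_term(2)[OF m] t L_valid[OF m t] by (simp add: evm_bvec)
  qed simp
  also have "\<dots> = evm m (Lw m)"
    unfolding Lw_def using L_valid[OF m] by (intro evm_sum[symmetric]) simp_all
  finally have L: "delta_local n i m = evm m (Lw m)" .
  have un: "delta_unmoving n i j m = evm m (Uw j m)" if "j \<in> J" for j
    unfolding delta_unmoving_def Uw_def evm_bvec[OF U_valid[OF that m]]
    by (rule label_term[OF m U_valid[OF that m]])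
  have mv: "delta_moving n i j m = evm m (Vw j m)" if j: "j \<in> J" for j
    using A_B_disjoint[of m j] label_term[OF m V_valid(1)[OF j]] label_term[OF m V_valid(2)[OF j]] V_valid[OF j, of m]
    by (simp add: delta_moving_def Vw_def sigma_eq[OF j] sigma_inv_eq[OF j] evm_bvec XT_eq)
  have "delta_external n i m = (\<Oplus>\<^bsub>T\<^esub>j\<in>J. evm m (Uw j m + Vw j m))"
    unfolding delta_external_def XT_eq
  proof (rule T.finsum_cong')
    show "(\<lambda>j. evm m (Uw j m + Vw j m)) \<in> J \<rightarrow> carrier T"
      unfolding T_simps using Uw_WS[OF _ m] Vw_WS by (intro Pi_I evm_closed WS_add)
  qed (simp_all only: un mv T_simps evm_add[OF Uw_WS[OF _ m] Vw_WS])
  also have "\<dots> = evm m (\<Sum>j\<in>J. Uw j m + Vw j m)"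
    using Uw_WS[OF _ m] Vw_WS by (intro evm_sum[symmetric] WS_add) simp
  finally have E: "delta_external n i m = evm m (\<Sum>j\<in>J. Uw j m + Vw j m)" .
  show ?thesis
    unfolding L E XT_eq T_simps Dw_def using Uw_WS[OF _ m] Vw_WS Lw_WS[OF m]
    by (intro evm_add[symmetric] WS_sum WS_add)
qed

lemma X_delta_eq: "f \<in> carrier M \<Longrightarrow> X_delta n i f = linear_ext T (\<lambda>m. evm m (Dw m)) f"
  unfolding X_delta_def linear_ext_def XT_eq
proof (rule T.finsum_cong')
  assume f: "f \<in> carrier M"
  then have sub: "m \<in> X_basis n i" if "m \<in> Poly_Mapping.keys f" for m using that by auto
  show "(\<lambda>m. evm m (Dw m)) \<in> Poly_Mapping.keys f \<rightarrow> carrier T"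
    using sub evm_closed[OF Dw_WS] by simp
  show "delta_local n i m \<oplus>\<^bsub>T\<^esub> delta_external n i m = evm m (Dw m)"
    if "m \<in> Poly_Mapping.keys f" for m
    using delta_basis[OF sub[OF that]] unfolding XT_eq .
qed simp

lemma delta_pi: "(\<lambda>m. evm m (Dw m)) \<in> X_basis n i \<rightarrow> carrier T"
  using evm_closed[OF Dw_WS] by simp

lemma X_delta_bvec: "m \<in> X_basis n i \<Longrightarrow> X_delta n i (bvec m) = evm m (Dw m)"
  using evm_closed[OF Dw_WS] by (simp add: X_delta_eq)

lemma X_delta_closed: "f \<in> carrier M \<Longrightarrow> X_delta n i f \<in> carrier (tensor_group K (BB n) M)"
  using T.linear_ext_closed[OF delta_pi, of f] by (simp add: X_delta_eq)

lemma X_delta_add: "f \<in> carrier M \<Longrightarrow> g \<in> carrier M \<Longrightarrow>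
    X_delta n i (f + g) = X_delta n i f \<oplus>\<^bsub>tensor_group K (BB n) M\<^esub> X_delta n i g"
  using T.linear_ext_add[OF delta_pi, of f g] by (simp add: X_delta_eq keys_add_subset)

lemma X_delta_zero: "X_delta n i 0 = \<zero>\<^bsub>tensor_group K (BB n) M\<^esub>"
  by (simp add: X_delta_eq)

text \<open>All paths in f start at the idempotents of m, so \<open>idem m\<close> fixes their
  coefficients and k acts through its product with \<open>idem m\<close>. Linearity of the
  differential over the idempotent ring follows.\<close>

lemma act_evm:
  assumes k: "k \<in> gspan (BB n) (idems n)" and m: "m \<in> X_basis n i" and f: "f \<in> WS m"
  shows "k \<odot>\<^bsub>T\<^esub> evm m f = (if k \<otimes>\<^bsub>BB n\<^esub> idem m = idem m then evm m f else \<zero>\<^bsub>tensor_group K (BB n) M\<^esub>)"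
proof -
  have kc: "k \<in> carrier (BB n)" using k by (rule idem_ring_closed)
  have "Poly_Mapping.keys f \<subseteq> valid m" using f by simp
  then show ?thesis
  proof (induction f rule: bit_poly_induct)
    case zero
    then show ?case using kc by (simp add: act_zero)
  next
    case (bvec t)
    obtain v w m' where t: "t = (v, w, m')" by (cases t)
    have vt: "(v, w, m') \<in> valid m" using bvec t by simp
    have c: "coeff m v w \<in> carrier (BB n)" by (rule coeff_closed[OF vt])
    have "idem m \<otimes>\<^bsub>BB n\<^esub> coeff m v w = coeff m v w"
      using validD[OF vt] idem1_subset[OF m] idem2_subset[OF m]
      by (simp add: bb_idem_def coeff_def bb_mult path_mult_simp)
    then have "k \<otimes>\<^bsub>BB n\<^esub> coeff m v w = (k \<otimes>\<^bsub>BB n\<^esub> idem m) \<otimes>\<^bsub>BB n\<^esub> coeff m v w"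
      using kc c m by (simp add: BB.m_assoc)
    then have "k \<otimes>\<^bsub>BB n\<^esub> coeff m v w = (if k \<otimes>\<^bsub>BB n\<^esub> idem m = idem m then coeff m v w else \<zero>\<^bsub>BB n\<^esub>)"
      using idem_action_cases[OF k m] \<open>idem m \<otimes>\<^bsub>BB n\<^esub> coeff m v w = coeff m v w\<close> c by auto
    then show ?case
      using validD(1)[OF vt] kc c by (simp add: t evm_bvec[OF vt] ev_def act_tens)
  next
    case (add f g)
    then show ?case
      using kc evm_closed[of f m] evm_closed[of g m] by (simp add: evm_add act_add_right)
  qed
qed

lemma X_delta_smult:
  assumes k: "k \<in> carrier K" and f: "f \<in> carrier M"
  shows "X_delta n i (k \<odot>\<^bsub>M\<^esub> f) = k \<odot>\<^bsub>T\<^esub> X_delta n i f"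
proof -
  have k': "k \<in> gspan (BB n) (idems n)" using k by simp
  have kc: "k \<in> carrier (BB n)" using k' by (rule idem_ring_closed)
  have "Poly_Mapping.keys f \<subseteq> X_basis n i" using f by simp
  then show ?thesis
  proof (induction f rule: bit_poly_induct)
    case zero
    then show ?case using kc by (simp add: act_zero X_delta_zero)
  next
    case (bvec m)
    then show ?case
      by (simp add: M_smult_bvec X_delta_bvec X_delta_zero act_evm[OF k' bvec Dw_WS[OF bvec]])
  next
    case (add f g)
    then show ?case
      using kc X_delta_closed[of f] X_delta_closed[of g] M_smult_closed[of f k] M_smult_closed[of g k]
      by (simp add: M_smult_add X_delta_add act_add_right)
  qed
qed

lemma TD: "type_D_data K (BB n) M (X_delta n i)"
  by unfold_locales
    (use diff_idem_ring X_delta_closed X_delta_add X_delta_smult in simp_all)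

interpretation TD: type_D_data K "BB n" M "X_delta n i"
  by (rule TD)

section \<open>The curvature of a sum of triples\<close>

lemma diff_term_WS:
  assumes "(v, w, m') \<in> valid m" "k < length w"
  shows "(case w ! k of CC i \<Rightarrow> bvec (v, w[k := UU i], m') | _ \<Rightarrow> 0) \<in> WS m"
proof (cases "w ! k")
  case (CC c)
  have "(v, w[k := UU c], m') \<in> valid m"
    using validD[OF assms(1)] CC_replace[OF assms(2) CC] by (intro validI) simp_all
  then show ?thesis by (simp add: CC)
qed simp_all

lemma term_diff_WS: "(v, w, m') \<in> valid m \<Longrightarrow> term_diff (v, w, m') \<in> WS m"
  unfolding term_diff_def prod.case by (intro WS_sum diff_term_WS) simp_all

lemma prefix_WS:
  assumes "(v, w, m') \<in> valid m" "f \<in> WS m'" shows "prefix v w f \<in> WS m"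
  unfolding prefix_def lin_def
proof (rule WS_sum)
  fix t assume "t \<in> Poly_Mapping.keys f"
  then have "t \<in> valid m'" using assms(2) by blast
  then show "(case t of (v', w', m'') \<Rightarrow> bvec (v @ v', w @ w', m'')) \<in> WS m"
    using valid_append[OF assms(1)] by (cases t) simp
qed

lemma diff_coeff:
  assumes t: "(v, w, m') \<in> valid m"
  shows "diff (BB n) (coeff m v w) \<boxtimes> bvec m' = evm m (term_diff (v, w, m'))"
proof -
  note vd = validD[OF t]
  let ?y = "idem2 n i m"
  let ?\<Lambda> = "\<lambda>g. bb_tensor n (bvec (idem1 i m, v)) g \<boxtimes> bvec m'"
  have step: "(\<Sum>k\<in>A. diff_at ?y [] w [] k) \<in> path_space True n \<and>
      ?\<Lambda> (\<Sum>k\<in>A. diff_at ?y [] w [] k) =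
      evm m (\<Sum>k\<in>A. case w ! k of CC i \<Rightarrow> bvec (v, w[k := UU i], m') | _ \<Rightarrow> 0)"
    if "finite A" "A \<subseteq> {..<length w}" for A
    using that
  proof (induction A rule: finite_induct)
    case empty
    then show ?case using vd by simp
  next
    case (insert k A)
    have k: "k < length w" using insert by simp
    have one: "diff_at ?y [] w [] k \<in> path_space True n \<and>
        ?\<Lambda> (diff_at ?y [] w [] k) = evm m (case w ! k of CC i \<Rightarrow> bvec (v, w[k := UU i], m') | _ \<Rightarrow> 0) \<and>
        (case w ! k of CC i \<Rightarrow> bvec (v, w[k := UU i], m') | _ \<Rightarrow> 0) \<in> WS m"
    proof (cases "w ! k")
      case (CC c)
      have "(v, w[k := UU c], m') \<in> valid m"
        using vd CC_replace[OF k CC] by (intro validI) simp_all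
      then show ?thesis
        using CC_replace(2)[OF k CC vd(4)] by (simp add: CC evm_bvec) (simp add: ev_def coeff_def)
    qed (use vd in simp_all)
    have rest: "(\<Sum>k\<in>A. case w ! k of CC i \<Rightarrow> bvec (v, w[k := UU i], m') | _ \<Rightarrow> 0) \<in> WS m"
      using insert by (intro WS_sum diff_term_WS[OF t]) auto
    show ?case
      using insert one rest vd
      by (simp add: bb_add_right tens_add_left evm_add keys_add_subset)
  qed
  have "diff (BB n) (coeff m v w) = bb_tensor n (bvec (idem1 i m, v)) (\<Sum>k<length w. diff_at ?y [] w [] k)"
    unfolding coeff_def using vd by (simp add: bb_diff path_diff_simp)
  then show ?thesis
    using step[of "{..<length w}"] by (simp add: term_diff_def)
qed

lemma act_coeff:
  assumes t: "(v, w, m') \<in> valid m" and f: "f \<in> WS m'"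
  shows "coeff m v w \<odot>\<^bsub>T\<^esub> evm m' f = evm m (prefix v w f)"
proof -
  have c: "coeff m v w \<in> carrier (BB n)" by (rule coeff_closed[OF t])
  have "Poly_Mapping.keys f \<subseteq> valid m'" using f by simp
  then show ?thesis
  proof (induction f rule: bit_poly_induct)
    case zero
    then show ?case using c by (simp add: act_zero)
  next
    case (bvec u)
    obtain v' w' m'' where u: "u = (v', w', m'')" by (cases u)
    have vu: "(v', w', m'') \<in> valid m'" using bvec u by simp
    show ?case
      using valid_append[OF t vu] coeff_mult[OF t vu] validD(1)[OF vu] c coeff_closed[OF vu]
      by (simp add: u evm_bvec[OF vu] evm_bvec ev_def act_tens)
  next
    case (add f g)
    then show ?case
      using c prefix_WS[OF t, of f] prefix_WS[OF t, of g] evm_closed[of f m'] evm_closed[of g m']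
      by (simp add: prefix_add evm_add act_add_right)
  qed
qed

text \<open>The kernel of evaluation. From here on the relations of the two algebras are used only
  as statements that certain sums lie in it.\<close>

definition Null :: "basis_elem \<Rightarrow> (wterm \<Rightarrow>\<^sub>0 bit) set"
  where "Null m = {f \<in> WS m. evm m f = \<zero>\<^bsub>tensor_group K (BB n) M\<^esub>}"

text \<open>Both sides are additive in f. On a single triple the claim is
  \<open>curvature_tens\<close>, with the differential of the coefficient given by
  \<open>diff_coeff\<close> and its action by \<open>act_coeff\<close>.\<close>

lemma curvature_evm:
  assumes "f \<in> WS m"
  shows "lin term_diff f + compose f Dw \<in> WS m \<and> TD.curvature (evm m f) = evm m (lin term_diff f + compose f Dw)"
proof -
  have "Poly_Mapping.keys f \<subseteq> valid m" using assms by simp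
  then show ?thesis
  proof (induction f rule: bit_poly_induct)
    case zero
    have "TD.curvature \<zero>\<^bsub>T\<^esub> = \<zero>\<^bsub>T\<^esub>"
      using TD.curvature_add[of "\<zero>\<^bsub>T\<^esub>" "\<zero>\<^bsub>T\<^esub>"] TD.curvature_closed[of "\<zero>\<^bsub>T\<^esub>"] by simp
    then show ?case by simp
  next
    case (bvec t)
    obtain v w m' where t: "t = (v, w, m')" by (cases t)
    have vt: "(v, w, m') \<in> valid m" using bvec t by simp
    have m': "m' \<in> X_basis n i" by (rule validD(1)[OF vt])
    have D: "term_diff (v, w, m') \<in> WS m" "prefix v w (Dw m') \<in> WS m"
      using term_diff_WS[OF vt] prefix_WS[OF vt Dw_WS[OF m']] by simp_all
    have "TD.curvature (coeff m v w \<boxtimes> bvec m') =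
        (diff (BB n) (coeff m v w) \<boxtimes> bvec m') \<oplus>\<^bsub>T\<^esub> (coeff m v w \<odot>\<^bsub>T\<^esub> X_delta n i (bvec m'))"
      using coeff_closed[OF vt] m' by (intro TD.curvature_tens) simp_all
    then show ?case
      using D act_coeff[OF vt Dw_WS[OF m']] diff_coeff[OF vt] WS_add[OF D]
      by (simp add: t evm_bvec[OF vt] ev_def X_delta_bvec[OF m'] evm_add)
  next
    case (add f g)
    have "lin term_diff (f + g) + compose (f + g) Dw =
        (lin term_diff f + compose f Dw) + (lin term_diff g + compose g Dw)"
      by (simp add: lin_add compose_add_left add_ac)
    then show ?case
      using add TD.curvature_add[of "evm m f" "evm m g"] evm_closed[of f m] evm_closed[of g m]
        WS_add[of "lin term_diff f + compose f Dw" m "lin term_diff g + compose g Dw"]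
        evm_add[of "lin term_diff f + compose f Dw" m "lin term_diff g + compose g Dw"]
      by (simp add: evm_add)
  qed
qed

subsection \<open>Homogeneity\<close>

abbreviation word_degree :: "bool \<Rightarrow> label list \<Rightarrow> bidegree"
  where "word_degree s w \<equiv> sum_list (map (label_degree s) w)"

definition homogeneous :: "basis_elem \<Rightarrow> wterm \<Rightarrow> bool"
  where "homogeneous m = (\<lambda>(v, w, m'). word_degree False v + word_degree True w + deg m' = deg m + (1, 0))"

lemma delta_loc_degree:
  assumes "(v, w, g') \<in> delta_loc g"
  shows "word_degree False (map (shift_label i) v) + word_degree True (map (shift_label i) w) +
    kind_degree i (gen_kind g') = kind_degree i (gen_kind g) + (1, 0)"
  using assms by (cases g; simp; elim disjE conjE; simp add: zero_prod_def)

lemma tensor_homogI: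
  assumes t: "(v, w, m') \<in> valid m" and h: "homogeneous m (v, w, m')"
  shows "ev m (v, w, m') \<in> tensor_homog K (BB n) M (X_grading n i) (deg m + (1, 0))"
proof -
  note vd = validD[OF t]
  have 1: "quiver_class False n (bvec (idem1 i m, v)) \<in> homog (Balg n) (word_degree False v)"
    unfolding homog_quiver_dga using vd by (intro QR.gspan_incl) (auto simp: path_degree_def)
  have 2: "quiver_class True n (bvec (idem2 n i m, w)) \<in> homog (Bshriek n) (word_degree True w)"
    unfolding homog_quiver_dga using vd by (intro QR.gspan_incl) (auto simp: path_degree_def)
  have 3: "coeff m v w \<in> homog (BB n) (word_degree False v + word_degree True w)"
    unfolding coeff_def bb_tensor_def BB_def homog_tensor_dga
    using 1 2 by (intro DG.T.gspan_incl) blast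
  have 4: "bvec m' \<in> X_grading n i (deg m')"
    using vd(1) by (simp add: X_grading_def)
  show ?thesis
    unfolding tensor_homog_def ev_def prod.case
    by (rule T.gspan_incl, intro CollectI exI conjI, rule refl, rule 3, rule 4)
      (use h in \<open>simp add: homogeneous_def\<close>)
qed

lemma V_homogeneous: "deg (flip i j m) = deg m"
  by (simp add: flip_def flip_kind split: prod.split)

text \<open>U_j \<otimes> C_j, R_j \<otimes> L_j and L_j \<otimes> R_j have homological degree 1 and
  Alexander degree 0, and a move keeps the type and so the degree of the basis element. The local
  terms are checked entry by entry.\<close>

lemma Dw_homogeneous:
  assumes m: "m \<in> X_basis n i"
  shows "\<forall>t\<in>Poly_Mapping.keys (Dw m). homogeneous m t"
proof -
  let ?H = "{t. homogeneous m t}"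
  have "Poly_Mapping.keys (Lw m) \<subseteq> ?H"
    unfolding Lw_def
  proof (rule keys_sum_subset)
    fix t assume "t \<in> delta_loc (snd m)"
    then show "Poly_Mapping.keys (bvec (lift_term m t) :: wterm \<Rightarrow>\<^sub>0 bit) \<subseteq> ?H"
      using delta_loc_degree by (cases t) (simp add: lift_term_def homogeneous_def)
  qed
  moreover have "Poly_Mapping.keys (Uw j m + Vw j m) \<subseteq> ?H" for j
    by (rule keys_add_subset) (simp_all add: Uw_def Vw_def homogeneous_def V_homogeneous)
  ultimately show ?thesis
    unfolding Dw_def using keys_add_subset keys_sum_subset by (metis (no_types, lifting) mem_Collect_eq subsetD)
qed

lemma X_delta_homog:
  assumes f: "f \<in> X_grading n i (h, a)"
  shows "X_delta n i f \<in> tensor_homog K (BB n) M (X_grading n i) (h + 1, a)"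
proof -
  let ?G = "{mod_tensor K (BB n) M b x | b x. \<exists>d\<^sub>1 d\<^sub>2. b \<in> homog (BB n) d\<^sub>1 \<and> x \<in> X_grading n i d\<^sub>2 \<and> d\<^sub>1 + d\<^sub>2 = (h + 1, a)}"
  have add: "X \<oplus>\<^bsub>T\<^esub> Y \<in> tensor_homog K (BB n) M (X_grading n i) (h + 1, a)"
    if "X \<in> tensor_homog K (BB n) M (X_grading n i) (h + 1, a)"
      "Y \<in> tensor_homog K (BB n) M (X_grading n i) (h + 1, a)" for X Y
    using that unfolding tensor_homog_def by (rule T.gspan_add)
  have zero: "\<zero>\<^bsub>T\<^esub> \<in> tensor_homog K (BB n) M (X_grading n i) (h + 1, a)"
    unfolding tensor_homog_def by (rule T.gspan_zero)
  have basis: "evm m g \<in> tensor_homog K (BB n) M (X_grading n i) (h + 1, a)"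
    if m: "m \<in> X_basis n i" "deg m = (h, a)" and g: "Poly_Mapping.keys g \<subseteq> {t \<in> valid m. homogeneous m t}" for m g
    using g
  proof (induction g rule: bit_poly_induct)
    case zero
    then show ?case using \<open>\<zero>\<^bsub>T\<^esub> \<in> _\<close> by simp
  next
    case (bvec t)
    then show ?case
      using tensor_homogI[of "fst t" "fst (snd t)" "snd (snd t)" m] m(2) by (simp add: evm_bvec)
  next
    case (add f g)
    then have "f \<in> WS m" "g \<in> WS m" by blast+
    then show ?case using add.IH \<open>\<And>Y X. _ \<Longrightarrow> _ \<Longrightarrow> X \<oplus>\<^bsub>T\<^esub> Y \<in> _\<close> by (simp add: evm_add)
  qed
  have "Poly_Mapping.keys f \<subseteq> {m \<in> X_basis n i. deg m = (h, a)}"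
    using f by (simp add: X_grading_def)
  then show ?thesis
  proof (induction f rule: bit_poly_induct)
    case zero
    then show ?case using \<open>\<zero>\<^bsub>T\<^esub> \<in> _\<close> by (simp add: X_delta_zero)
  next
    case (bvec m)
    then show ?case
      using basis[of m "Dw m"] Dw_WS[of m] Dw_homogeneous[of m] by (auto simp: X_delta_bvec)
  next
    case (add f g)
    then have "f \<in> carrier M" "g \<in> carrier M" by auto
    then show ?case using add.IH \<open>\<And>Y X. _ \<Longrightarrow> _ \<Longrightarrow> X \<oplus>\<^bsub>T\<^esub> Y \<in> _\<close> by (simp add: X_delta_add)
  qed
qed

lemma DD_bimoduleI:
  assumes "\<And>m. m \<in> X_basis n i \<Longrightarrow> lin term_diff (Dw m) + compose (Dw m) Dw \<in> Null m"
  shows "DD_bimodule n M (X_grading n i) (X_delta n i)"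
  unfolding DD_bimodule_def
proof (rule TD.type_D_structureI[OF M_graded])
  show "X_delta n i x \<in> tensor_homog K (BB n) M (X_grading n i) (h + 1, a)"
    if "x \<in> X_grading n i (h, a)" for h a x
    using that by (rule X_delta_homog)
  show "TD.curvature (X_delta n i f) = \<zero>\<^bsub>T\<^esub>" if f: "f \<in> carrier M" for f
  proof -
    have "Poly_Mapping.keys f \<subseteq> X_basis n i" using f by simp
    then show ?thesis
    proof (induction f rule: bit_poly_induct)
      case zero
      have "TD.curvature \<zero>\<^bsub>T\<^esub> = \<zero>\<^bsub>T\<^esub>"
        using TD.curvature_add[of "\<zero>\<^bsub>T\<^esub>" "\<zero>\<^bsub>T\<^esub>"] TD.curvature_closed[of "\<zero>\<^bsub>T\<^esub>"] by simp
      then show ?case by (simp add: X_delta_zero)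
    next
      case (bvec m)
      then show ?case
        using assms[OF bvec] curvature_evm[OF Dw_WS[OF bvec]] by (simp add: X_delta_bvec Null_def)
    next
      case (add f g)
      then show ?case
        using TD.curvature_add[of "X_delta n i f" "X_delta n i g"] X_delta_closed[of f] X_delta_closed[of g]
        by (simp add: X_delta_add)
    qed
  qed
qed

end

section \<open>Normal forms of words\<close>

fun clash :: "label \<Rightarrow> label \<Rightarrow> bool" where
  "clash (RR i) (RR j) \<longleftrightarrow> j = Suc i"
| "clash (LL i) (LL j) \<longleftrightarrow> i = Suc j"
| "clash _ _ \<longleftrightarrow> False"

fun inverse_labels :: "label \<Rightarrow> label \<Rightarrow> bool" where
  "inverse_labels (RR i) (LL j) \<longleftrightarrow> i = j"
| "inverse_labels (LL i) (RR j) \<longleftrightarrow> i = j"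
| "inverse_labels _ _ \<longleftrightarrow> False"

text \<open>The same condition as \<open>commuting\<close>, phrased with natural numbers so that it
  can be evaluated.\<close>

definition comm_labels :: "label \<Rightarrow> label \<Rightarrow> bool"
  where "comm_labels a b \<longleftrightarrow> is_UU a \<or> is_UU b \<or> is_CC a \<or> is_CC b \<or> idx a > Suc (idx b) \<or> idx b > Suc (idx a)"

text \<open>All letters that commutations can bring to the front of the word, each with the word
  that is left behind.\<close>

fun pulls :: "label list \<Rightarrow> (label \<times> label list) list" where
  "pulls [] = []"
| "pulls (a # w) = (a, w) # map (\<lambda>(b, r). (b, a # r)) (filter (\<lambda>(b, r). comm_labels a b) (pulls w))"

text \<open>The new letter a meets every letter that can be pulled next to it: a clash gives zero,
  an inverse gives U. Failing that, a is moved past a commuting head, because a letter further on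
  may be within reach of a although it cannot itself pass that head.\<close>

fun push :: "label \<Rightarrow> label list \<Rightarrow> label list option" where
  "push a w = (if \<exists>p\<in>set (pulls w). clash a (fst p) then None
    else case find (\<lambda>p. inverse_labels a (fst p)) (pulls w) of
      Some p \<Rightarrow> Some (UU (idx a) # snd p)
    | None \<Rightarrow> (case w of [] \<Rightarrow> Some [a]
        | b # r \<Rightarrow> if comm_labels a b then map_option ((#) b) (push a r) else Some (a # w)))"

declare push.simps [simp del]

fun reduce :: "label list \<Rightarrow> label list option" where
  "reduce [] = Some []"
| "reduce (a # w) = Option.bind (reduce w) (push a)"

text \<open>Loops U come first, then C, then the arrows that change the vertex. The offsets 10 and
  20 exceed the label indices 1 to 4 of the tables, so the blocks do not overlap.\<close>

fun sort_key :: "label \<Rightarrow> nat" where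
  "sort_key (UU i) = i"
| "sort_key (CC i) = 10 + i"
| "sort_key (RR i) = 20 + i"
| "sort_key (LL i) = 20 + i"

fun insert_label :: "label \<Rightarrow> label list \<Rightarrow> label list" where
  "insert_label a [] = [a]"
| "insert_label a (b # r) = (if comm_labels a b \<and> sort_key b < sort_key a then b # insert_label a r else a # b # r)"

text \<open>N lists vertices known to be absent from the source. Loops commute with everything, so
  their mere occurrence counts. Besides U_k with k - 1 and k absent and a repeated C_k, the product
  of U_k and U_(k+1) with k - 1 and k + 1 absent is recognised; see \<open>wzero_UU_UU\<close>. The
  condition that k is not 0 keeps k - 1 from being truncated.\<close>

definition dead :: "nat list \<Rightarrow> label list \<Rightarrow> bool"
  where "dead N w \<longleftrightarrow> (\<exists>a\<in>set w. case a of
      UU k \<Rightarrow> k \<noteq> 0 \<and> k - 1 \<in> set N \<and> (k \<in> set N \<or> Suc k \<in> set N \<and> UU (Suc k) \<in> set w)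
    | CC k \<Rightarrow> CC k \<in> set (remove1 (CC k) w)
    | _ \<Rightarrow> False)"

text \<open>After R_j the vertex j - 1 is empty and j is occupied; after L_j it is the other way
  round. For index 0 the empty list claims nothing.\<close>

fun absent_after :: "nat list \<Rightarrow> label \<Rightarrow> nat list" where
  "absent_after N (RR j) = (if j = 0 then [] else (j - 1) # filter (\<lambda>k. k \<noteq> j) N)"
| "absent_after N (LL j) = (if j = 0 then [] else j # filter (\<lambda>k. k \<noteq> j - 1) N)"
| "absent_after N (UU j) = N"
| "absent_after N (CC j) = N"

text \<open>A loop may vanish only after it has been moved past an arrow, since other vertices are
  empty there. Each round pulls one arrow R or L to the front, steps along it and tests the rest;
  the number f bounds the rounds, and \<open>normalize\<close> sets it to the length of the
  word.\<close>

fun vanishes :: "nat \<Rightarrow> nat list \<Rightarrow> label list \<Rightarrow> bool" where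
  "vanishes 0 N w \<longleftrightarrow> dead N w"
| "vanishes (Suc f) N w \<longleftrightarrow> dead N w \<or>
    (\<exists>p\<in>set (pulls w). \<not> is_UU (fst p) \<and> \<not> is_CC (fst p) \<and> vanishes f (absent_after N (fst p)) (snd p))"

text \<open>\<open>None\<close> stands for a word that is zero. Reduction and sorting are valid at
  every source, while the last test uses what N says about the source.\<close>

definition normalize :: "nat list \<Rightarrow> label list \<Rightarrow> label list option"
  where "normalize N w = Option.bind (reduce w) (\<lambda>r.
    let r' = foldr insert_label r [] in if vanishes (length r') N r' then None else Some r')"

type_synonym lterm = "label list \<times> label list \<times> xgen"

definition normalize_term :: "nat list \<Rightarrow> nat list \<Rightarrow> lterm \<Rightarrow> lterm option"
  where "normalize_term N N' = (\<lambda>(v, w, g).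
    Option.bind (normalize N v) (\<lambda>v'. Option.bind (normalize N' w) (\<lambda>w'. Some (v', w', g))))"

text \<open>The terms that occur an odd number of times: a further occurrence deletes an earlier
  one, as in characteristic two, and \<open>None\<close> counts as zero.\<close>

fun leftover :: "'a option list \<Rightarrow> 'a list" where
  "leftover [] = []"
| "leftover (None # ts) = leftover ts"
| "leftover (Some t # ts) = (if t \<in> set (leftover ts) then remove1 t (leftover ts) else t # leftover ts)"

abbreviation cancels :: "'a option list \<Rightarrow> bool"
  where "cancels ts \<equiv> leftover ts = []"

text \<open>The table of \<open>delta_loc\<close> as lists, with all indices raised by one to make room for the
  neighbouring labels \<open>1\<close> and \<open>4\<close>.\<close>

fun loc_terms :: "xgen \<Rightarrow> lterm list" where
  "loc_terms Z1 = []"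
| "loc_terms Z2 = []"
| "loc_terms Z3 = [([], [], Z2)]"
| "loc_terms Z4 = []"
| "loc_terms X1 = [([RR 2], [LL 2, LL 3], X6), ([RR 2], [UU 2, CC 3], X7),
      ([UU 2], [UU 2, CC 3], X8)]"
| "loc_terms X2 = [([LL 3], [RR 3, RR 2], X3), ([LL 3], [CC 2, UU 3], X10)]"
| "loc_terms X3 = [([LL 2], [], X1), ([], [LL 2, LL 3], X10), ([LL 2], [UU 2, CC 3], X11)]"
| "loc_terms X4 = []"
| "loc_terms X5 = [([UU 3], [], X2), ([LL 3], [RR 3, RR 2], X7), ([UU 3], [CC 2, UU 3], X12)]"
| "loc_terms X6 = [([RR 3], [], X2), ([], [RR 3, RR 2], X7), ([LL 2], [RR 3, RR 2], X8),
      ([RR 3], [CC 2, UU 3], X12)]"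
| "loc_terms X7 = [([UU 3], [], X3), ([LL 2], [], X4), ([RR 3], [LL 2, LL 3], X12)]"
| "loc_terms X8 = [([], [], X4)]"
| "loc_terms X9 = [([], [], X5), ([LL 3], [], X6)]"
| "loc_terms X10 = [([UU 2], [], X6), ([LL 2], [RR 3, RR 2], X11)]"
| "loc_terms X11 = [([RR 2], [], X7), ([UU 2], [], X8)]"
| "loc_terms X12 = [([LL 3], [], X10)]"
| "loc_terms Y1 = [([RR 2, UU 3], [CC 2, CC 3], Y2), ([LL 3, UU 2], [CC 2, CC 3], Y4),
      ([RR 2], [UU 2, CC 3], Y5), ([UU 2], [UU 2, CC 3], Y6),
      ([LL 3], [CC 2, UU 3], Y7)]"
| "loc_terms Y2 = [([LL 2], [], Y1), ([LL 2, LL 3], [CC 2, CC 3], Y7),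
      ([LL 2], [UU 2, CC 3], Y8)]"
| "loc_terms Y3 = [([UU 3], [], Y1), ([RR 2, UU 3], [CC 2, CC 3], Y5),
      ([UU 2, UU 3], [CC 2, CC 3], Y6), ([UU 3], [CC 2, UU 3], Y8)]"
| "loc_terms Y4 = [([RR 3], [], Y1), ([RR 3, RR 2], [CC 2, CC 3], Y5),
      ([RR 3, UU 2], [CC 2, CC 3], Y6), ([RR 3], [CC 2, UU 3], Y8)]"
| "loc_terms Y5 = [([UU 3], [], Y2), ([LL 2], [], Y3), ([LL 2, UU 3], [CC 2, CC 3], Y8)]"
| "loc_terms Y6 = [([], [], Y3), ([LL 3], [], Y4)]"
| "loc_terms Y7 = [([RR 3, RR 2], [], Y2), ([UU 2], [], Y4), ([RR 3, UU 2], [CC 2, CC 3], Y8)]"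
| "loc_terms Y8 = [([RR 2], [], Y5), ([UU 2], [], Y6), ([LL 3], [], Y7)]"

section \<open>Finite lists of the terms that have to cancel\<close>

definition diff_terms :: "lterm \<Rightarrow> lterm list"
  where "diff_terms = (\<lambda>(v, w, g). concat (map (\<lambda>k. case w ! k of CC c \<Rightarrow> [(v, w[k := UU c], g)] | _ \<Rightarrow> []) [0..<length w]))"

definition prepend :: "label list \<Rightarrow> label list \<Rightarrow> lterm list \<Rightarrow> lterm list"
  where "prepend v w = map (\<lambda>(v', w', g). (v @ v', w @ w', g))"

definition local_square :: "xgen \<Rightarrow> lterm list"
  where "local_square g = concat (map diff_terms (loc_terms g)) @
    concat (map (\<lambda>(v, w, h). prepend v w (loc_terms h)) (loc_terms g))"

text \<open>The move at i - 1, with label 1 in the tables. The flag e tells whether the vertex i - 2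
  belongs to the external state, and so to the first idempotent rather than the second.\<close>

definition move_left :: "bool \<Rightarrow> xgen \<Rightarrow> lterm list"
  where "move_left e g =
    (if e \<and> 0 \<notin> gen_idem1 g \<and> 0 \<in> gen_idem2 g then [([RR 1], [LL 1], flip0 g)]
     else if \<not> e \<and> 0 \<in> gen_idem1 g \<and> 0 \<notin> gen_idem2 g then [([LL 1], [RR 1], flip0 g)] else [])"

text \<open>The move at i + 2, with label 4 in the tables. Here e tells whether the vertex i + 2
  belongs to the external state.\<close>

definition move_right :: "bool \<Rightarrow> xgen \<Rightarrow> lterm list"
  where "move_right e g =
    (if \<not> e \<and> 2 \<in> gen_idem1 g \<and> 2 \<notin> gen_idem2 g then [([RR 4], [LL 4], flip2 g)]
     else if e \<and> 2 \<notin> gen_idem1 g \<and> 2 \<in> gen_idem2 g then [([LL 4], [RR 4], flip2 g)] else [])"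

definition cross_terms :: "(xgen \<Rightarrow> lterm list) \<Rightarrow> xgen \<Rightarrow> lterm list"
  where "cross_terms mv g = concat (map (\<lambda>(v, w, h). prepend v w (mv h)) (loc_terms g)) @
    concat (map (\<lambda>(v, w, h). prepend v w (loc_terms h)) (mv g))"

text \<open>In table coordinates the vertex k stands for k + i - 2. So the local vertices 0, 1, 2
  appear as 1, 2, 3, between the external neighbours 0 and 4.\<close>

definition absent_local :: "nat set \<Rightarrow> nat list"
  where "absent_local a = map Suc (filter (\<lambda>k. k \<notin> a) [0, 1, 2])"

text \<open>The structure equation of the local bimodule, generator by generator, with the terms
  from \<partial>(C_k) = U_k included.\<close>

lemma local_square_cancels:
  "cancels (map (normalize_term (absent_local (gen_idem1 g)) (absent_local (gen_idem2 g))) (local_square g))"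
  by (induct g; code_simp)

text \<open>The local differential commutes with the move at i - 1, for both positions of the vertex
  i - 2. That vertex, written 0, is absent from exactly one of the two idempotents, which some of
  the cancellations may use.\<close>

lemma cross_left_cancels:
  "cancels (map (normalize_term ((if e then [] else [0]) @ absent_local (gen_idem1 g))
    ((if e then [0] else []) @ absent_local (gen_idem2 g))) (cross_terms (move_left e) g))"
  by (induct e; induct g; code_simp)

text \<open>The same on the other side, with the vertex i + 2 written as 4.\<close>

lemma cross_right_cancels:
  "cancels (map (normalize_term ((if e then [] else [4]) @ absent_local (gen_idem1 g))
    ((if e then [4] else []) @ absent_local (gen_idem2 g))) (cross_terms (move_right e) g))"
  by (induct e; induct g; code_simp)

section \<open>Relations between words\<close>

text \<open>Equality, respectively vanishing, in the quiver algebra of the path with source \<open>X\<close> that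
  spells a given word; void if there is no such path.\<close>

definition weq :: "bool \<Rightarrow> nat \<Rightarrow> nat set \<Rightarrow> label list \<Rightarrow> label list \<Rightarrow> bool"
  where "weq s n X u v \<longleftrightarrow> ((X, u) \<in> paths s n \<longrightarrow> (X, v) \<in> paths s n \<and> target X u = target X v \<and>
    bvec (X, u) + bvec (X, v) \<in> rel_ideal s n)"

definition wzero :: "bool \<Rightarrow> nat \<Rightarrow> nat set \<Rightarrow> label list \<Rightarrow> bool"
  where "wzero s n X u \<longleftrightarrow> ((X, u) \<in> paths s n \<longrightarrow> bvec (X, u) \<in> rel_ideal s n)"

lemma weq_refl [simp]: "weq s n X u u"
  by (simp add: weq_def rel_ideal_zero)

lemma weq_trans:
  assumes "weq s n X u v" "weq s n X v w" shows "weq s n X u w"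
proof -
  have "bvec (X, u) + bvec (X, w) = (bvec (X, u) + bvec (X, v)) + (bvec (X, v) + bvec (X, w) :: path \<Rightarrow>\<^sub>0 bit)"
    by (simp add: add_ac)
  then show ?thesis
    using assms rel_ideal_add unfolding weq_def by metis
qed

lemma weq_wzero:
  assumes "weq s n X u v" "wzero s n X v" shows "wzero s n X u"
proof -
  have "bvec (X, u) = (bvec (X, u) + bvec (X, v)) + (bvec (X, v) :: path \<Rightarrow>\<^sub>0 bit)"
    by (simp add: add_ac)
  then show ?thesis
    using assms rel_ideal_add unfolding weq_def wzero_def by metis
qed

text \<open>The ideal of relations is two-sided, so a congruence of words survives multiplication by
  the prefix p and the suffix q.\<close>

lemma weq_context:
  assumes "weq s n (target X p) u v" shows "weq s n X (p @ u @ q) (p @ v @ q)"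
  unfolding weq_def
proof (intro impI)
  assume P: "(X, p @ u @ q) \<in> paths s n"
  let ?Y = "target X p"
  have p: "(X, p) \<in> paths s n" and u: "(?Y, u) \<in> paths s n" and q: "(target ?Y u, q) \<in> paths s n"
    using P by (simp_all add: paths_append)
  have v: "(?Y, v) \<in> paths s n" "target ?Y u = target ?Y v" "bvec (?Y, u) + bvec (?Y, v) \<in> rel_ideal s n"
    using assms u by (simp_all add: weq_def)
  have "bvec (X, p) \<star> ((bvec (?Y, u) + bvec (?Y, v)) \<star> bvec (target ?Y u, q)) \<in> rel_ideal s n"
    using p q v(3) by (intro rel_ideal_mult) simp_all
  then have "bvec (X, p @ u @ q) + bvec (X, p @ v @ q) \<in> rel_ideal s n"
    using v(2) by (simp add: bilinear_ext_add_left bilinear_ext_add_right path_mult_simp)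
  then show "(X, p @ v @ q) \<in> paths s n \<and> target X (p @ u @ q) = target X (p @ v @ q) \<and>
      bvec (X, p @ u @ q) + bvec (X, p @ v @ q) \<in> rel_ideal s n"
    using p q v by (simp add: paths_append)
qed

lemma weq_Cons: "(\<And>Y. weq s n Y u v) \<Longrightarrow> weq s n X (a # u) (a # v)"
  using weq_context[of s n X "[a]" u v "[]"] by simp

lemma wzero_context:
  assumes "wzero s n (target X p) u" shows "wzero s n X (p @ u @ q)"
  unfolding wzero_def
proof (intro impI)
  assume P: "(X, p @ u @ q) \<in> paths s n"
  let ?Y = "target X p"
  have p: "(X, p) \<in> paths s n" and u: "(?Y, u) \<in> paths s n" and q: "(target ?Y u, q) \<in> paths s n"
    using P by (simp_all add: paths_append)
  have "bvec (X, p) \<star> (bvec (?Y, u) \<star> bvec (target ?Y u, q)) \<in> rel_ideal s n"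
    using p q u assms by (intro rel_ideal_mult) (simp_all add: wzero_def)
  then show "bvec (X, p @ u @ q) \<in> rel_ideal s n"
    by (simp add: path_mult_simp)
qed

lemma labels_idx: "(X, u) \<in> paths s n \<Longrightarrow> l \<in> set u \<Longrightarrow> 1 \<le> idx l"
  by (auto simp: mem_paths labels_def)

lemma weqI_rel:
  assumes "(X, u) \<in> paths s n \<Longrightarrow> (X, v) \<in> paths s n \<and> target X u = target X v \<and>
    bvec (X, u) + bvec (X, v) \<in> relations s n"
  shows "weq s n X u v"
  using assms relations_rel_ideal unfolding weq_def by blast

text \<open>Indices at distance greater than one involve disjoint pairs of vertices, and loops move
  nothing. Hence one order of the letters is a path whenever the other is, which the commutation
  relations require.\<close>

lemma commuting_arrows:
  assumes "commuting a b" "1 \<le> idx a" "1 \<le> idx b"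
  shows "composable X [a, b] \<Longrightarrow> composable X [b, a]" and "target X [a, b] = target X [b, a]"
proof -
  have ne: "idx a \<noteq> idx b \<and> idx a - 1 \<noteq> idx b \<and> idx b - 1 \<noteq> idx a \<and> idx a - 1 \<noteq> idx b - 1"
    if "\<not> is_UU a" "\<not> is_UU b" "\<not> is_CC a" "\<not> is_CC b"
    using assms that by (auto simp: commuting_def)
  show "composable X [a, b] \<Longrightarrow> composable X [b, a]"
    using ne assms(2,3)
    by (cases a; cases b) (simp_all add: has_arrow_iff del: has_arrow.simps(1,2))
  show "target X [a, b] = target X [b, a]"
    using ne by (cases a; cases b) (auto simp: set_eq_iff)
qed

lemma weq_swap:
  assumes "commuting a b" shows "weq s n X [a, b] [b, a]"
proof (rule weqI_rel)
  assume P: "(X, [a, b]) \<in> paths s n"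
  then have "1 \<le> idx a" "1 \<le> idx b" using labels_idx[OF P] by simp_all
  note c = commuting_arrows[OF assms this]
  have Q: "(X, [b, a]) \<in> paths s n"
    using P c(1) unfolding mem_paths by simp
  have "bvec (X, [a, b]) + bvec (X, [b, a]) \<in> relations s n"
    using P Q assms unfolding relations_def by blast
  then show "(X, [b, a]) \<in> paths s n \<and> target X [a, b] = target X [b, a] \<and>
    bvec (X, [a, b]) + bvec (X, [b, a]) \<in> relations s n"
    using Q c(2) by blast
qed

lemma weq_inverse:
  assumes "inverse_labels a b" shows "weq s n X [a, b] [UU (idx a)]"
proof (rule weqI_rel)
  assume P: "(X, [a, b]) \<in> paths s n"
  have j: "1 \<le> idx a" using labels_idx[OF P] by simp
  obtain k where "a = RR k \<and> b = LL k \<or> a = LL k \<and> b = RR k"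
    using assms by (cases a; cases b) auto
  then show "(X, [UU (idx a)]) \<in> paths s n \<and> target X [a, b] = target X [UU (idx a)] \<and>
    bvec (X, [a, b]) + bvec (X, [UU (idx a)]) \<in> relations s n"
  proof (elim disjE conjE)
    assume e: "a = RR k" "b = LL k"
    have "k - 1 \<in> X" "k \<notin> X" using P j unfolding e mem_paths by (simp_all add: has_arrow_iff del: has_arrow.simps(1,2))
    then have "target X [a, b] = X" unfolding e by auto
    moreover have "bvec (X, [a, b]) + bvec (X, [UU (idx a)]) \<in> relations s n"
      using P unfolding e relations_def by auto
    ultimately show ?thesis using P unfolding e by (simp add: mem_paths labels_def)
  next
    assume e: "a = LL k" "b = RR k"
    have "k - 1 \<notin> X" "k \<in> X" using P j unfolding e mem_paths by (simp_all add: has_arrow_iff del: has_arrow.simps(1,2))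
    then have "target X [a, b] = X" unfolding e by auto
    moreover have "bvec (X, [a, b]) + bvec (X, [UU (idx a)]) \<in> relations s n"
      using P unfolding e relations_def by auto
    ultimately show ?thesis using P unfolding e by (simp add: mem_paths labels_def)
  qed
qed

lemma wzeroI_rel: "((X, u) \<in> paths s n \<Longrightarrow> bvec (X, u) \<in> relations s n) \<Longrightarrow> wzero s n X u"
  using relations_rel_ideal unfolding wzero_def by blast

lemma wzero_clash:
  assumes "clash a b" shows "wzero s n X [a, b]"
proof (rule wzeroI_rel)
  assume P: "(X, [a, b]) \<in> paths s n"
  obtain k where "a = RR k \<and> b = RR (k + 1) \<or> a = LL (Suc k) \<and> b = LL (Suc k - 1)"
    using assms by (cases a; cases b) auto
  then show "bvec (X, [a, b]) \<in> relations s n"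
    using P unfolding relations_def by blast
qed

lemma wzero_CC: "wzero s n X [CC k, CC k]"
  by (rule wzeroI_rel) (unfold relations_def, blast)

lemma wzero_UU: "k - 1 \<notin> X \<Longrightarrow> k \<notin> X \<Longrightarrow> wzero s n X [UU k]"
proof (rule wzeroI_rel)
  assume "(X, [UU k]) \<in> paths s n" "k - 1 \<notin> X" "k \<notin> X"
  moreover from this have "X \<inter> {k - 1, k} = {}" by simp
  ultimately show "bvec (X, [UU k]) \<in> relations s n" unfolding relations_def by blast
qed

text \<open>If k is empty, U_k already vanishes. If k is occupied, then U_k = L_k R_k and U_(k+1) =
  R_(k+1) L_(k+1) at this vertex, and the product contains R_k R_(k+1) = 0.\<close>

lemma wzero_UU_UU:
  assumes "k - 1 \<notin> X" "Suc k \<notin> X" shows "wzero s n X [UU k, UU (Suc k)]"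
proof (cases "k \<in> X")
  case False
  then show ?thesis
    using wzero_context[of s n X "[]" "[UU k]" "[UU (Suc k)]"] wzero_UU[OF assms(1) False] by simp
next
  case True
  show ?thesis
  proof (cases "(X, [UU k, UU (Suc k)]) \<in> paths s n")
    case P: True
    then have k: "1 \<le> k" using labels_idx[OF P, of "UU k"] by simp
    have lab: "X \<subseteq> {0..n}" "set [UU k, UU (Suc k)] \<subseteq> labels s n" using P by (simp_all add: mem_paths)
    \<comment> \<open>Both detours start at k: one goes to the empty vertex k - 1 and the other to
      the empty vertex k + 1, so this word is a path.\<close>
    let ?w = "[LL k, RR k, RR (Suc k), LL (Suc k)]"
    have t: "target X [LL k, RR k] = X" using True assms(1) k by auto
    have "composable X [LL k, RR k]"
      using True assms(1) k by (simp add: has_arrow_iff del: has_arrow.simps(1,2))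
    moreover have "composable X [RR (Suc k), LL (Suc k)]"
      using True assms(2) by (simp add: has_arrow_iff del: has_arrow.simps(1,2))
    ultimately have "composable X ?w"
      using composable_append[of X "[LL k, RR k]" "[RR (Suc k), LL (Suc k)]"] unfolding t by simp
    then have W: "(X, ?w) \<in> paths s n"
      using lab unfolding mem_paths by (simp add: labels_def)
    have "wzero s n X ?w"
      using wzero_context[of s n X "[LL k]" "[RR k, RR (Suc k)]" "[LL (Suc k)]"] wzero_clash[of "RR k" "RR (Suc k)"]
      by simp
    moreover have "weq s n X ?w [UU k, RR (Suc k), LL (Suc k)]"
      using weq_context[of s n X "[]" "[LL k, RR k]" "[UU k]" "[RR (Suc k), LL (Suc k)]"] weq_inverse[of "LL k" "RR k"]
      by simp
    moreover have "weq s n X [UU k, RR (Suc k), LL (Suc k)] [UU k, UU (Suc k)]"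
      using weq_context[of s n X "[UU k]" "[RR (Suc k), LL (Suc k)]" "[UU (Suc k)]" "[]"] weq_inverse[of "RR (Suc k)" "LL (Suc k)"]
      by simp
    ultimately have q: "weq s n X ?w [UU k, UU (Suc k)]" and z: "bvec (X, ?w) \<in> rel_ideal s n"
      using weq_trans W unfolding wzero_def by blast+
    have "bvec (X, ?w) + bvec (X, [UU k, UU (Suc k)]) \<in> rel_ideal s n"
      using q W unfolding weq_def by blast
    from rel_ideal_add[OF z this] show ?thesis
      by (simp only: wzero_def bit_poly_add_self_left simp_thms)
  qed (simp add: wzero_def)
qed

lemma weq_move_front:
  "(\<And>b. b \<in> set u \<Longrightarrow> commuting b a) \<Longrightarrow> weq s n X (u @ [a]) (a # u)"
proof (induction u arbitrary: X)
  case (Cons b u)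
  have "weq s n X (b # (u @ [a])) (b # a # u)"
    using Cons by (intro weq_Cons) simp
  moreover have "weq s n X (b # a # u) (a # b # u)"
    using weq_context[of s n X "[]" "[b, a]" "[a, b]" u] weq_swap[of b a] Cons.prems by simp
  ultimately show ?case using weq_trans by simp
qed simp

section \<open>Soundness of the normal form\<close>

text \<open>The table indices 1, 2, 3, 4 become i - 1, i, i + 1, i + 2.\<close>

fun relabel :: "nat \<Rightarrow> label \<Rightarrow> label" where
  "relabel i (RR k) = RR (k + i - 2)"
| "relabel i (LL k) = LL (k + i - 2)"
| "relabel i (UU k) = UU (k + i - 2)"
| "relabel i (CC k) = CC (k + i - 2)"

lemma idx_relabel [simp]: "idx (relabel i l) = idx l + i - 2"
  by (cases l) simp_all

lemma relabel_kind [simp]: "is_UU (relabel i l) = is_UU l" "is_CC (relabel i l) = is_CC l"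
  by (cases l; simp)+

text \<open>Indices that become \<open>0\<close> do not occur in paths, so truncation in \<open>relabel\<close> does no harm.\<close>

locale relabeled =
  fixes s :: bool and n i :: nat
begin

abbreviation "g \<equiv> map (relabel i)"

abbreviation req :: "label list \<Rightarrow> label list \<Rightarrow> bool"
  where "req u v \<equiv> (\<forall>X. weq s n X (g u) (g v))"

lemma req_trans: "req u v \<Longrightarrow> req v w \<Longrightarrow> req u w"
  using weq_trans by blast

lemma req_context: "req u v \<Longrightarrow> req (p @ u @ q) (p @ v @ q)"
  using weq_context[of s n _ "g p" "g u" "g v" "g q"] by simp

lemma req_Cons: "req u v \<Longrightarrow> req (a # u) (a # v)"
  using req_context[of u v "[a]" "[]"] by simp

text \<open>The bound says that the relabelled index is at least 1, so the subtraction was not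
  truncated. A word violating it spells no path, and then the claim is void.\<close>

lemma weqI_idx:
  assumes "(\<And>l. l \<in> set u \<Longrightarrow> 3 \<le> idx l + i) \<Longrightarrow> weq s n X (g u) v" shows "weq s n X (g u) v"
proof (cases "(X, g u) \<in> paths s n")
  case True
  have "3 \<le> idx l + i" if "l \<in> set u" for l
    using labels_idx[OF True, of "relabel i l"] that by simp
  then show ?thesis by (rule assms)
qed (simp add: weq_def)

lemma wzeroI_idx:
  assumes "(\<And>l. l \<in> set u \<Longrightarrow> 3 \<le> idx l + i) \<Longrightarrow> wzero s n X (g u)" shows "wzero s n X (g u)"
proof (cases "(X, g u) \<in> paths s n")
  case True
  have "3 \<le> idx l + i" if "l \<in> set u" for l
    using labels_idx[OF True, of "relabel i l"] that by simp
  then show ?thesis by (rule assms)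
qed (simp add: wzero_def)

lemma req_swap: "comm_labels a b \<Longrightarrow> req [a, b] [b, a]"
proof
  fix X assume c: "comm_labels a b"
  show "weq s n X (g [a, b]) (g [b, a])"
  proof (rule weqI_idx)
    assume "\<And>l. l \<in> set [a, b] \<Longrightarrow> 3 \<le> idx l + i"
    then have "3 \<le> idx a + i" "3 \<le> idx b + i" by simp_all
    then have "commuting (relabel i a) (relabel i b)"
      using c unfolding comm_labels_def commuting_def by auto
    then show "weq s n X (g [a, b]) (g [b, a])" using weq_swap by simp
  qed
qed

lemma req_inverse:
  assumes "inverse_labels a b" shows "req [a, b] [UU (idx a)]"
proof
  fix X
  have "inverse_labels (relabel i a) (relabel i b)" using assms by (cases a; cases b) auto
  from weq_inverse[OF this, of s n X] show "weq s n X (g [a, b]) (g [UU (idx a)])" by simp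
qed

lemma zero_clash:
  assumes "clash a b" shows "wzero s n X (g [a, b])"
proof (rule wzeroI_idx)
  assume "\<And>l. l \<in> set [a, b] \<Longrightarrow> 3 \<le> idx l + i"
  then have "3 \<le> idx a + i" "3 \<le> idx b + i" by simp_all
  then have "clash (relabel i a) (relabel i b)" using assms by (cases a; cases b) auto
  then show "wzero s n X (g [a, b])" using wzero_clash by simp
qed

lemma pulls_sound: "(b, r) \<in> set (pulls w) \<Longrightarrow> req w (b # r)"
proof (induction w arbitrary: b r)
  case (Cons a w)
  show ?case
  proof (cases "(b, r) = (a, w)")
    case False
    then obtain r' where r': "(b, r') \<in> set (pulls w)" "comm_labels a b" "r = a # r'"
      using Cons.prems by auto
    have "req (a # w) (a # b # r')" using Cons.IH[OF r'(1)] by (rule req_Cons)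
    moreover have "req (a # b # r') (b # a # r')"
      using req_context[OF req_swap[OF r'(2)], of "[]" r'] by simp
    ultimately show ?thesis using req_trans r'(3) by blast
  qed simp
qed simp

lemma push_sound:
  "(push a w = None \<longrightarrow> (\<forall>X. wzero s n X (g (a # w)))) \<and> (\<forall>w'. push a w = Some w' \<longrightarrow> req (a # w) w')"
proof (induction w)
  case Nil
  then show ?case by (simp add: push.simps)
next
  case (Cons c w)
  let ?P = "pulls (c # w)"
  show ?case
  proof (cases "\<exists>p\<in>set ?P. clash a (fst p)")
    case True
    then obtain b r where p: "(b, r) \<in> set ?P" "clash a b" by (metis prod.collapse)
    have "req (a # c # w) (a # b # r)" using pulls_sound[OF p(1)] by (rule req_Cons)
    moreover have "wzero s n X (g (a # b # r))" for X
      using wzero_context[of s n X "[]" "g [a, b]" "g r"] zero_clash[OF p(2)] by simp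
    ultimately have "\<forall>X. wzero s n X (g (a # c # w))" using weq_wzero by blast
    moreover have "push a (c # w) = None" by (subst push.simps) (simp only: True if_True)
    ultimately show ?thesis by simp
  next
    case nc: False
    show ?thesis
    proof (cases "find (\<lambda>p. inverse_labels a (fst p)) ?P")
      case None
      then have e: "push a (c # w) = (if comm_labels a c then map_option ((#) c) (push a w) else Some (a # c # w))"
        by (subst push.simps) (simp only: nc None if_False option.case list.case)
      show ?thesis
      proof (cases "comm_labels a c")
        case True
        have sw: "req (a # c # w) (c # a # w)"
          using req_context[OF req_swap[OF True], of "[]" w] by simp
        show ?thesis
        proof (cases "push a w")
          case pn: None
          have "wzero s n X (g (c # a # w))" for X
            using wzero_context[of s n X "[relabel i c]" "g (a # w)" "[]"] Cons.IH pn by simp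
          then show ?thesis using sw weq_wzero e pn True by fastforce
        next
          case ps: (Some w')
          have "req (c # a # w) (c # w')" using Cons.IH ps by (intro req_Cons) blast
          then have "req (a # c # w) (c # w')" using sw req_trans by blast
          then show ?thesis using e ps True by simp
        qed
      qed (simp add: e)
    next
      case (Some p)
      obtain b r where p: "p = (b, r)" by (cases p)
      have "(b, r) \<in> set ?P" "inverse_labels a b"
        using Some unfolding find_Some_iff p by (metis fst_conv nth_mem)+
      have "req (a # c # w) (a # b # r)" using pulls_sound[OF \<open>(b, r) \<in> set ?P\<close>] by (rule req_Cons)
      moreover have "req (a # b # r) (UU (idx a) # r)"
        using req_context[OF req_inverse[OF \<open>inverse_labels a b\<close>], of "[]" r] by simp
      ultimately have "req (a # c # w) (UU (idx a) # r)" using req_trans by blast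
      moreover have "push a (c # w) = Some (UU (idx a) # r)"
        by (subst push.simps) (simp only: nc Some if_False option.case p snd_conv)
      ultimately show ?thesis by simp
    qed
  qed
qed

lemma reduce_sound:
  "(reduce w = None \<longrightarrow> (\<forall>X. wzero s n X (g w))) \<and> (\<forall>w'. reduce w = Some w' \<longrightarrow> req w w')"
proof (induction w)
  case (Cons a w)
  show ?case
  proof (cases "reduce w")
    case None
    have "wzero s n X (g (a # w))" for X
      using wzero_context[of s n X "[relabel i a]" "g w" "[]"] Cons.IH None by simp
    then show ?thesis using None by simp
  next
    case (Some r)
    have r: "req (a # w) (a # r)" using Cons.IH Some by (intro req_Cons) blast
    have "wzero s n X (g (a # w))" if "push a r = None" for X
      using push_sound[of a r] r weq_wzero that by blast
    moreover have "req (a # w) w'" if "push a r = Some w'" for w'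
      using push_sound[of a r] req_trans[OF r] that by blast
    ultimately show ?thesis using Some by simp
  qed
qed simp

lemma insert_label_sound: "req (a # w) (insert_label a w)"
proof (induction w)
  case (Cons b w)
  show ?case
  proof (cases "comm_labels a b \<and> sort_key b < sort_key a")
    case True
    have "req (a # b # w) (b # a # w)"
      using req_context[OF req_swap, of a b "[]" w] True by simp
    moreover have "req (b # a # w) (b # insert_label a w)"
      using Cons.IH by (rule req_Cons)
    ultimately have "req (a # b # w) (b # insert_label a w)" using req_trans by blast
    then show ?thesis using True by simp
  next
    case False
    then have "insert_label a (b # w) = a # b # w" by (simp only: insert_label.simps if_False)
    then show ?thesis by simp
  qed
qed simp

lemma sort_sound: "req w (foldr insert_label w [])"
proof (induction w)
  case (Cons a w)
  have "req (a # w) (a # foldr insert_label w [])" using Cons.IH by (rule req_Cons)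
  from req_trans[OF this insert_label_sound] show ?case by simp
qed simp

text \<open>The list is in table coordinates and X in global ones; the inequality guarantees that
  the subtraction is exact.\<close>

definition absent :: "nat list \<Rightarrow> nat set \<Rightarrow> bool"
  where "absent N X \<longleftrightarrow> (\<forall>k\<in>set N. 2 \<le> k + i \<and> k + i - 2 \<notin> X)"

lemma req_front:
  assumes "a \<in> set w" "is_UU a \<or> is_CC a" shows "req w (a # remove1 a w)"
proof
  fix X
  obtain u v where w: "w = u @ a # v" "a \<notin> set u" using split_list_first[OF assms(1)] by blast
  have "weq s n X (g u @ [relabel i a]) (relabel i a # g u)"
    using assms(2) by (intro weq_move_front) (auto simp: commuting_def)
  from weq_context[of s n X "[]", simplified, OF this, of "g v"]
  show "weq s n X (g w) (g (a # remove1 a w))"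
    using w by (simp add: remove1_append)
qed

text \<open>The loops in question can be brought to the front of the word, to the vertex X about
  which the absences are known.\<close>

lemma dead_sound:
  assumes "dead N w" "absent N X" shows "wzero s n X (g w)"
proof (rule wzeroI_idx)
  assume idx: "\<And>l. l \<in> set w \<Longrightarrow> 3 \<le> idx l + i"
  obtain a where a: "a \<in> set w" "case a of
      UU k \<Rightarrow> k \<noteq> 0 \<and> k - 1 \<in> set N \<and> (k \<in> set N \<or> Suc k \<in> set N \<and> UU (Suc k) \<in> set w)
    | CC k \<Rightarrow> CC k \<in> set (remove1 (CC k) w)
    | _ \<Rightarrow> False" using assms(1) unfolding dead_def by blast
  show "wzero s n X (g w)"
  proof (cases a)
    case (UU k)
    have k: "k \<noteq> 0" "k - 1 \<in> set N" "k \<in> set N \<or> Suc k \<in> set N \<and> UU (Suc k) \<in> set w"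
      using a(2) by (simp_all add: UU)
    have ki: "3 \<le> k + i" using idx[OF a(1)] by (simp add: UU)
    have "k - 1 + i - 2 \<notin> X" using assms(2) k(2) unfolding absent_def by blast
    moreover have "k - 1 + i - 2 = k + i - 2 - 1" using k(1) by simp
    ultimately have km: "k + i - 2 - 1 \<notin> X" by simp
    have f: "req w (UU k # remove1 (UU k) w)" using req_front[OF a(1)] by (simp add: UU)
    have "wzero s n X (g (UU k # remove1 (UU k) w))"
      using k(3)
    proof (elim disjE conjE)
      assume "k \<in> set N"
      then have "k + i - 2 \<notin> X" using assms(2) unfolding absent_def by blast
      then show ?thesis
        using wzero_context[of s n X "[]" "[UU (k + i - 2)]" "g (remove1 (UU k) w)"] wzero_UU[OF km] by simp
    next
      assume S: "Suc k \<in> set N" "UU (Suc k) \<in> set w"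
      then have "Suc k + i - 2 \<notin> X" using assms(2) unfolding absent_def by blast
      moreover have kk: "Suc k + i - 2 = Suc (k + i - 2)" using ki by simp
      ultimately have kp: "Suc (k + i - 2) \<notin> X" by simp
      have S': "UU (Suc k) \<in> set (remove1 (UU k) w)" using S(2) by simp
      let ?r = "remove1 (UU (Suc k)) (remove1 (UU k) w)"
      have "req (UU k # remove1 (UU k) w) (UU k # UU (Suc k) # ?r)"
        using req_front[OF S'] by (intro req_Cons) simp
      moreover have "wzero s n X (g (UU k # UU (Suc k) # ?r))"
      proof -
        have "g (UU k # UU (Suc k) # ?r) = [] @ [UU (k + i - 2), UU (Suc (k + i - 2))] @ g ?r"
          by (simp only: list.map relabel.simps kk append.simps)
        then show ?thesis
          using wzero_context[of s n X "[]" "[UU (k + i - 2), UU (Suc (k + i - 2))]" "g ?r"]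
            wzero_UU_UU[OF km kp] by (simp only: foldl_Nil)
      qed
      ultimately show ?thesis using weq_wzero by blast
    qed
    then show ?thesis using f weq_wzero by blast
  next
    case (CC k)
    have S': "CC k \<in> set (remove1 (CC k) w)" using a(2) by (simp add: CC)
    let ?r = "remove1 (CC k) (remove1 (CC k) w)"
    have "req w (CC k # remove1 (CC k) w)" using req_front[OF a(1)] by (simp add: CC)
    moreover have "req (CC k # remove1 (CC k) w) (CC k # CC k # ?r)"
      using req_front[OF S'] by (intro req_Cons) simp
    ultimately have "req w (CC k # CC k # ?r)" using req_trans by blast
    moreover have "wzero s n X (g (CC k # CC k # ?r))"
      using wzero_context[of s n X "[]" "[CC (k + i - 2), CC (k + i - 2)]" "g ?r"] wzero_CC by simp
    ultimately show ?thesis using weq_wzero by blast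
  qed (use a(2) in simp_all)
qed

lemma absent_after_sound:
  assumes "absent N X" "3 \<le> idx a + i"
  shows "absent (absent_after N a) (arrow_target X (relabel i a))"
proof (cases a)
  case (RR j)
  have "k + i - 2 \<noteq> j + i - 2" if "2 \<le> k + i" "k \<noteq> j" for k using that assms(2) RR by auto
  moreover have "j - 1 + i - 2 = j + i - 2 - 1" "2 \<le> j - 1 + i" "j + i - 2 - 1 \<noteq> j + i - 2" if "j \<noteq> 0"
    using that assms(2) RR by auto
  ultimately show ?thesis
    using assms(1) unfolding RR absent_def by auto
next
  case (LL j)
  have "k + i - 2 \<noteq> j + i - 2 - 1" if "2 \<le> k + i" "k \<noteq> j - 1" "j \<noteq> 0" for k using that assms(2) LL by auto
  moreover have "j + i - 2 - 1 \<noteq> j + i - 2" "2 \<le> j + i" using assms(2) LL by auto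
  ultimately show ?thesis
    using assms(1) unfolding LL absent_def by auto
qed (use assms in simp_all)

lemma vanishes_sound: "vanishes f N w \<Longrightarrow> absent N X \<Longrightarrow> wzero s n X (g w)"
proof (induction f arbitrary: N w X)
  case 0
  then show ?case using dead_sound by simp
next
  case (Suc f)
  show ?case
  proof (cases "dead N w")
    case True
    then show ?thesis using dead_sound Suc.prems by blast
  next
    case False
    then obtain b r where p: "(b, r) \<in> set (pulls w)" "vanishes f (absent_after N b) r"
      using Suc.prems(1) by auto
    have f: "req w (b # r)" by (rule pulls_sound[OF p(1)])
    have "wzero s n X (g (b # r))"
    proof (rule wzeroI_idx)
      assume "\<And>l. l \<in> set (b # r) \<Longrightarrow> 3 \<le> idx l + i"
      then have "absent (absent_after N b) (arrow_target X (relabel i b))"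
        using Suc.prems(2) by (intro absent_after_sound) simp_all
      then have "wzero s n (arrow_target X (relabel i b)) (g r)" by (rule Suc.IH[OF p(2)])
      then show "wzero s n X (g (b # r))"
        using wzero_context[of s n X "[relabel i b]" "g r" "[]"] by simp
    qed
    then show ?thesis using f weq_wzero by blast
  qed
qed

lemma normalize_sound:
  assumes "absent N X"
  shows "normalize N w = None \<Longrightarrow> wzero s n X (g w)"
    and "normalize N w = Some w' \<Longrightarrow> weq s n X (g w) (g w')"
proof -
  have *: "(normalize N w = None \<longrightarrow> wzero s n X (g w)) \<and> (\<forall>w'. normalize N w = Some w' \<longrightarrow> weq s n X (g w) (g w'))"
  proof (cases "reduce w")
    case None
    then show ?thesis using reduce_sound[of w] by (simp add: normalize_def)
  next
    case (Some r)
    let ?r = "foldr insert_label r []"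
    have "req w ?r" using reduce_sound[of w] Some sort_sound[of r] req_trans by blast
    moreover have "wzero s n X (g w)" if "vanishes (length ?r) N ?r"
      using vanishes_sound[OF that assms] calculation weq_wzero by blast
    moreover have "normalize N w = (if vanishes (length ?r) N ?r then None else Some ?r)"
      by (simp add: normalize_def Some Let_def)
    ultimately show ?thesis by (cases "vanishes (length ?r) N ?r") simp_all
  qed
  then show "normalize N w = None \<Longrightarrow> wzero s n X (g w)"
    and "normalize N w = Some w' \<Longrightarrow> weq s n X (g w) (g w')" by blast+
qed

end

section \<open>The structure equation\<close>

text \<open>Each deletion made by \<open>leftover\<close> removes two equal summands, whose sum is
  zero.\<close>

lemma leftover_sum:
  "(\<Sum>x\<leftarrow>xs. case x of None \<Rightarrow> 0 | Some t \<Rightarrow> F t) = (\<Sum>t\<leftarrow>leftover xs. F t)"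
  for F :: "'a \<Rightarrow> 'b \<Rightarrow>\<^sub>0 bit"
proof (induction xs rule: leftover.induct)
  case (3 t ts)
  show ?case
  proof (cases "t \<in> set (leftover ts)")
    case True
    have "(\<Sum>t\<leftarrow>leftover ts. F t) = F t + (\<Sum>t\<leftarrow>remove1 t (leftover ts). F t)"
      by (rule sum_list_map_remove1[OF True])
    then show ?thesis using 3 True by simp
  qed (use 3 in simp)
qed simp_all

lemma lin_sum_list: "lin \<phi> (\<Sum>t\<leftarrow>ts. f t) = (\<Sum>t\<leftarrow>ts. lin \<phi> (f t))"
  by (induction ts) (simp_all add: lin_add)

lemma sum_list_concat: "(\<Sum>t\<leftarrow>concat xss. f t) = (\<Sum>xs\<leftarrow>xss. \<Sum>t\<leftarrow>xs. f t)"
  for f :: "'a \<Rightarrow> 'b :: comm_monoid_add"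
  by (induction xss) simp_all

text \<open>Groups a double sum by unordered pairs of distinct indices. Applied to the square of a
  sum, each group becomes a commutator.\<close>

lemma sum_offdiagonal:
  fixes f :: "nat \<Rightarrow> nat \<Rightarrow> 'a :: comm_monoid_add"
  assumes "finite J"
  shows "(\<Sum>j\<in>J. \<Sum>k\<in>J. f j k) = (\<Sum>j\<in>J. f j j) + (\<Sum>j\<in>J. \<Sum>k\<in>J. if j < k then f j k + f k j else 0)"
proof -
  have "f j k = (if j = k then f j k else 0) + ((if j < k then f j k else 0) + (if k < j then f j k else 0))" for j k
    by auto
  then have "(\<Sum>j\<in>J. \<Sum>k\<in>J. f j k) = (\<Sum>j\<in>J. \<Sum>k\<in>J. if j = k then f j k else 0) +
      ((\<Sum>j\<in>J. \<Sum>k\<in>J. if j < k then f j k else 0) + (\<Sum>j\<in>J. \<Sum>k\<in>J. if k < j then f j k else 0))"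
    by (simp only: sum.distrib[symmetric])
  also have "(\<Sum>j\<in>J. \<Sum>k\<in>J. if k < j then f j k else 0) = (\<Sum>j\<in>J. \<Sum>k\<in>J. if j < k then f k j else 0)"
    by (rule sum.swap)
  also have "(\<Sum>j\<in>J. \<Sum>k\<in>J. if j = k then f j k else 0) = (\<Sum>j\<in>J. f j j)"
    using assms by (intro sum.cong refl) simp
  also have "(\<Sum>j\<in>J. \<Sum>k\<in>J. if j < k then f j k else 0) + (\<Sum>j\<in>J. \<Sum>k\<in>J. if j < k then f k j else 0) =
      (\<Sum>j\<in>J. \<Sum>k\<in>J. if j < k then f j k + f k j else 0)"
    unfolding sum.distrib[symmetric] by (intro sum.cong refl) simp
  finally show ?thesis .
qed

context X_setting
begin

section \<open>Congruences of words as elements of the kernel of evaluation\<close>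

lemma NullI: "f \<in> WS m \<Longrightarrow> evm m f = \<zero>\<^bsub>tensor_group K (BB n) M\<^esub> \<Longrightarrow> f \<in> Null m"
  by (simp add: Null_def)

lemma Null_zero: "0 \<in> Null m"
  by (simp add: Null_def)

lemma Null_add: "f \<in> Null m \<Longrightarrow> g \<in> Null m \<Longrightarrow> f + g \<in> Null m"
  by (simp add: Null_def evm_add keys_add_subset)

lemma Null_sum: "(\<And>a. a \<in> A \<Longrightarrow> f a \<in> Null m) \<Longrightarrow> sum f A \<in> Null m"
  by (induction A rule: infinite_finite_induct) (simp_all add: Null_zero Null_add)

lemma Null_sum_list: "(\<And>a. a \<in> set xs \<Longrightarrow> f a \<in> Null m) \<Longrightarrow> (\<Sum>a\<leftarrow>xs. f a) \<in> Null m"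
  by (induction xs) (simp_all add: Null_zero Null_add)

lemma Null_pair:
  assumes t: "(v, w, m') \<in> valid m"
    and 1: "weq False n (idem1 i m) v v'" and 2: "weq True n (idem2 n i m) w w'"
  shows "(v', w', m') \<in> valid m" and "bvec (v, w, m') + bvec (v', w', m') \<in> Null m"
proof -
  note vd = validD[OF t]
  have v: "(idem1 i m, v') \<in> paths False n" "target (idem1 i m) v = target (idem1 i m) v'"
    "bvec (idem1 i m, v) + bvec (idem1 i m, v') \<in> rel_ideal False n"
    using 1 vd(2) by (simp_all add: weq_def)
  have w: "(idem2 n i m, w') \<in> paths True n" "target (idem2 n i m) w = target (idem2 n i m) w'"
    "bvec (idem2 n i m, w) + bvec (idem2 n i m, w') \<in> rel_ideal True n"
    using 2 vd(4) by (simp_all add: weq_def)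
  show t': "(v', w', m') \<in> valid m"
    using vd v(1,2) w(1,2) by (intro validI) simp_all
  have "quiver_class False n (bvec (idem1 i m, v)) = quiver_class False n (bvec (idem1 i m, v'))"
    "quiver_class True n (bvec (idem2 n i m, w)) = quiver_class True n (bvec (idem2 n i m, w'))"
    using vd v w by (simp_all add: class_eq_iff)
  then have "ev m (v, w, m') = ev m (v', w', m')"
    by (simp add: ev_def coeff_def bb_tensor_def)
  moreover have "ev m (v', w', m') \<in> carrier (tensor_group K (BB n) M)"
    using ev_closed[of m] t' by (auto simp: Pi_iff)
  ultimately show "bvec (v, w, m') + bvec (v', w', m') \<in> Null m"
    using t t' by (intro NullI) (simp_all add: keys_add_subset evm_add evm_bvec)
qed

lemma Null_vanish:
  assumes t: "(v, w, m') \<in> valid m"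
    and z: "wzero False n (idem1 i m) v \<or> wzero True n (idem2 n i m) w"
  shows "bvec (v, w, m') \<in> Null m"
proof (rule NullI)
  note vd = validD[OF t]
  have "quiver_class False n (bvec (idem1 i m, v)) = \<zero>\<^bsub>Balg n\<^esub> \<or>
      quiver_class True n (bvec (idem2 n i m, w)) = \<zero>\<^bsub>Bshriek n\<^esub>"
    using z vd by (auto simp: wzero_def class_eq_zero_iff)
  moreover have c: "quiver_class False n (bvec (idem1 i m, v)) \<in> carrier (Balg n)"
    "quiver_class True n (bvec (idem2 n i m, w)) \<in> carrier (Bshriek n)"
    using vd by simp_all
  ultimately have "coeff m v w = \<zero>\<^bsub>BB n\<^esub>"
    unfolding coeff_def bb_tensor_def BB_simps using c by (elim disjE) (simp_all only: DG.tens_zero)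
  then show "evm m (bvec (v, w, m')) = \<zero>\<^bsub>tensor_group K (BB n) M\<^esub>"
    using vd(1) by (simp add: evm_bvec[OF t] ev_def)
qed (use t in simp)

subsection \<open>Reduction to finite tables\<close>

definition gterm :: "nat set \<Rightarrow> lterm \<Rightarrow> wterm"
  where "gterm xe = (\<lambda>(v, w, h). (map (relabel i) v, map (relabel i) w, (xe, h)))"

abbreviation gsum :: "nat set \<Rightarrow> lterm list \<Rightarrow> wterm \<Rightarrow>\<^sub>0 bit"
  where "gsum xe ts \<equiv> \<Sum>t\<leftarrow>ts. bvec (gterm xe t)"

lemma normalize_term_Null:
  assumes t: "gterm xe t \<in> valid m"
    and N: "relabeled.absent i N (idem1 i m)" "relabeled.absent i N' (idem2 n i m)"
  shows "bvec (gterm xe t) + (case normalize_term N N' t of None \<Rightarrow> 0 | Some u \<Rightarrow> bvec (gterm xe u)) \<in> Null m"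
proof -
  obtain v w h where tt: "t = (v, w, h)" by (cases t)
  have t': "(map (relabel i) v, map (relabel i) w, (xe, h)) \<in> valid m"
    using t by (simp add: tt gterm_def)
  note n1 = relabeled.normalize_sound[OF N(1)] and n2 = relabeled.normalize_sound[OF N(2)]
  show ?thesis
  proof (cases "normalize N v")
    case None
    then show ?thesis
      using Null_vanish[OF t'] n1(1)[OF None] by (simp add: tt gterm_def normalize_term_def)
  next
    case v: (Some v')
    show ?thesis
    proof (cases "normalize N' w")
      case None
      then show ?thesis
        using Null_vanish[OF t'] n2(1)[OF None] v by (simp add: tt gterm_def normalize_term_def)
    next
      case w: (Some w')
      show ?thesis
        using Null_pair(2)[OF t' n1(2)[OF v] n2(2)[OF w]] v w by (simp add: tt gterm_def normalize_term_def)
    qed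
  qed
qed

text \<open>Every term agrees with its normal form modulo the kernel, and the sum of the normal
  forms is zero because they cancel in pairs.\<close>

lemma cancels_Null:
  assumes v: "\<And>t. t \<in> set ts \<Longrightarrow> gterm xe t \<in> valid m"
    and N: "relabeled.absent i N (idem1 i m)" "relabeled.absent i N' (idem2 n i m)"
    and c: "cancels (map (normalize_term N N') ts)"
  shows "gsum xe ts \<in> Null m"
proof -
  let ?c = "\<lambda>t. (case normalize_term N N' t of None \<Rightarrow> 0 | Some u \<Rightarrow> bvec (gterm xe u)) :: wterm \<Rightarrow>\<^sub>0 bit"
  have "(\<Sum>t\<leftarrow>ts. ?c t) = 0"
    using leftover_sum[of "\<lambda>u. bvec (gterm xe u)" "map (normalize_term N N') ts"] c by (simp add: o_def)
  then have "gsum xe ts = (\<Sum>t\<leftarrow>ts. bvec (gterm xe t) + ?c t)"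
    by (simp add: sum_list_addf)
  also have "\<dots> \<in> Null m"
    using v N by (intro Null_sum_list normalize_term_Null)
  finally show ?thesis .
qed

text \<open>Verifies the raised table \<open>loc_terms\<close> against the given table: relabelling
  its entries yields exactly the shifted entries of \<open>delta_loc\<close>.\<close>

lemma Lw_gsum: "Lw (xe, g) = gsum xe (loc_terms g)"
  unfolding Lw_def lift_term_def gterm_def snd_conv fst_conv
  by (induct g) (simp_all add: add_ac)

lemma loc_terms_valid:
  assumes "(xe, g) \<in> X_basis n i" "t \<in> set (loc_terms g)" shows "gterm xe t \<in> valid (xe, g)"
proof -
  \<comment> \<open>\<open>relabel 3\<close> adds 1 to every index, so following it by
    \<open>relabel i\<close> is the shift by i - 1.\<close>
  have "set (loc_terms g) = (\<lambda>(v, w, h). (map (relabel 3) v, map (relabel 3) w, h)) ` delta_loc g"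
    by (induct g) simp_all
  then obtain u where u: "u \<in> delta_loc g" "t = (case u of (v, w, h) \<Rightarrow> (map (relabel 3) v, map (relabel 3) w, h))"
    using assms(2) by blast
  have "relabel i (relabel 3 l) = shift_label i l" for l by (cases l) auto
  then have "gterm xe t = lift_term (xe, g) u"
    unfolding u(2) by (cases u) (simp add: lift_term_def gterm_def o_def)
  then show ?thesis using L_valid[OF assms(1), of u] u(1) by simp
qed

lemma term_diff_gsum: "lin term_diff (gsum xe ts) = gsum xe (concat (map diff_terms ts))"
proof -
  have "term_diff (gterm xe t) = gsum xe (diff_terms t)" for t
  proof -
    obtain v w h where t: "t = (v, w, h)" by (cases t)
    have "(case map (relabel i) w ! k of CC c \<Rightarrow> bvec (map (relabel i) v, (map (relabel i) w)[k := UU c], (xe, h)) | _ \<Rightarrow> 0) =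
        gsum xe (case w ! k of CC c \<Rightarrow> [(v, w[k := UU c], h)] | _ \<Rightarrow> [])" if "k < length w" for k
      using that by (cases "w ! k") (simp_all add: gterm_def map_update)
    then have "term_diff (gterm xe t) = (\<Sum>k<length w. gsum xe (case w ! k of CC c \<Rightarrow> [(v, w[k := UU c], h)] | _ \<Rightarrow> []))"
      unfolding t term_diff_def gterm_def prod.case by (intro sum.cong) simp_all
    also have "\<dots> = (\<Sum>k\<leftarrow>[0..<length w]. gsum xe (case w ! k of CC c \<Rightarrow> [(v, w[k := UU c], h)] | _ \<Rightarrow> []))"
      by (simp add: interv_sum_list_conv_sum_set_nat lessThan_atLeast0)
    also have "\<dots> = gsum xe (diff_terms t)"
      by (simp add: t diff_terms_def sum_list_concat o_def)
    finally show ?thesis .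
  qed
  then show ?thesis by (simp add: lin_sum_list sum_list_concat o_def)
qed

lemma compose_gsum:
  assumes "\<And>h. h \<in> (\<lambda>(v, w, h). h) ` set ts \<Longrightarrow> W (xe, h) = gsum xe' (Q h)"
  shows "compose (gsum xe ts) W = gsum xe' (concat (map (\<lambda>(v, w, h). prepend v w (Q h)) ts))"
proof -
  have "compose (bvec (gterm xe t)) W = gsum xe' (case t of (v, w, h) \<Rightarrow> prepend v w (Q h))" if "t \<in> set ts" for t
  proof -
    obtain v w h where t: "t = (v, w, h)" by (cases t)
    have "compose (bvec (gterm xe t)) W = prefix (map (relabel i) v) (map (relabel i) w) (gsum xe' (Q h))"
      using assms[of h] that by (force simp: t gterm_def)
    also have "\<dots> = gsum xe' (prepend v w (Q h))"
      by (simp add: prefix_def lin_sum_list prepend_def o_def gterm_def case_prod_unfold)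
    finally show ?thesis by (simp add: t)
  qed
  then have "(\<Sum>t\<leftarrow>ts. compose (bvec (gterm xe t)) W) = (\<Sum>t\<leftarrow>ts. gsum xe' (case t of (v, w, h) \<Rightarrow> prepend v w (Q h)))"
    by (intro arg_cong[where f = sum_list] map_cong refl) simp
  then show ?thesis
    unfolding compose_def lin_sum_list by (simp add: sum_list_concat o_def)
qed

lemma prepend_valid:
  assumes "gterm xe (v, w, h) \<in> valid m" "\<And>t. t \<in> set ts \<Longrightarrow> gterm xe' t \<in> valid (xe, h)"
    and "t \<in> set (prepend v w ts)"
  shows "gterm xe' t \<in> valid m"
proof -
  obtain v' w' h' where "t = (v @ v', w @ w', h')" "(v', w', h') \<in> set ts"
    using assms(3) by (auto simp: prepend_def)
  then show ?thesis
    using valid_append[of _ _ "(xe, h)" m _ _ "(xe', h')"] assms(1) assms(2)[of "(v', w', h')"]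
    by (simp add: gterm_def)
qed

lemma diff_terms_valid:
  assumes "gterm xe t \<in> valid m" "u \<in> set (diff_terms t)" shows "gterm xe u \<in> valid m"
proof -
  obtain v w h where t: "t = (v, w, h)" by (cases t)
  note vd = validD[OF assms(1)[unfolded t gterm_def prod.case]]
  obtain k c where k: "k < length w" "w ! k = CC c" "u = (v, w[k := UU c], h)"
  proof -
    obtain k where "k < length w" "u \<in> set (case w ! k of CC c \<Rightarrow> [(v, w[k := UU c], h)] | _ \<Rightarrow> [])"
      using assms(2) unfolding t diff_terms_def prod.case set_concat set_map set_upt
      by (elim UnionE imageE) simp
    then show ?thesis using that by (cases "w ! k") simp_all
  qed
  have "k < length (map (relabel i) w)" "map (relabel i) w ! k = CC (c + i - 2)" using k by simp_all
  note r = CC_replace[OF this]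
  have "map (relabel i) (w[k := UU c]) = (map (relabel i) w)[k := UU (c + i - 2)]"
    by (simp add: map_update)
  then show ?thesis
    unfolding k gterm_def prod.case using vd r by (intro validI) simp_all
qed

lemma absent_local_sound:
  assumes "(xe, g) \<in> X_basis n i"
  shows "relabeled.absent i (absent_local (gen_idem1 g)) (idem1 i (xe, g))"
    and "relabeled.absent i (absent_local (gen_idem2 g)) (idem2 n i (xe, g))"
proof -
  have abs: "relabeled.absent i (absent_local a) X"
    if "\<And>k. k \<in> {i - 1..i + 1} \<Longrightarrow> k \<in> X \<longleftrightarrow> k + 1 - i \<in> a" for a X
    unfolding relabeled.absent_def
  proof
    fix k' assume "k' \<in> set (absent_local a)"
    then obtain k where k: "k' = Suc k" "k \<le> 2" "k \<notin> a"
      unfolding absent_local_def set_map set_filter by auto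
    have "Suc k + i - 2 \<in> {i - 1..i + 1}" "Suc k + i - 2 + 1 - i = k" using k(2) i1 by auto
    then have "Suc k + i - 2 \<notin> X" using that[of "Suc k + i - 2"] k(3) by (simp only: simp_thms)
    then show "2 \<le> k' + i \<and> k' + i - 2 \<notin> X" using k(1) i1 by simp
  qed
  show "relabeled.absent i (absent_local (gen_idem1 g)) (idem1 i (xe, g))"
    by (rule abs) (simp only: mem_idem1[OF assms] if_True)
  show "relabeled.absent i (absent_local (gen_idem2 g)) (idem2 n i (xe, g))"
    by (rule abs) (simp only: mem_idem2[OF assms] if_True)
qed

lemma absent_append: "relabeled.absent i (N @ N') X \<longleftrightarrow> relabeled.absent i N X \<and> relabeled.absent i N' X"
  by (auto simp: relabeled.absent_def)

lemma local_Null: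
  assumes m: "m \<in> X_basis n i" shows "lin term_diff (Lw m) + compose (Lw m) Lw \<in> Null m"
proof -
  obtain xe g where mg: "m = (xe, g)" by (cases m)
  have b: "(xe, h) \<in> X_basis n i" for h using m by (simp add: mg X_basis_def)
  have "lin term_diff (Lw m) + compose (Lw m) Lw = gsum xe (local_square g)"
    unfolding mg Lw_gsum[of xe g] term_diff_gsum local_square_def
      compose_gsum[where W = Lw and Q = loc_terms and xe = xe and xe' = xe, OF Lw_gsum] by simp
  also have "\<dots> \<in> Null m"
    unfolding mg
  proof (rule cancels_Null[OF _ absent_local_sound[OF b] local_square_cancels])
    fix t assume "t \<in> set (local_square g)"
    then consider u where "u \<in> set (loc_terms g)" "t \<in> set (diff_terms u)"
      | v w h where "(v, w, h) \<in> set (loc_terms g)" "t \<in> set (prepend v w (loc_terms h))"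
      by (auto simp: local_square_def)
    then show "gterm xe t \<in> valid (xe, g)"
      using loc_terms_valid[OF b] diff_terms_valid prepend_valid[of xe _ _ _ "(xe, g)" _ xe] by cases metis+
  qed
  finally show ?thesis .
qed

text \<open>A move at j changes the external state from xe to the same xe' for every local
  generator. All terms of the commutator therefore lie over xe', and they can be listed by words and
  local generators alone.\<close>

lemma cross_Null:
  assumes m: "(xe, g) \<in> X_basis n i" and V: "\<And>h. Vw j (xe, h) = gsum xe' (mv h)" and xe': "xe' \<subseteq> S_ext n i"
    and mv: "\<And>h t. t \<in> set (mv h) \<Longrightarrow> gterm xe' t \<in> valid (xe, h)"
    and N: "relabeled.absent i N (idem1 i (xe, g))" "relabeled.absent i N' (idem2 n i (xe, g))"
    and c: "cancels (map (normalize_term N N') (cross_terms mv g))"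
  shows "compose (Lw (xe, g)) (Vw j) + compose (Vw j (xe, g)) Lw \<in> Null (xe, g)"
proof -
  have b: "(xe, h) \<in> X_basis n i" "(xe', h) \<in> X_basis n i" for h
    using m xe' by (simp_all add: X_basis_def)
  have "compose (Lw (xe, g)) (Vw j) + compose (Vw j (xe, g)) Lw = gsum xe' (cross_terms mv g)"
    unfolding Lw_gsum[of xe g] V[of g] cross_terms_def
      compose_gsum[where W = Lw and Q = loc_terms and xe = xe' and xe' = xe', OF Lw_gsum]
      compose_gsum[where W = "Vw j" and Q = mv and xe = xe and xe' = xe', OF V] by simp
  also have "\<dots> \<in> Null (xe, g)"
  proof (rule cancels_Null[OF _ N c])
    fix t assume "t \<in> set (cross_terms mv g)"
    then consider v w h where "(v, w, h) \<in> set (loc_terms g)" "t \<in> set (prepend v w (mv h))"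
      | v w h where "(v, w, h) \<in> set (mv g)" "t \<in> set (prepend v w (loc_terms h))"
      by (auto simp: cross_terms_def)
    then show "gterm xe' t \<in> valid (xe, g)"
    proof cases
      case 1
      show ?thesis by (rule prepend_valid[OF loc_terms_valid[OF b(1) 1(1)] mv 1(2)])
    next
      case 2
      show ?thesis by (rule prepend_valid[OF mv[OF 2(1)] loc_terms_valid[OF b(2)] 2(2)])
    qed
  qed
  finally show ?thesis .
qed

end

context X_setting
begin

subsection \<open>Neighbouring external moves\<close>

lemma A_set_pair: "(xe, g) \<in> X_basis n i \<Longrightarrow> (xe, g) \<in> A_set n i j \<longleftrightarrow>
    j - 1 \<in> idem1 i (xe, g) \<and> j - 1 \<notin> idem2 n i (xe, g) \<and> j \<notin> idem1 i (xe, g) \<and> j \<in> idem2 n i (xe, g)"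
  and B_set_pair: "(xe, g) \<in> X_basis n i \<Longrightarrow> (xe, g) \<in> B_set n i j \<longleftrightarrow>
    j \<in> idem1 i (xe, g) \<and> j \<notin> idem2 n i (xe, g) \<and> j - 1 \<notin> idem1 i (xe, g) \<and> j - 1 \<in> idem2 n i (xe, g)"
  by (simp_all add: A_set_iff B_set_iff)

text \<open>A list with at most one entry leaves no room for cancellation, so validity of the sum is
  validity of its term.\<close>

lemma Vw_gsum_valid:
  assumes "Vw j m = gsum xe' ts" "j \<in> J" "length ts \<le> 1" "t \<in> set ts"
  shows "gterm xe' t \<in> valid m"
proof -
  have "ts = [t]" using assms(3,4) by (cases ts) auto
  then show ?thesis using Vw_WS[OF assms(2), of m] assms(1) by simp
qed

text \<open>The vertex j = i - 1 is the local vertex 0 and j - 1 is external. Whether the move is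
  possible depends on the local generator and on the occupation of j - 1 only, which is the data of
  the table.\<close>

lemma left_Null:
  assumes j: "j \<in> J" "j + 1 = i" and m: "m \<in> X_basis n i"
  shows "compose (Lw m) (Vw j) + compose (Vw j m) Lw \<in> Null m"
proof -
  obtain xe g where mg: "m = (xe, g)" by (cases m)
  have xe: "xe \<subseteq> S_ext n i" using m by (simp add: mg X_basis_def)
  then have b: "(xe, h) \<in> X_basis n i" for h by (simp add: X_basis_def)
  have j1: "1 \<le> j" using j by simp
  have out: "j - 1 \<notin> {i - 1..i + 1}" "j \<in> {i - 1..i + 1}" "j + 1 - i = 0" "j - 1 \<le> n"
    using j j1 i1_le by auto
  have S: "j - 1 \<in> S_ext n i" using out by (simp add: mem_S_ext)
  let ?e = "j - 1 \<in> xe"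
  let ?x = "if ?e then xe - {j - 1} else insert (j - 1) xe"
  have x: "?x \<subseteq> S_ext n i" using xe S by auto
  have A: "(xe, h) \<in> A_set n i j \<longleftrightarrow> ?e \<and> 0 \<notin> gen_idem1 h \<and> 0 \<in> gen_idem2 h" for h
    unfolding A_set_pair[OF b] mem_idem1[OF b] mem_idem2[OF b] using out by auto
  have B: "(xe, h) \<in> B_set n i j \<longleftrightarrow> \<not> ?e \<and> 0 \<in> gen_idem1 h \<and> 0 \<notin> gen_idem2 h" for h
    unfolding B_set_pair[OF b] mem_idem1[OF b] mem_idem2[OF b] using out by auto
  have f: "flip i j (xe, h) = (?x, flip0 h)" for h using j(2) by (simp add: flip_def)
  have r: "1 + i - 2 = j" "Suc i - 2 = j" "i - Suc 0 = j" using j(2) by simp_all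
  have V: "Vw j (xe, h) = gsum ?x (move_left ?e h)" for h
    unfolding Vw_def A B f move_left_def
    by (simp add: gterm_def r del: if_image_distrib)
  have N1: "relabeled.absent i (if ?e then [] else [0]) (idem1 i (xe, g))"
    using j j1 mem_idem1[OF b, of "j - 1" g] out by (auto simp: relabeled.absent_def)
  have N2: "relabeled.absent i (if ?e then [0] else []) (idem2 n i (xe, g))"
    using j j1 mem_idem2[OF b, of "j - 1" g] out by (auto simp: relabeled.absent_def)
  show ?thesis
    unfolding mg
  proof (rule cross_Null[OF b V x _ _ _ cross_left_cancels])
    show "gterm ?x t \<in> valid (xe, h)" if "t \<in> set (move_left ?e h)" for h t
      using that by (intro Vw_gsum_valid[OF V j(1)]) (simp_all add: move_left_def split: if_splits)
  qed (use N1 N2 absent_local_sound[OF b, of g] absent_append in blast)+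
qed

lemma right_Null:
  assumes j: "j \<in> J" "j = i + 2" and m: "m \<in> X_basis n i"
  shows "compose (Lw m) (Vw j) + compose (Vw j m) Lw \<in> Null m"
proof -
  obtain xe g where mg: "m = (xe, g)" by (cases m)
  have xe: "xe \<subseteq> S_ext n i" using m by (simp add: mg X_basis_def)
  then have b: "(xe, h) \<in> X_basis n i" for h by (simp add: X_basis_def)
  have out: "j \<notin> {i - 1..i + 1}" "j - 1 \<in> {i - 1..i + 1}" "j - 1 + 1 - i = 2" "j \<le> n"
    using j by auto
  have S: "j \<in> S_ext n i" using out by (simp add: mem_S_ext)
  let ?e = "j \<in> xe"
  let ?x = "if ?e then xe - {j} else insert j xe"
  have x: "?x \<subseteq> S_ext n i" using xe S by auto
  have A: "(xe, h) \<in> A_set n i j \<longleftrightarrow> \<not> ?e \<and> 2 \<in> gen_idem1 h \<and> 2 \<notin> gen_idem2 h" for h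
    unfolding A_set_pair[OF b] mem_idem1[OF b] mem_idem2[OF b] using out by auto
  have B: "(xe, h) \<in> B_set n i j \<longleftrightarrow> ?e \<and> 2 \<notin> gen_idem1 h \<and> 2 \<in> gen_idem2 h" for h
    unfolding B_set_pair[OF b] mem_idem1[OF b] mem_idem2[OF b] using out by auto
  have f: "flip i j (xe, h) = (?x, flip2 h)" for h using j(2) by (simp add: flip_def)
  have r: "4 + i - 2 = j" "i + 2 = j" "Suc (Suc i) = j" using j(2) by simp_all
  have V: "Vw j (xe, h) = gsum ?x (move_right ?e h)" for h
    unfolding Vw_def A B f move_right_def
    by (simp add: gterm_def r)
  have m1: "j \<in> idem1 i (xe, g) \<longleftrightarrow> j \<in> xe" and m2: "j \<in> idem2 n i (xe, g) \<longleftrightarrow> j \<le> n \<and> j \<notin> xe"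
    unfolding mem_idem1[OF b] mem_idem2[OF b] by (simp_all only: out(1) if_False)
  have N1: "relabeled.absent i (if ?e then [] else [4]) (idem1 i (xe, g))"
    using m1 by (cases "j \<in> xe") (simp_all add: relabeled.absent_def r)
  have N2: "relabeled.absent i (if ?e then [4] else []) (idem2 n i (xe, g))"
    using m2 by (cases "j \<in> xe") (simp_all add: relabeled.absent_def r)
  show ?thesis
    unfolding mg
  proof (rule cross_Null[OF b V x _ _ _ cross_right_cancels])
    show "gterm ?x t \<in> valid (xe, h)" if "t \<in> set (move_right ?e h)" for h t
      using that by (intro Vw_gsum_valid[OF V j(1)]) (simp_all add: move_right_def split: if_splits)
  qed (use N1 N2 absent_local_sound[OF b, of g] absent_append in blast)+
qed

subsection \<open>Distant external moves\<close>

lemma lift_term_labels: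
  assumes "t \<in> delta_loc g" "l \<in> set (fst (lift_term m t)) \<union> set (fst (snd (lift_term m t)))"
  shows "idx l = i \<or> idx l = i + 1"
proof -
  obtain v w g' where t: "t = (v, w, g')" by (cases t)
  have v: "set v \<subseteq> labels False 2" "set w \<subseteq> labels True 2"
    using delta_loc_valid[OF assms(1)[unfolded t]] by (simp_all add: mem_paths)
  obtain l' where l: "l = shift_label i l'" "l' \<in> set v \<union> set w"
    using assms(2) by (auto simp: t lift_term_def)
  then have "1 \<le> idx l'" "idx l' \<le> 2" using v by (auto simp: labels_def)
  then have "idx l' = 1 \<or> idx l' = 2" by auto
  then show ?thesis unfolding l(1) by (cases l') auto
qed

lemma Null_commute:
  assumes "(v @ [a], w @ [b], m') \<in> valid m"
    and "\<And>c. c \<in> set v \<Longrightarrow> commuting c a" "\<And>c. c \<in> set w \<Longrightarrow> commuting c b"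
  shows "bvec (v @ [a], w @ [b], m') + bvec (a # v, b # w, m') \<in> Null m"
  by (rule Null_pair(2)[OF assms(1)]; rule weq_move_front) (use assms in blast)+

text \<open>The move ignores the local generator, and its labels commute with the labels of index i
  and i + 1. So the two orders of composition agree term by term.\<close>

lemma far_Null:
  assumes j: "j \<in> J" and far: "j - 1 \<notin> {i - 1..i + 1}" "j \<notin> {i - 1..i + 1}" "j + 1 \<noteq> i" "j \<noteq> i + 2"
    and m: "m \<in> X_basis n i"
  shows "compose (Lw m) (Vw j) + compose (Vw j m) Lw \<in> Null m"
proof -
  obtain xe g where mg: "m = (xe, g)" by (cases m)
  have b: "(xe, h) \<in> X_basis n i" for h using m by (simp add: mg X_basis_def)
  let ?x = "if j \<in> xe then insert (j - 1) (xe - {j}) else insert j (xe - {j - 1})"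
  have f: "flip i j (xe, h) = (?x, h)" for h using far(3,4) by (simp add: flip_def)
  \<comment> \<open>Both vertices of the move are external, so its direction is the same for all
    generators over xe.\<close>
  have A: "(xe, h) \<in> A_set n i j \<longleftrightarrow> (xe, g) \<in> A_set n i j" for h
    unfolding A_set_pair[OF b] mem_idem1[OF b] mem_idem2[OF b] by (simp only: far(1,2) if_False)
  have B: "(xe, h) \<in> B_set n i j \<longleftrightarrow> (xe, g) \<in> B_set n i j" for h
    unfolding B_set_pair[OF b] mem_idem1[OF b] mem_idem2[OF b] by (simp only: far(1,2) if_False)
  have comm: "commuting l c" if "idx l = i \<or> idx l = i + 1" "idx c = j" for l c
  proof -
    have "j \<noteq> i" "j \<noteq> i + 1" "1 \<le> j" using j by auto
    then have "j + 2 \<le> i \<or> i + 3 \<le> j" using far by linarith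
    then have "\<bar>int (idx l) - int (idx c)\<bar> > 1" using that by auto
    then show ?thesis by (simp add: commuting_def)
  qed
  have key: "compose (Lw m) (Vw j) + compose (Vw j m) Lw \<in> Null m"
    if V: "\<And>h. Vw j (xe, h) = bvec ([a], [c], (?x, h))" and ac: "idx a = j" "idx c = j" for a c
  proof -
    have "compose (Lw m) (Vw j) + compose (Vw j m) Lw =
      (\<Sum>t\<in>delta_loc g. compose (bvec (lift_term m t)) (Vw j) + prefix [a] [c] (bvec (lift_term (?x, g) t)))"
      unfolding Lw_def compose_sum_left mg V[of g] compose_bvec prefix_sum sum.distrib by simp
    also have "\<dots> \<in> Null m"
    proof (rule Null_sum)
      fix t assume t: "t \<in> delta_loc g"
      obtain v w h where tt: "t = (v, w, h)" by (cases t)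
      let ?v = "map (shift_label i) v" and ?w = "map (shift_label i) w"
      have l: "lift_term m t = (?v, ?w, (xe, h))" "lift_term (?x, g) t = (?v, ?w, (?x, h))"
        by (simp_all only: lift_term_def tt prod.case mg fst_conv)
      have lab: "idx k = i \<or> idx k = i + 1" if "k \<in> set ?v \<union> set ?w" for k
        by (rule lift_term_labels[OF t, of k m]) (use that in \<open>simp only: l fst_conv snd_conv\<close>)
      have v1: "(?v, ?w, (xe, h)) \<in> valid m" using L_valid[OF m, of t] t l by (simp add: mg)
      have v2: "([a], [c], (?x, h)) \<in> valid (xe, h)"
        using Vw_WS[OF j, of "(xe, h)"] unfolding V by simp
      have "bvec (?v @ [a], ?w @ [c], (?x, h)) + bvec (a # ?v, c # ?w, (?x, h)) \<in> Null m"
        by (rule Null_commute[OF valid_append[OF v1 v2]]) (use comm ac lab in blast)+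
      then show "compose (bvec (lift_term m t)) (Vw j) + prefix [a] [c] (bvec (lift_term (?x, g) t)) \<in> Null m"
        unfolding l compose_bvec V prefix_bvec by simp
    qed
    finally show ?thesis .
  qed
  consider "(xe, g) \<in> A_set n i j" | "(xe, g) \<notin> A_set n i j" "(xe, g) \<in> B_set n i j"
    | "(xe, g) \<notin> A_set n i j" "(xe, g) \<notin> B_set n i j" by blast
  then show ?thesis
  proof cases
    case 1
    have "Vw j (xe, h) = bvec ([RR j], [LL j], (?x, h))" for h
      unfolding Vw_def A[of h] f using 1 by (simp only: if_True)
    then show ?thesis by (rule key) simp_all
  next
    case 2
    have "Vw j (xe, h) = bvec ([LL j], [RR j], (?x, h))" for h
      unfolding Vw_def A[of h] B[of h] f using 2 by (simp only: if_True if_False)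
    then show ?thesis by (rule key) simp_all
  next
    case 3
    have V: "Vw j (xe, h) = 0" for h
      unfolding Vw_def A[of h] B[of h] using 3 by (simp only: if_False)
    have "compose (Lw m) (Vw j) = (\<Sum>t\<in>delta_loc g. 0)"
      unfolding Lw_def compose_sum_left mg snd_conv
      by (intro sum.cong refl) (simp add: lift_term_def V split: prod.split)
    then show ?thesis by (simp add: mg V Null_zero)
  qed
qed

lemma local_external_Null:
  assumes j: "j \<in> J" and m: "m \<in> X_basis n i"
  shows "compose (Lw m) (Vw j) + compose (Vw j m) Lw \<in> Null m"
  using j
proof (cases rule: J_cases)
  case left
  then show ?thesis using left_Null[OF j _ m] by simp
next
  case right
  then show ?thesis using right_Null[OF j _ m] by simp
next
  case far
  then show ?thesis using far_Null[OF j _ _ _ _ m] by simp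
qed

subsection \<open>External moves among themselves\<close>

text \<open>The letters U_j and C_j commute with all labels in their factors. The constant function
  appears because the unmoving term stays at m, so only the value f matters; this allows induction
  on f.\<close>

lemma unmoving_central:
  assumes j: "j \<in> J" and m: "m \<in> X_basis n i" and f: "f \<in> WS m"
  shows "compose f (Uw j) + compose (Uw j m) (\<lambda>_. f) \<in> Null m"
proof -
  have "Poly_Mapping.keys f \<subseteq> valid m" using f by simp
  then show ?thesis
  proof (induction f rule: bit_poly_induct)
    case zero
    then show ?case by (simp add: Null_zero Uw_def)
  next
    case (bvec t)
    obtain v w m' where t: "t = (v, w, m')" by (cases t)
    have vt: "(v, w, m') \<in> valid m" using bvec t by simp
    have "bvec (v @ [UU j], w @ [CC j], m') + bvec (UU j # v, CC j # w, m') \<in> Null m"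
      using valid_append[OF vt U_valid[OF j validD(1)[OF vt]]]
      by (intro Null_commute) (simp_all add: commuting_def)
    then show ?case by (simp add: t Uw_def)
  next
    case (add f g)
    have "compose (f + g) (Uw j) + compose (Uw j m) (\<lambda>_. f + g) =
        (compose f (Uw j) + compose (Uw j m) (\<lambda>_. f)) + (compose g (Uw j) + compose (Uw j m) (\<lambda>_. g))"
      by (simp add: compose_add_left compose_add_right add_ac)
    then show ?case using add Null_add by metis
  qed
qed

lemma compose_U_left: "compose (Uw j m) W = compose (Uw j m) (\<lambda>_. W m)"
  by (simp add: Uw_def)

lemma unmoving_central':
  assumes "j \<in> J" "m \<in> X_basis n i" "W m \<in> WS m"
  shows "compose (W m) (Uw j) + compose (Uw j m) W \<in> Null m"
  unfolding compose_U_left[of j m W] by (rule unmoving_central[OF assms])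

text \<open>Complementary external states never share a vertex, and among the local vertices only 1,
  that is i, can lie in both idempotents. Neither j - 1 nor j equals i.\<close>

lemma not_both:
  assumes "j \<in> J" "m \<in> X_basis n i" "k = j - 1 \<or> k = j"
  shows "\<not> (k \<in> idem1 i m \<and> k \<in> idem2 n i m)"
proof -
  obtain xe g where mg: "m = (xe, g)" by (cases m)
  have b: "(xe, g) \<in> X_basis n i" using assms(2) by (simp add: mg)
  have 0: "\<not> (0 \<in> gen_idem1 g \<and> 0 \<in> gen_idem2 g)" "\<not> (2 \<in> gen_idem1 g \<and> 2 \<in> gen_idem2 g)"
    by (induct g) simp_all
  have "k \<noteq> i" using assms(1,3) by auto
  then have "k \<in> {i - 1..i + 1} \<Longrightarrow> k + 1 - i = 0 \<or> k + 1 - i = 2" using i1 by auto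
  then show ?thesis
    unfolding mg mem_idem1[OF b] mem_idem2[OF b] using 0 by (cases "k \<in> {i - 1..i + 1}") auto
qed

lemma diagonal_Null:
  assumes j: "j \<in> J" and m: "m \<in> X_basis n i"
  shows "lin term_diff (Uw j m + Vw j m) + compose (Uw j m + Vw j m) (\<lambda>m. Uw j m + Vw j m) \<in> Null m"
proof -
  have uu: "([UU j], [UU j], m) \<in> valid m"
    using j m by (intro validI) (simp_all add: mem_paths J_labels idem1_subset idem2_subset)
  have dU: "lin term_diff (Uw j m) = bvec ([UU j], [UU j], m)"
    by (simp add: Uw_def term_diff_def lessThan_Suc)
  have dV: "lin term_diff (Vw j m) = 0"
    by (simp add: Vw_def term_diff_def lessThan_Suc)
  have UU: "compose (Uw j m) (Uw j) \<in> Null m"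
  proof -
    have "([UU j] @ [UU j], [CC j] @ [CC j], m) \<in> valid m"
      using valid_append U_valid[OF j m] by blast
    then show ?thesis
      using Null_vanish[of "[UU j, UU j]" "[CC j, CC j]" m m] wzero_CC by (simp add: Uw_def)
  qed
  have UV: "compose (Vw j m) (Uw j) + compose (Uw j m) (Vw j) \<in> Null m"
    by (rule unmoving_central'[where W = "Vw j", OF j m Vw_WS[OF j]])
  have VV: "bvec ([UU j], [UU j], m) + compose (Vw j m) (Vw j) \<in> Null m"
  proof -
    have pair: "bvec ([UU j], [UU j], m) + bvec ([a, b], [b, a], m) \<in> Null m"
      if v: "([a, b], [b, a], m) \<in> valid m" and ab: "inverse_labels a b" "inverse_labels b a" "idx a = j" "idx b = j" for a b
      using Null_pair(2)[OF v weq_inverse[OF ab(1)] weq_inverse[OF ab(2)]] ab(3,4) by (simp add: add.commute)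
    consider "m \<in> A_set n i j" | "m \<in> B_set n i j" | "m \<notin> A_set n i j" "m \<notin> B_set n i j" by blast
    then show ?thesis
    proof cases
      case 1
      let ?m = "flip i j m"
      have B: "?m \<in> B_set n i j" "?m \<notin> A_set n i j" using A_flip(1)[OF j 1] A_B_disjoint by blast+
      have "([RR j] @ [LL j], [LL j] @ [RR j], m) \<in> valid m"
        using valid_append[OF V_valid(1)[OF j 1] V_valid(2)[OF j B(1)]] A_flip(4)[OF j 1] by simp
      moreover have "compose (Vw j m) (Vw j) = bvec ([RR j, LL j], [LL j, RR j], m)"
        using 1 B A_flip(4)[OF j 1] by (simp add: Vw_def)
      ultimately show ?thesis using pair[of "RR j" "LL j"] by simp
    next
      case 2
      let ?m = "flip i j m"
      have A: "?m \<in> A_set n i j" "m \<notin> A_set n i j" using B_flip(1)[OF j 2] 2 A_B_disjoint by blast+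
      have "([LL j] @ [RR j], [RR j] @ [LL j], m) \<in> valid m"
        using valid_append[OF V_valid(2)[OF j 2] V_valid(1)[OF j A(1)]] B_flip(4)[OF j 2] by simp
      moreover have "compose (Vw j m) (Vw j) = bvec ([LL j, RR j], [RR j, LL j], m)"
        using 2 A B_flip(4)[OF j 2] by (simp add: Vw_def)
      ultimately show ?thesis using pair[of "LL j" "RR j"] by simp
    next
      case 3
      have "Vw j m = 0" using 3 by (simp add: Vw_def)
      \<comment> \<open>Each of j - 1 and j lies in at most one idempotent. If both idempotents met
        the pair, one would contain exactly j - 1 and the other exactly j, and a move would be
        possible. So U_j is zero in one of the factors.\<close>
      moreover have "(j - 1 \<notin> idem1 i m \<and> j \<notin> idem1 i m) \<or> (j - 1 \<notin> idem2 n i m \<and> j \<notin> idem2 n i m)"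
        using 3 m not_both[OF j m] unfolding A_set_iff B_set_iff by blast
      then have "bvec ([UU j], [UU j], m) \<in> Null m"
        using Null_vanish[OF uu] wzero_UU by blast
      ultimately show ?thesis by simp
    qed
  qed
  have "lin term_diff (Uw j m + Vw j m) + compose (Uw j m + Vw j m) (\<lambda>m. Uw j m + Vw j m) =
      compose (Uw j m) (Uw j) + (compose (Vw j m) (Uw j) + compose (Uw j m) (Vw j)) +
      (bvec ([UU j], [UU j], m) + compose (Vw j m) (Vw j))"
    by (simp add: lin_add compose_add_left compose_add_right dU dV add_ac)
  then show ?thesis using Null_add[OF Null_add[OF UU UV] VV] by simp
qed

text \<open>For \<open>|j - k| = 1\<close> every composite of the two moves contains a vanishing product in one of the
  two tensor factors.\<close>

lemma adjacent_moves:
  assumes jk: "k = Suc j \<or> j = Suc k" and 1: "1 \<le> j" "1 \<le> k"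
    and ab: "(a, b) = (RR j, LL j) \<or> (a, b) = (LL j, RR j)" and cd: "(c, d) = (RR k, LL k) \<or> (c, d) = (LL k, RR k)"
    and v: "([a, c], [b, d], m') \<in> valid m"
  shows "bvec ([a, c], [b, d], m') \<in> Null m"
proof (rule Null_vanish[OF v])
  have comp: "composable (idem1 i m) [a, c]"
    using validD(2)[OF v] unfolding mem_paths by blast
  \<comment> \<open>Equal directions in the first factor give R_j R_k with L_j L_k, or the reverse;
    one of the two is zero according to which index is larger. With opposite directions the first
    word is not even a path: the first step fills or empties the shared vertex against the needs of
    the second.\<close>
  consider "clash a c" | "clash b d" | "a = RR j" "c = LL k" | "a = LL j" "c = RR k"
    using jk ab cd by auto
  then show "wzero False n (idem1 i m) [a, c] \<or> wzero True n (idem2 n i m) [b, d]"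
  proof cases
    case 3
    then have "has_arrow (arrow_target (idem1 i m) (RR j)) (LL k)" using comp by simp
    then have "(k = j \<or> k \<in> idem1 i m \<and> k \<noteq> j - 1) \<and> \<not> (k - 1 = j \<or> k - 1 \<in> idem1 i m \<and> k - 1 \<noteq> j - 1)" unfolding has_arrow_iff[OF 1(2)] by simp
    then have False using jk 1(1) by (cases "k = Suc j"; cases j) simp_all
    then show ?thesis by (rule FalseE)
  next
    case 4
    then have "has_arrow (arrow_target (idem1 i m) (LL j)) (RR k)" using comp by simp
    then have "(k - 1 = j - 1 \<or> k - 1 \<in> idem1 i m \<and> k - 1 \<noteq> j) \<and> \<not> (k = j - 1 \<or> k \<in> idem1 i m \<and> k \<noteq> j)" unfolding has_arrow_iff[OF 1(2)] by simp
    then have False using jk 1(1) by (cases "k = Suc j"; cases j) simp_all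
    then show ?thesis by (rule FalseE)
  qed (use wzero_clash in blast)+
qed

lemma Vw_cases:
  obtains "Vw j m = 0" "m \<notin> A_set n i j" "m \<notin> B_set n i j"
  | a b where "(a, b) = (RR j, LL j) \<or> (a, b) = (LL j, RR j)" "Vw j m = bvec ([a], [b], flip i j m)"
      "m \<in> A_set n i j \<and> a = RR j \<or> m \<in> B_set n i j \<and> a = LL j"
proof -
  consider "m \<in> A_set n i j" | "m \<notin> A_set n i j" "m \<in> B_set n i j" | "m \<notin> A_set n i j" "m \<notin> B_set n i j" by blast
  then show ?thesis
  proof cases
    case 1
    then show ?thesis using that(2)[of "RR j" "LL j"] by (simp add: Vw_def)
  next
    case 2
    then show ?thesis using that(2)[of "LL j" "RR j"] by (simp add: Vw_def)
  next
    case 3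
    then show ?thesis using that(1) by (simp add: Vw_def)
  qed
qed

lemma adjacent_Null:
  assumes j: "j \<in> J" "k \<in> J" and jk: "k = Suc j \<or> j = Suc k"
  shows "compose (Vw j m) (Vw k) \<in> Null m"
proof (cases rule: Vw_cases[of j m])
  case 1
  then show ?thesis by (simp add: Null_zero)
next
  case (2 a b)
  show ?thesis
  proof (cases rule: Vw_cases[of k "flip i j m"])
    case 1
    then show ?thesis by (simp add: 2 Null_zero)
  next
    case c: (2 c d)
    let ?m = "flip i k (flip i j m)"
    have "([a], [b], flip i j m) \<in> valid m" "([c], [d], ?m) \<in> valid (flip i j m)"
      using Vw_WS[OF j(1), of m] Vw_WS[OF j(2), of "flip i j m"] by (simp_all add: 2(2) c(2))
    then have v: "([a, c], [b, d], ?m) \<in> valid m" using valid_append[of "[a]" "[b]" _ m "[c]" "[d]"] by simp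
    have "1 \<le> j" "1 \<le> k" using j by auto
    then have "bvec ([a, c], [b, d], ?m) \<in> Null m"
      using adjacent_moves[OF jk _ _ 2(1) c(1) v] by simp
    then show ?thesis by (simp add: 2(2) c(2))
  qed
qed

text \<open>The moves involve disjoint pairs of vertices, so neither affects whether, or in which
  direction, the other is possible. The words then commute, and both orders end at the same basis
  element.\<close>

lemma far_moves:
  assumes j: "j \<in> J" "k \<in> J" and jk: "j + 1 < k \<or> k + 1 < j" and m: "m \<in> X_basis n i"
  shows "compose (Vw j m) (Vw k) + compose (Vw k m) (Vw j) \<in> Null m"
proof -
  have stay: "flip i j m \<in> A_set n i k \<longleftrightarrow> m \<in> A_set n i k" "flip i j m \<in> B_set n i k \<longleftrightarrow> m \<in> B_set n i k"
    if j: "j \<in> J" "k \<in> J" and jk: "j + 1 < k \<or> k + 1 < j" and ne: "m \<in> A_set n i j \<or> m \<in> B_set n i j" for j k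
  proof -
    have ne': "k \<noteq> j" "k - 1 \<noteq> j" "k \<noteq> j - 1" "k - 1 \<noteq> j - 1" using jk j by auto
    have b: "flip i j m \<in> X_basis n i"
      using ne A_flip(1)[OF j(1), of m] B_flip(1)[OF j(1), of m] unfolding A_set_iff B_set_iff by blast
    have mem: "x \<in> idem1 i (flip i j m) \<longleftrightarrow> x \<in> idem1 i m" "x \<in> idem2 n i (flip i j m) \<longleftrightarrow> x \<in> idem2 n i m"
      if "x \<noteq> j" "x \<noteq> j - 1" for x
      using ne A_flip(2,3)[OF j(1), of m] B_flip(2,3)[OF j(1), of m] that by auto
    show "flip i j m \<in> A_set n i k \<longleftrightarrow> m \<in> A_set n i k" "flip i j m \<in> B_set n i k \<longleftrightarrow> m \<in> B_set n i k"
      unfolding A_set_iff B_set_iff using mem ne' b m by simp_all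
  qed
  show ?thesis
  proof (cases rule: Vw_cases[of j m])
    case 1
    have "compose (Vw k m) (Vw j) = 0"
    proof (cases rule: Vw_cases[of k m])
      case (2 a b)
      have "flip i k m \<notin> A_set n i j" "flip i k m \<notin> B_set n i j"
        using stay[OF j(2,1)] jk 2(3) 1 by blast+
      then have "Vw j (flip i k m) = 0" by (simp add: Vw_def)
      then show ?thesis by (simp add: 2(2))
    qed simp
    then show ?thesis by (simp add: 1 Null_zero)
  next
    case (2 a b)
    have mj: "m \<in> A_set n i j \<or> m \<in> B_set n i j" using 2(3) by blast
    show ?thesis
    proof (cases rule: Vw_cases[of k m])
      case 1
      have "flip i j m \<notin> A_set n i k" "flip i j m \<notin> B_set n i k"
        using stay[OF j jk mj] 1 by blast+
      then have "Vw k (flip i j m) = 0" by (simp add: Vw_def)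
      then show ?thesis by (simp add: 1 2(2) Null_zero)
    next
      case c: (2 c d)
      have mk: "m \<in> A_set n i k \<or> m \<in> B_set n i k" using c(3) by blast
      have kj: "k + 1 < j \<or> j + 1 < k" using jk by blast
      have Vk: "Vw k (flip i j m) = bvec ([c], [d], flip i k (flip i j m))"
        using stay[OF j jk mj] c A_B_disjoint[of m k] unfolding Vw_def by auto
      have Vj: "Vw j (flip i k m) = bvec ([a], [b], flip i j (flip i k m))"
        using stay[OF j(2,1) kj mk] 2 A_B_disjoint[of m j] unfolding Vw_def by auto
      have valid1: "([a], [b], flip i j m) \<in> valid m" "([c], [d], flip i k (flip i j m)) \<in> valid (flip i j m)"
        using Vw_WS[OF j(1), of m] Vw_WS[OF j(2), of "flip i j m"] by (simp_all add: 2(2) Vk)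
      have valid2: "([c], [d], flip i k m) \<in> valid m" "([a], [b], flip i j (flip i k m)) \<in> valid (flip i k m)"
        using Vw_WS[OF j(2), of m] Vw_WS[OF j(1), of "flip i k m"] by (simp_all add: c(2) Vj)
      have v1: "([a, c], [b, d], flip i k (flip i j m)) \<in> valid m"
        using valid_append[OF valid1] by simp
      have v2: "([c, a], [d, b], flip i j (flip i k m)) \<in> valid m"
        using valid_append[OF valid2] by simp
      have comm: "commuting a c" "commuting b d" using 2(1) c(1) jk unfolding commuting_def by auto
      have idx: "1 \<le> idx a" "1 \<le> idx b" "1 \<le> idx c" "1 \<le> idx d" using 2(1) c(1) j by auto
      have kind: "gen_kind (snd (flip i l x)) = gen_kind (snd x)" for l x
        by (simp add: flip_def flip_kind split: prod.split)
      \<comment> \<open>The ends are compared through their type and idempotents instead of the case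
        distinctions in \<open>flip\<close>; commuting arrows have equal targets.\<close>
      have "flip i k (flip i j m) = flip i j (flip i k m)"
      proof (rule basis_key_inj)
        show "idem1 i (flip i k (flip i j m)) = idem1 i (flip i j (flip i k m))"
          using validD(3)[OF v1] validD(3)[OF v2] commuting_arrows(2)[OF comm(1) idx(1,3), of "idem1 i m"] by simp
        show "idem2 n i (flip i k (flip i j m)) = idem2 n i (flip i j (flip i k m))"
          using validD(5)[OF v1] validD(5)[OF v2] commuting_arrows(2)[OF comm(2) idx(2,4), of "idem2 n i m"] by simp
      qed (use validD(1)[OF v1] validD(1)[OF v2] kind in simp_all)
      then show ?thesis
        using Null_pair(2)[OF v1 weq_swap[OF comm(1)] weq_swap[OF comm(2)]]
        by (simp add: 2(2) c(2) Vk Vj)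
    qed
  qed
qed

lemma offdiagonal_Null:
  assumes j: "j \<in> J" "k \<in> J" "j < k" and m: "m \<in> X_basis n i"
  shows "compose (Uw j m + Vw j m) (\<lambda>m. Uw k m + Vw k m) + compose (Uw k m + Vw k m) (\<lambda>m. Uw j m + Vw j m) \<in> Null m"
proof -
  have VV: "compose (Vw j m) (Vw k) + compose (Vw k m) (Vw j) \<in> Null m"
  proof (cases "k = Suc j")
    case True
    then show ?thesis using adjacent_Null[OF j(1,2)] adjacent_Null[OF j(2,1)] Null_add by simp
  next
    case False
    then show ?thesis using far_moves[OF j(1,2) _ m] j(3) by simp
  qed
  have 1: "compose (Uw k m + Vw k m) (Uw j) + compose (Uw j m) (\<lambda>m. Uw k m + Vw k m) \<in> Null m"
    by (rule unmoving_central'[where W = "\<lambda>m. Uw k m + Vw k m", OF j(1) m WS_add[OF Uw_WS[OF j(2) m] Vw_WS[OF j(2)]]])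
  have 2: "compose (Vw j m) (Uw k) + compose (Uw k m) (Vw j) \<in> Null m"
    by (rule unmoving_central'[where W = "Vw j", OF j(2) m Vw_WS[OF j(1)]])
  have "compose (Uw j m + Vw j m) (\<lambda>m. Uw k m + Vw k m) + compose (Uw k m + Vw k m) (\<lambda>m. Uw j m + Vw j m) =
    (compose (Vw j m) (Vw k) + compose (Vw k m) (Vw j)) +
    (compose (Uw k m + Vw k m) (Uw j) + compose (Uw j m) (\<lambda>m. Uw k m + Vw k m)) +
    (compose (Vw j m) (Uw k) + compose (Uw k m) (Vw j))"
    by (simp add: compose_add_left compose_add_right add_ac)
  then show ?thesis using Null_add[OF Null_add[OF VV 1] 2] by simp
qed

section \<open>The structure equation assembled from the four kinds of terms\<close>

lemma structure_equation:
  assumes m: "m \<in> X_basis n i" shows "lin term_diff (Dw m) + compose (Dw m) Dw \<in> Null m"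
proof -
  define E where "E = (\<lambda>j m. Uw j m + Vw j m)"
  have D: "Dw = (\<lambda>m. Lw m + (\<Sum>j\<in>J. E j m))" by (rule ext) (simp add: Dw_def E_def)
  have LE: "compose (Lw m) (E j) + compose (E j m) Lw \<in> Null m" if j: "j \<in> J" for j
  proof -
    have "compose (Lw m) (E j) + compose (E j m) Lw =
      (compose (Lw m) (Uw j) + compose (Uw j m) Lw) + (compose (Lw m) (Vw j) + compose (Vw j m) Lw)"
      by (simp add: E_def compose_add_left compose_add_right add_ac)
    then show ?thesis
      using Null_add[OF unmoving_central'[where W = Lw, OF j m Lw_WS[OF m]] local_external_Null[OF j m]] by simp
  qed
  \<comment> \<open>The square of a local plus an external part: the local square, the commutators
    with each external index, and a double sum over J that is regrouped by unordered pairs. The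
    derivatives of the external terms join the diagonal.\<close>
  have "lin term_diff (Dw m) + compose (Dw m) Dw =
    (lin term_diff (Lw m) + compose (Lw m) Lw) + (\<Sum>j\<in>J. compose (Lw m) (E j) + compose (E j m) Lw) +
    ((\<Sum>j\<in>J. lin term_diff (E j m)) + (\<Sum>j\<in>J. \<Sum>k\<in>J. compose (E j m) (E k)))"
    unfolding D by (simp add: lin_add lin_sum compose_add_left compose_add_right compose_sum_left
        compose_sum_right sum.distrib add_ac) (rule sum.swap)
  also have "(\<Sum>j\<in>J. lin term_diff (E j m)) + (\<Sum>j\<in>J. \<Sum>k\<in>J. compose (E j m) (E k)) =
    (\<Sum>j\<in>J. lin term_diff (E j m) + compose (E j m) (E j)) +
    (\<Sum>j\<in>J. \<Sum>k\<in>J. if j < k then compose (E j m) (E k) + compose (E k m) (E j) else 0)"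
    by (subst sum_offdiagonal) (simp_all add: sum.distrib add_ac)
  also have "(lin term_diff (Lw m) + compose (Lw m) Lw) + (\<Sum>j\<in>J. compose (Lw m) (E j) + compose (E j m) Lw) + \<dots> \<in> Null m"
  proof (rule Null_add[OF Null_add[OF local_Null[OF m]] Null_add])
    show "(\<Sum>j\<in>J. compose (Lw m) (E j) + compose (E j m) Lw) \<in> Null m" by (rule Null_sum) (rule LE)
    show "(\<Sum>j\<in>J. lin term_diff (E j m) + compose (E j m) (E j)) \<in> Null m"
      unfolding E_def by (rule Null_sum) (rule diagonal_Null[OF _ m])
    show "(\<Sum>j\<in>J. \<Sum>k\<in>J. if j < k then compose (E j m) (E k) + compose (E k m) (E j) else 0) \<in> Null m"
    proof (rule Null_sum, rule Null_sum)
      fix j k assume jk: "j \<in> J" "k \<in> J"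
      show "(if j < k then compose (E j m) (E k) + compose (E k m) (E j) else 0) \<in> Null m"
        unfolding E_def using offdiagonal_Null[OF jk _ m] Null_zero by simp
    qed
  qed
  finally show ?thesis .
qed

end

theorem theorem1p3:
  fixes n i :: nat
  assumes "2 \<le> n" and "1 \<le> i" and "i \<le> n - 1"
  shows "DD_bimodule n (X_module n i) (X_grading n i) (X_delta n i)"
proof -
  interpret X_setting n i by unfold_locales (fact assms)+
  show ?thesis by (rule DD_bimoduleI[OF structure_equation])
qed

end
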